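(* In dimension $n=2$, the second Dirichlet eigenvalue of the Laplacian $\lambda_2$ (which is $(-2)$-homogeneous) satisfies neither the Brunn-Minkowski inequality nor the Kneser-Süss inequality. That is, neither of the following two statements is true: $$\lambda_2^{-1/2}(K+L)\ \ge\ \lambda_2^{-1/2}(K)+\lambda_2^{-1/2}(L)\qquad\forall\,K,L\in\mathcal{K}^2,$$ $$\lambda_2^{-1/2}(K\stackrel{.}{+}L)\ \ge\ \lambda_2^{-1/2}(K)+\lambda_2^{-1/2}(L)\qquad\forall\,K,L\in\mathcal{K}_0^2 .$$
   Context: $\mathcal{K}^2$ is the class of compact convex sets in $\mathbb{R}^2$ and $\mathcal{K}_0^2$ the subclass of those with nonempty interior. For $K\in\mathcal{K}_0^2$, $\lambda_2(K)$ is the second eigenvalue (counted with multiplicity) of $-\Delta$ with homogeneous Dirichlet boundary conditions in the interior of $K$; for $K$ with empty interior, $\lambda_2(K)=+\infty$ and $\lambda_2^{-1/2}(K)=0$. $K+L$ is the Minkowski sum. An $\alpha$-homogeneous functional $F$ satisfies the Brunn-Minkowski inequality if $F^{1/\alpha}(K+L)\ge F^{1/\alpha}(K)+F^{1/\alpha}(L)$ for all convex bodies $K,L$ of $\mathbb{R}^n$, and the Kneser-Süss inequality if $F^{(n-1)/\alpha}(K\stackrel{.}{+}L)\ge F^{(n-1)/\alpha}(K)+F^{(n-1)/\alpha}(L)$ for all convex bodies $K,L$ of $\mathbb{R}^n$ with nonempty interior; here $n=2$, $\alpha=-2$. Blaschke addition: for a convex body $K$ with nonempty interior and Gauss map $\nu_K$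 (defined $\mathcal{H}^{n-1}$-a.e. on $\partial K$), let $\mu(K)[\omega]=\mathcal{H}^{n-1}(\nu_K^{-1}(\omega))$ for Borel $\omega\subseteq\mathbb{S}^{n-1}$; $K\stackrel{.}{+}L$ is the convex body with nonempty interior, unique up to translation, such that $\mu(K\stackrel{.}{+}L)=\mu(K)+\mu(L)$. *)

theory Defs
  imports "HOL-Analysis.Analysis"
begin

section \<open>Convex bodies\<close>

text \<open>The empty set is excluded: Minkowski addition would send every set to the empty set.\<close>

definition convex_bodies :: "'a::euclidean_space set set" where
  "convex_bodies = {K. convex K \<and> compact K \<and> K \<noteq> {}}"

definition solid_convex_bodies :: "'a::euclidean_space set set" where
  "solid_convex_bodies = {K \<in> convex_bodies. interior K \<noteq> {}}"


section \<open>The Dirichlet spectrum of the Laplacian\<close>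

definition square_integrable_on :: "'a::euclidean_space set \<Rightarrow> ('a \<Rightarrow> 'b::euclidean_space) \<Rightarrow> bool" where
  "square_integrable_on \<Omega> u \<longleftrightarrow>
     u \<in> borel_measurable (lebesgue_on \<Omega>) \<and> integrable (lebesgue_on \<Omega>) (\<lambda>x. (norm (u x))\<^sup>2)"

text \<open>\<open>test_function \<Omega> \<phi> D\<phi>\<close>: \<open>\<phi>\<close> is of class \<open>C\<^sup>1\<close> with compact support in \<open>\<Omega>\<close> and gradient \<open>D\<phi>\<close>.\<close>

definition test_function :: "'a::euclidean_space set \<Rightarrow> ('a \<Rightarrow> real) \<Rightarrow> ('a \<Rightarrow> 'a) \<Rightarrow> bool" where
  "test_function \<Omega> \<phi> D\<phi> \<longleftrightarrow>
     (\<forall>x. GDERIV \<phi> x :> D\<phi> x) \<and> continuous_on UNIV D\<phi> \<and>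
     compact (closure {x. \<phi> x \<noteq> 0}) \<and> closure {x. \<phi> x \<noteq> 0} \<subseteq> \<Omega>"

text \<open>\<open>H10 \<Omega> u g\<close>: \<open>u\<close> belongs to the Sobolev space \<open>H\<^sup>1\<^sub>0(\<Omega>)\<close>, the closure of
  \<open>C\<^sup>1\<^sub>c(\<Omega>)\<close> in the \<open>H\<^sup>1\<close> norm, and \<open>g\<close> is (a representative of) its weak gradient.  By
  mollification, starting from smooth test functions gives the same space.\<close>

definition H10 :: "'a::euclidean_space set \<Rightarrow> ('a \<Rightarrow> real) \<Rightarrow> ('a \<Rightarrow> 'a) \<Rightarrow> bool" where
  "H10 \<Omega> u g \<longleftrightarrow>
     square_integrable_on \<Omega> u \<and> square_integrable_on \<Omega> g \<and>
     (\<exists>\<phi> D\<phi>. (\<forall>n::nat. test_function \<Omega> (\<phi> n) (D\<phi> n)) \<and>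
        (\<lambda>n. LINT x|lebesgue_on \<Omega>. (\<phi> n x - u x)\<^sup>2) \<longlonglongrightarrow> 0 \<and>
        (\<lambda>n. LINT x|lebesgue_on \<Omega>. (norm (D\<phi> n x - g x))\<^sup>2) \<longlonglongrightarrow> 0)"

text \<open>The weak solutions in \<open>H\<^sup>1\<^sub>0(\<Omega>)\<close> of \<open>- \<Delta>u = \<mu> u\<close>, including \<open>u = 0\<close>.\<close>

definition dirichlet_eigenspace :: "'a::euclidean_space set \<Rightarrow> real \<Rightarrow> ('a \<Rightarrow> real) set" where
  "dirichlet_eigenspace \<Omega> \<mu> =
     {u. \<exists>g. H10 \<Omega> u g \<and>
        (\<forall>v h. H10 \<Omega> v h \<longrightarrow>
           (LINT x|lebesgue_on \<Omega>. g x \<bullet> h x) = \<mu> * (LINT x|lebesgue_on \<Omega>. u x * v x))}"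

definition dirichlet_spectrum :: "'a::euclidean_space set \<Rightarrow> real set" where
  "dirichlet_spectrum \<Omega> =
     {\<mu>. \<exists>u \<in> dirichlet_eigenspace \<Omega> \<mu>. \<not> (AE x in lebesgue_on \<Omega>. u x = 0)}"

text \<open>The dimension of the eigenspace, functions being identified when they agree almost
  everywhere: the supremum of the lengths of linearly independent families.\<close>

definition dirichlet_multiplicity :: "'a::euclidean_space set \<Rightarrow> real \<Rightarrow> enat" where
  "dirichlet_multiplicity \<Omega> \<mu> =
     Sup {enat n | n. \<exists>u. (\<forall>i<n. u i \<in> dirichlet_eigenspace \<Omega> \<mu>) \<and>
        (\<forall>c :: nat \<Rightarrow> real.
           (AE x in lebesgue_on \<Omega>. (\<Sum>i<n. c i * u i x) = 0) \<longrightarrow> (\<forall>i<n. c i = 0))}"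

text \<open>The \<open>k\<close>-th eigenvalue (\<open>k \<ge> 1\<close>) counted with multiplicity: the least \<open>t\<close> for which the
  multiplicities of the eigenvalues not exceeding \<open>t\<close> add up to at least \<open>k\<close>.\<close>

definition dirichlet_eigenvalue :: "nat \<Rightarrow> 'a::euclidean_space set \<Rightarrow> ereal" where
  "dirichlet_eigenvalue k \<Omega> =
     Inf {ereal t | t. \<exists>F. finite F \<and> F \<subseteq> dirichlet_spectrum \<Omega> \<inter> {..t} \<and>
        enat k \<le> (\<Sum>\<mu>\<in>F. dirichlet_multiplicity \<Omega> \<mu>)}"

definition lambda2 :: "(real ^ 2) set \<Rightarrow> ereal" where
  "lambda2 K = (if interior K = {} then \<infinity> else dirichlet_eigenvalue 2 (interior K))"

text \<open>The value of \<open>\<lambda>\<^sub>2\<close> raised to the power \<open>-1/2\<close>, which is 0 where \<open>\<lambda>\<^sub>2\<close> is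
  infinite; if \<open>K\<close> is bounded with nonempty interior, \<open>\<lambda>\<^sub>2\<close> is a positive real number.\<close>

definition lambda2_inv_sqrt :: "(real ^ 2) set \<Rightarrow> real" where
  "lambda2_inv_sqrt K =
     (if interior K = {} then 0 else real_of_ereal (lambda2 K) powr (- 1 / 2))"


section \<open>Blaschke addition in the plane\<close>

text \<open>The one-dimensional Hausdorff (outer) measure; in dimension one the normalising constant
  of the Hausdorff measure is 1.\<close>

definition hausdorff1 :: "'a::metric_space set \<Rightarrow> ennreal" where
  "hausdorff1 A =
     (SUP \<delta>\<in>{0::real<..}. INF C\<in>{C :: nat \<Rightarrow> 'a set.
         A \<subseteq> (\<Union>i. C i) \<and> (\<forall>i. bounded (C i) \<and> diameter (C i) \<le> \<delta>)}.
       (\<Sum>i. ennreal (diameter (C i))))"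

definition outer_unit_normals :: "'a::euclidean_space set \<Rightarrow> 'a \<Rightarrow> 'a set" where
  "outer_unit_normals K x = {\<nu>. norm \<nu> = 1 \<and> (\<forall>y\<in>K. \<nu> \<bullet> (y - x) \<le> 0)}"

text \<open>The preimage of \<open>\<omega>\<close> under the Gauss map, whose domain consists of the boundary points with
  exactly one outer unit normal.\<close>

definition gauss_preimage :: "'a::euclidean_space set \<Rightarrow> 'a set \<Rightarrow> 'a set" where
  "gauss_preimage K \<omega> = {x \<in> frontier K. \<exists>\<nu>\<in>\<omega>. outer_unit_normals K x = {\<nu>}}"

definition surface_area_measure :: "(real ^ 2) set \<Rightarrow> (real ^ 2) set \<Rightarrow> ennreal" where
  "surface_area_measure K \<omega> = hausdorff1 (gauss_preimage K \<omega>)"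

text \<open>Blaschke addition determines its result only up to translation, so it is rendered as a
  relation: \<open>M\<close> is one of the representatives of the Blaschke sum of \<open>K\<close> and \<open>L\<close>.\<close>

definition is_blaschke_sum :: "(real ^ 2) set \<Rightarrow> (real ^ 2) set \<Rightarrow> (real ^ 2) set \<Rightarrow> bool" where
  "is_blaschke_sum K L M \<longleftrightarrow>
     M \<in> solid_convex_bodies \<and>
     (\<forall>\<omega>. \<omega> \<in> sets borel \<and> \<omega> \<subseteq> sphere 0 1 \<longrightarrow>
        surface_area_measure M \<omega> = surface_area_measure K \<omega> + surface_area_measure L \<omega>)"

end

theory Submission
  imports Defs
begin

text \<open>
  Both inequalities already fail for rectangles.  Separation of variables gives the Dirichlet
  spectrum of an \<open>a \<times> b\<close> rectangle as the numbers \<open>\<pi>\<^sup>2 (m\<^sup>2/a\<^sup>2 + n\<^sup>2/b\<^sup>2)\<close> with \<open>m, n \<ge> 1\<close>, and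
  hence \<open>\<lambda>\<^sub>2 = \<pi>\<^sup>2 min (4/a\<^sup>2 + 1/b\<^sup>2) (1/a\<^sup>2 + 4/b\<^sup>2)\<close>.  As a function of the pair of side lengths,
  \<open>\<lambda>\<^sub>2\<close> raised to the power \<open>-1/2\<close> is therefore the maximum of two concave functions which agree on
  the diagonal \<open>a = b\<close>: the nodal line of the second mode always cuts the longer side, and the
  two competing modes cross at the square.  The maximum has a convex kink there, so concavity
  fails across the diagonal.

  Concretely, for \<open>K = [0,3] \<times> [0,2]\<close> and \<open>L = [0,2] \<times> [0,3]\<close> both values are \<open>6/(5\<pi>)\<close>.  The
  Minkowski sum of \<open>K\<close> and \<open>L\<close> is the square \<open>[0,5] \<times> [0,5]\<close>, whose value is
  \<open>\<surd>5/\<pi> < 12/(5\<pi>)\<close>.  This square is also their Blaschke sum: the surface area measure of a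
  rectangle consists of four point masses, at the coordinate directions, whose weights are the side
  lengths, and these add up.  So one pair of rectangles refutes both inequalities.

  The value of \<open>\<lambda>\<^sub>2\<close> on rectangles (lemma \<open>lambda2_rectangle\<close>) has to be obtained from the weak
  formulation.  The products of sines belong to \<open>H\<^sup>1\<^sub>0\<close> (\<open>H10_if_C1_zero_on_frontier\<close>); a Green
  identity against them holds for every element of \<open>H\<^sup>1\<^sub>0\<close> (\<open>H10_green_sine_mode\<close>), so that an
  eigenfunction is orthogonal to all modes belonging to other eigenvalues; and the modes are
  complete (\<open>sine_modes_complete\<close>), so that nothing else is in the spectrum and the first eigenvalue
  is simple.  For the Blaschke sum one needs that the one-dimensional Hausdorff measure of finitely
  many disjoint open segments is their total length (\<open>hausdorff1_Union_open_segments\<close>).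
  Homogeneity of \<open>\<lambda>\<^sub>2\<close> follows by transporting \<open>H\<^sup>1\<^sub>0\<close>, eigenspaces and multiplicities
  along a dilation.
\<close>


section \<open>Behaviour of the Dirichlet spectrum under dilations\<close>

lemma scaleR_measurable_lebesgue_on:
  fixes S :: "'a::euclidean_space set"
  assumes S: "S \<in> sets lebesgue" and t: "t > 0"
  shows "(\<lambda>x. t *\<^sub>R x) \<in> lebesgue_on S \<rightarrow>\<^sub>M lebesgue_on ((\<lambda>x. t *\<^sub>R x) ` S)"
proof -
  have "(\<lambda>x. t *\<^sub>R x) \<in> lebesgue \<rightarrow>\<^sub>M (lebesgue :: 'a measure)"
    using lebesgue_measurable_scaling by simp
  then show ?thesis
    by (auto intro!: measurable_restrict_space3 simp: space_restrict_space)
qed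

lemma scaleR_image_lebesgue_sets:
  fixes S :: "'a::euclidean_space set"
  assumes S: "S \<in> sets lebesgue" and t: "t > 0"
  shows "(\<lambda>x. t *\<^sub>R x) ` S \<in> sets lebesgue"
proof -
  have "(\<lambda>x. t *\<^sub>R x) ` S = (\<lambda>x. (1/t) *\<^sub>R x) -` S \<inter> space lebesgue"
    using t by (force simp: image_iff)
  then show ?thesis
    using measurable_sets[OF lebesgue_measurable_scaling S, of "1/t"] by simp
qed

text \<open>Written as an equality of measures, so that integrals and integrability can be transported by
  the general lemmas on densities and image measures.\<close>

lemma lebesgue_on_scaleR:
  fixes S :: "'a::euclidean_space set"
  assumes S: "S \<in> sets lebesgue" and t: "t > 0"
  shows "lebesgue_on ((\<lambda>x. t *\<^sub>R x) ` S) =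
    density (distr (lebesgue_on S) (lebesgue_on ((\<lambda>x. t *\<^sub>R x) ` S)) (\<lambda>x. t *\<^sub>R x))
      (\<lambda>_. ennreal (t ^ DIM('a)))"
    (is "lebesgue_on ?T = density ?D _")
proof (rule measure_eqI)
  note T = scaleR_image_lebesgue_sets[OF S t]
  show "sets (lebesgue_on ?T) = sets (density ?D (\<lambda>_. ennreal (t ^ DIM('a))))"
    by simp
  fix A assume A: "A \<in> sets (lebesgue_on ?T)"
  then have A': "A \<subseteq> ?T" "A \<in> sets lebesgue"
    using T by (auto simp: sets_restrict_space_iff)
  let ?P = "(\<lambda>x. t *\<^sub>R x) -` A \<inter> S"
  have P: "?P \<in> sets (lebesgue_on S)"
    using measurable_sets[OF scaleR_measurable_lebesgue_on[OF S t] A] S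
    by (simp add: space_restrict_space)
  have im: "(\<lambda>x. t *\<^sub>R x) ` ?P = A"
    using A' by (force simp: image_iff)
  have "emeasure (lebesgue_on ?T) A = emeasure lebesgue A"
    using A' T by (simp add: emeasure_restrict_space)
  also have "\<dots> = ennreal (t ^ DIM('a)) * emeasure lebesgue ?P"
    using emeasure_lebesgue_affine[of t 0 ?P] t im by (simp add: ennreal_power)
  also have "emeasure lebesgue ?P = emeasure (lebesgue_on S) ?P"
    using S by (simp add: emeasure_restrict_space)
  also have "\<dots> = emeasure ?D A"
    using scaleR_measurable_lebesgue_on[OF S t] A
    by (simp add: emeasure_distr space_restrict_space)
  also have "ennreal (t ^ DIM('a)) * \<dots> = emeasure (density ?D (\<lambda>_. ennreal (t ^ DIM('a)))) A"
    using A by (simp add: emeasure_density_const)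
  finally show "emeasure (lebesgue_on ?T) A = emeasure (density ?D (\<lambda>_. ennreal (t ^ DIM('a)))) A" .
qed

lemma test_function_measurable:
  assumes "test_function S \<phi> D"
  shows "\<phi> \<in> borel_measurable (lebesgue_on X)" "D \<in> borel_measurable (lebesgue_on X)"
proof -
  have "continuous_on UNIV \<phi>"
    using assms unfolding test_function_def gderiv_def
    by (auto intro!: has_derivative_continuous continuous_at_imp_continuous_on)
  then have "\<phi> \<in> borel_measurable borel" by (rule borel_measurable_continuous_onI)
  then have "\<phi> \<in> borel_measurable lebesgue" by (simp add: measurable_completion)
  then show "\<phi> \<in> borel_measurable (lebesgue_on X)"
    by (rule measurable_restrict_space1)
  have "D \<in> borel_measurable borel"
    using assms by (auto simp: test_function_def intro: borel_measurable_continuous_onI)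
  then have "D \<in> borel_measurable lebesgue" by (simp add: measurable_completion)
  then show "D \<in> borel_measurable (lebesgue_on X)"
    by (rule measurable_restrict_space1)
qed

context
  fixes S :: "'a::euclidean_space set" and t :: real and T :: "'a set"
  assumes S: "S \<in> sets lebesgue" and t: "t > 0" and T_def: "T = (\<lambda>x. t *\<^sub>R x) ` S"
begin

lemma scaled_sets: "T \<in> sets lebesgue" and scaled_back: "S = (\<lambda>x. (1/t) *\<^sub>R x) ` T"
  using S t scaleR_image_lebesgue_sets[OF S t] unfolding T_def
  by (auto simp: image_image)

lemma scaled_measurable:
  "f \<in> borel_measurable (lebesgue_on S) \<Longrightarrow> (\<lambda>x. f ((1/t) *\<^sub>R x)) \<in> borel_measurable (lebesgue_on T)"
  using measurable_compose[OF scaleR_measurable_lebesgue_on[OF scaled_sets, of "1/t"]] t scaled_back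
  by auto

lemma scaled_integrable:
  fixes f :: "'a \<Rightarrow> real"
  assumes "integrable (lebesgue_on S) f"
  shows "integrable (lebesgue_on T) (\<lambda>x. f ((1/t) *\<^sub>R x))"
proof -
  have "f \<in> borel_measurable (lebesgue_on S)" using assms by auto
  note m = scaled_measurable[OF this]
  have "integrable (distr (lebesgue_on S) (lebesgue_on T) (\<lambda>x. t *\<^sub>R x)) (\<lambda>x. f ((1/t) *\<^sub>R x))"
    using integrable_distr_eq[OF scaleR_measurable_lebesgue_on[OF S t], folded T_def, OF m] assms t
    by simp
  then show ?thesis
    apply (subst T_def, subst lebesgue_on_scaleR[OF S t], fold T_def)
    using m t by (subst integrable_density) auto
qed

lemma scaled_integral:
  fixes f :: "'a \<Rightarrow> real"
  assumes m0: "f \<in> borel_measurable (lebesgue_on S)"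
  shows "(LINT x|lebesgue_on T. f ((1/t) *\<^sub>R x)) = t ^ DIM('a) * (LINT x|lebesgue_on S. f x)"
proof -
  note m = scaled_measurable[OF m0]
  have "(LINT x|lebesgue_on T. f ((1/t) *\<^sub>R x)) =
    (LINT x|density (distr (lebesgue_on S) (lebesgue_on T) (\<lambda>x. t *\<^sub>R x)) (\<lambda>_. ennreal (t ^ DIM('a))).
      f ((1/t) *\<^sub>R x))"
    using lebesgue_on_scaleR[OF S t, folded T_def] by simp
  also have "\<dots> = (LINT x|distr (lebesgue_on S) (lebesgue_on T) (\<lambda>x. t *\<^sub>R x). t ^ DIM('a) * f ((1/t) *\<^sub>R x))"
    using m t by (subst integral_density) auto
  also have "\<dots> = t ^ DIM('a) * (LINT x|distr (lebesgue_on S) (lebesgue_on T) (\<lambda>x. t *\<^sub>R x). f ((1/t) *\<^sub>R x))"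
    by simp
  also have "(LINT x|distr (lebesgue_on S) (lebesgue_on T) (\<lambda>x. t *\<^sub>R x). f ((1/t) *\<^sub>R x)) = (LINT x|lebesgue_on S. f x)"
    using integral_distr[OF scaleR_measurable_lebesgue_on[OF S t], folded T_def, OF m] t by simp
  finally show ?thesis .
qed

lemma scaled_AE:
  assumes "AE x in lebesgue_on T. P ((1/t) *\<^sub>R x)"
  shows "AE x in lebesgue_on S. P x"
proof -
  have "AE x in lebesgue. x \<in> T \<longrightarrow> P ((1/t) *\<^sub>R x)"
    using assms scaled_sets by (simp add: AE_restrict_space_iff)
  then obtain N where "{x \<in> space lebesgue. \<not> (x \<in> T \<longrightarrow> P ((1/t) *\<^sub>R x))} \<subseteq> N"
    "emeasure lebesgue N = 0" "N \<in> sets lebesgue"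
    by (rule AE_E)
  then have N: "N \<in> null_sets lebesgue" "\<And>x. x \<in> T - N \<Longrightarrow> P ((1/t) *\<^sub>R x)"
    by auto
  let ?N = "(\<lambda>x. (1/t) *\<^sub>R x) ` N"
  have "?N \<in> null_sets lebesgue"
    using N(1) t emeasure_lebesgue_affine[of "1/t" 0 N] scaleR_image_lebesgue_sets[of N "1/t"]
    by (auto simp: null_sets_def)
  moreover have "P x" if "x \<in> S - ?N" for x
  proof -
    have "t *\<^sub>R x \<in> T" "t *\<^sub>R x \<notin> N"
      using that t unfolding T_def by (auto simp: image_iff)
    then have "t *\<^sub>R x \<in> T - N" by simp
    from N(2)[OF this] t show ?thesis by simp
  qed
  ultimately show ?thesis using S
    by (subst AE_restrict_space_iff) (auto simp: eventually_ae_filter intro!: bexI[of _ ?N])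
qed

lemma square_integrable_on_scale:
  assumes "square_integrable_on S u"
  shows "square_integrable_on T (\<lambda>x. u ((1/t) *\<^sub>R x))"
  using assms scaled_measurable scaled_integrable[of "\<lambda>x. (norm (u x))\<^sup>2"]
  unfolding square_integrable_on_def by auto

lemma test_function_scale:
  assumes "test_function S \<phi> D"
  shows "test_function T (\<lambda>x. \<phi> ((1/t) *\<^sub>R x)) (\<lambda>x. (1/t) *\<^sub>R D ((1/t) *\<^sub>R x))"
  unfolding test_function_def
proof (intro conjI allI)
  fix x :: 'a
  have "((\<lambda>x. (1/t) *\<^sub>R x) has_derivative (\<lambda>h. (1/t) *\<^sub>R h)) (at x)"
    by (auto intro!: derivative_eq_intros)
  moreover have "(\<phi> has_derivative (\<lambda>h. h \<bullet> D ((1/t) *\<^sub>R x))) (at ((1/t) *\<^sub>R x))"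
    using assms by (auto simp: test_function_def gderiv_def)
  ultimately show "GDERIV (\<lambda>x. \<phi> ((1/t) *\<^sub>R x)) x :> (1/t) *\<^sub>R D ((1/t) *\<^sub>R x)"
    unfolding gderiv_def using has_derivative_compose by fastforce
next
  have "continuous_on UNIV D" using assms by (simp add: test_function_def)
  then show "continuous_on UNIV (\<lambda>x. (1/t) *\<^sub>R D ((1/t) *\<^sub>R x))"
    by (auto intro!: continuous_intros continuous_on_compose2[of UNIV D])
next
  have *: "{x. \<phi> ((1/t) *\<^sub>R x) \<noteq> 0} = (\<lambda>x. t *\<^sub>R x) ` {x. \<phi> x \<noteq> 0}"
  proof (intro equalityI subsetI)
    fix x assume "x \<in> {x. \<phi> ((1/t) *\<^sub>R x) \<noteq> 0}"
    then show "x \<in> (\<lambda>x. t *\<^sub>R x) ` {x. \<phi> x \<noteq> 0}"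
      using t by (intro image_eqI[of _ _ "(1/t) *\<^sub>R x"]) auto
  qed (use t in auto)
  have **: "closure {x. \<phi> ((1/t) *\<^sub>R x) \<noteq> 0} = (\<lambda>x. t *\<^sub>R x) ` closure {x. \<phi> x \<noteq> 0}"
    unfolding * by (simp add: closure_scaleR)
  show "compact (closure {x. \<phi> ((1/t) *\<^sub>R x) \<noteq> 0})"
    unfolding ** using assms by (simp add: test_function_def compact_scaling)
  show "closure {x. \<phi> ((1/t) *\<^sub>R x) \<noteq> 0} \<subseteq> T"
    unfolding ** T_def using assms by (auto simp: test_function_def)
qed

text \<open>The factor \<open>1/t\<close> in the gradient comes from the chain rule; the approximating test
  functions are dilated along with \<open>u\<close>, and their squared distances are only
  multiplied by powers of \<open>t\<close>.\<close>

lemma H10_scale: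
  assumes "H10 S u g"
  shows "H10 T (\<lambda>x. u ((1/t) *\<^sub>R x)) (\<lambda>x. (1/t) *\<^sub>R g ((1/t) *\<^sub>R x))"
proof -
  obtain \<phi> D where tf: "\<And>n::nat. test_function S (\<phi> n) (D n)"
    and l1: "(\<lambda>n. LINT x|lebesgue_on S. (\<phi> n x - u x)\<^sup>2) \<longlonglongrightarrow> 0"
    and l2: "(\<lambda>n. LINT x|lebesgue_on S. (norm (D n x - g x))\<^sup>2) \<longlonglongrightarrow> 0"
    and u: "square_integrable_on S u" and g: "square_integrable_on S g"
    using assms by (auto simp: H10_def)
  have um[measurable]: "u \<in> borel_measurable (lebesgue_on S)" "g \<in> borel_measurable (lebesgue_on S)"
    using u g by (auto simp: square_integrable_on_def)
  note [measurable] = test_function_measurable[OF tf, where X = S]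
  have "square_integrable_on S (\<lambda>x. (1/t) *\<^sub>R g x)"
    using g by (auto simp: square_integrable_on_def power_divide)
  from square_integrable_on_scale[OF this] square_integrable_on_scale[OF u]
  have sq: "square_integrable_on T (\<lambda>x. u ((1/t) *\<^sub>R x))"
    "square_integrable_on T (\<lambda>x. (1/t) *\<^sub>R g ((1/t) *\<^sub>R x))" by auto
  have "(LINT x|lebesgue_on T. (\<phi> n ((1/t) *\<^sub>R x) - u ((1/t) *\<^sub>R x))\<^sup>2)
      = t ^ DIM('a) * (LINT x|lebesgue_on S. (\<phi> n x - u x)\<^sup>2)" for n
    by (rule scaled_integral) measurable
  then have c1: "(\<lambda>n. LINT x|lebesgue_on T. (\<phi> n ((1/t) *\<^sub>R x) - u ((1/t) *\<^sub>R x))\<^sup>2) \<longlonglongrightarrow> 0"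
    using tendsto_mult_right_zero[OF l1] by simp
  have "(LINT x|lebesgue_on T. (norm ((1/t) *\<^sub>R D n ((1/t) *\<^sub>R x) - (1/t) *\<^sub>R g ((1/t) *\<^sub>R x)))\<^sup>2)
      = (t ^ DIM('a) / t\<^sup>2) * (LINT x|lebesgue_on S. (norm (D n x - g x))\<^sup>2)" for n
  proof -
    have "(norm ((1/t) *\<^sub>R a - (1/t) *\<^sub>R b))\<^sup>2 = (1/t)\<^sup>2 * (norm (a - b))\<^sup>2" for a b :: 'a
      by (simp flip: scaleR_right_diff_distrib add: power_mult_distrib power_divide)
    moreover have "(LINT x|lebesgue_on T. (norm (D n ((1/t) *\<^sub>R x) - g ((1/t) *\<^sub>R x)))\<^sup>2)
      = t ^ DIM('a) * (LINT x|lebesgue_on S. (norm (D n x - g x))\<^sup>2)"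
      by (rule scaled_integral) measurable
    ultimately show ?thesis by (simp add: power_divide)
  qed
  then have c2: "(\<lambda>n. LINT x|lebesgue_on T. (norm ((1/t) *\<^sub>R D n ((1/t) *\<^sub>R x) - (1/t) *\<^sub>R g ((1/t) *\<^sub>R x)))\<^sup>2) \<longlonglongrightarrow> 0"
    using tendsto_mult_right_zero[OF l2, of "t ^ DIM('a) / t\<^sup>2"] by (simp only:)
  show ?thesis
    unfolding H10_def using sq c1 c2 test_function_scale[OF tf]
    by (intro conjI exI[of _ "\<lambda>n x. \<phi> n ((1/t) *\<^sub>R x)"]
        exI[of _ "\<lambda>n x. (1/t) *\<^sub>R D n ((1/t) *\<^sub>R x)"]) auto
qed

end

text \<open>An arbitrary element of \<open>H\<^sup>1\<^sub>0\<close> of the dilated domain is pulled back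
  with factor \<open>1/t\<close>; both sides of the weak equation then pick up the same Jacobian,
  and the two gradients on the left contribute the factor \<open>t\<^sup>-\<^sup>2\<close>.\<close>

lemma dirichlet_eigenspace_scale:
  fixes S :: "'a::euclidean_space set"
  assumes S: "S \<in> sets lebesgue" and t: "t > 0"
    and u: "u \<in> dirichlet_eigenspace S \<mu>"
  shows "(\<lambda>x. u ((1/t) *\<^sub>R x)) \<in> dirichlet_eigenspace ((\<lambda>x. t *\<^sub>R x) ` S) (\<mu> / t\<^sup>2)"
proof -
  define T where "T = (\<lambda>x. t *\<^sub>R x) ` S"
  note T = scaled_sets[OF S t T_def] and sback = scaled_back[OF S t T_def]
  obtain g where H: "H10 S u g"
    and eq: "\<And>v h. H10 S v h \<Longrightarrow>
           (LINT x|lebesgue_on S. g x \<bullet> h x) = \<mu> * (LINT x|lebesgue_on S. u x * v x)"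
    using u by (auto simp: dirichlet_eigenspace_def)
  have "(LINT x|lebesgue_on T. ((1/t) *\<^sub>R g ((1/t) *\<^sub>R x)) \<bullet> h x)
      = (\<mu> / t\<^sup>2) * (LINT x|lebesgue_on T. u ((1/t) *\<^sub>R x) * v x)" if vh: "H10 T v h" for v h
  proof -
    have H': "H10 S (\<lambda>x. v (t *\<^sub>R x)) (\<lambda>x. t *\<^sub>R h (t *\<^sub>R x))"
      using H10_scale[OF T _ sback vh] t by simp
    have [measurable]: "u \<in> borel_measurable (lebesgue_on S)" "g \<in> borel_measurable (lebesgue_on S)"
      "(\<lambda>x. v (t *\<^sub>R x)) \<in> borel_measurable (lebesgue_on S)"
      "(\<lambda>x. t *\<^sub>R h (t *\<^sub>R x)) \<in> borel_measurable (lebesgue_on S)"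
      using H H' by (auto simp: H10_def square_integrable_on_def)
    have "(LINT x|lebesgue_on T. g ((1/t) *\<^sub>R x) \<bullet> (t *\<^sub>R h (t *\<^sub>R ((1/t) *\<^sub>R x))))
      = t ^ DIM('a) * (LINT x|lebesgue_on S. g x \<bullet> (t *\<^sub>R h (t *\<^sub>R x)))"
      by (rule scaled_integral[OF S t T_def]) measurable
    moreover have "(LINT x|lebesgue_on T. u ((1/t) *\<^sub>R x) * v (t *\<^sub>R ((1/t) *\<^sub>R x)))
      = t ^ DIM('a) * (LINT x|lebesgue_on S. u x * v (t *\<^sub>R x))"
      by (rule scaled_integral[OF S t T_def]) measurable
    ultimately show ?thesis
      using eq[OF H'] t by (simp add: field_simps power2_eq_square)
  qed
  then show ?thesis
    unfolding T_def[symmetric] dirichlet_eigenspace_def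
    using H10_scale[OF S t T_def H] by blast
qed

lemma dirichlet_spectrum_scale:
  fixes S :: "'a::euclidean_space set"
  assumes S: "S \<in> sets lebesgue" and t: "t > 0" and \<mu>: "\<mu> \<in> dirichlet_spectrum S"
  shows "\<mu> / t\<^sup>2 \<in> dirichlet_spectrum ((\<lambda>x. t *\<^sub>R x) ` S)"
proof -
  obtain u where "u \<in> dirichlet_eigenspace S \<mu>" "\<not> (AE x in lebesgue_on S. u x = 0)"
    using \<mu> by (auto simp: dirichlet_spectrum_def)
  then have "(\<lambda>x. u ((1/t) *\<^sub>R x)) \<in> dirichlet_eigenspace ((\<lambda>x. t *\<^sub>R x) ` S) (\<mu> / t\<^sup>2)"
    and "\<not> (AE x in lebesgue_on ((\<lambda>x. t *\<^sub>R x) ` S). u ((1/t) *\<^sub>R x) = 0)"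
    using dirichlet_eigenspace_scale[OF S t] scaled_AE[OF S t refl, of "\<lambda>x. u x = 0"] by blast+
  then show ?thesis
    unfolding dirichlet_spectrum_def by (auto intro!: bexI[of _ "\<lambda>x. u ((1/t) *\<^sub>R x)"])
qed

lemma dirichlet_multiplicity_scale:
  fixes S :: "'a::euclidean_space set"
  assumes S: "S \<in> sets lebesgue" and t: "t > 0"
  shows "dirichlet_multiplicity S \<mu> \<le> dirichlet_multiplicity ((\<lambda>x. t *\<^sub>R x) ` S) (\<mu> / t\<^sup>2)"
  unfolding dirichlet_multiplicity_def
proof (rule Sup_subset_mono, safe)
  fix n and u :: "nat \<Rightarrow> 'a \<Rightarrow> real"
  let ?T = "(\<lambda>x. t *\<^sub>R x) ` S"
  assume u: "\<forall>i<n. u i \<in> dirichlet_eigenspace S \<mu>"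
    and ind: "\<forall>c::nat \<Rightarrow> real. (AE x in lebesgue_on S. (\<Sum>i<n. c i * u i x) = 0) \<longrightarrow> (\<forall>i<n. c i = 0)"
  have "\<forall>i<n. (\<lambda>x. u i ((1/t) *\<^sub>R x)) \<in> dirichlet_eigenspace ?T (\<mu> / t\<^sup>2)"
    using u dirichlet_eigenspace_scale[OF S t] by blast
  moreover have "\<forall>c::nat \<Rightarrow> real. (AE x in lebesgue_on ?T. (\<Sum>i<n. c i * u i ((1/t) *\<^sub>R x)) = 0)
      \<longrightarrow> (\<forall>i<n. c i = 0)"
    using ind scaled_AE[OF S t refl, of "\<lambda>x. (\<Sum>i<n. _ i * u i x) = 0"] by blast
  ultimately show "\<exists>m. enat n = enat m \<and> (\<exists>u. (\<forall>i<m. u i \<in> dirichlet_eigenspace ?T (\<mu> / t\<^sup>2)) \<and>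
    (\<forall>c::nat \<Rightarrow> real. (AE x in lebesgue_on ?T. (\<Sum>i<m. c i * u i x) = 0) \<longrightarrow> (\<forall>i<m. c i = 0)))"
    by (intro exI[of _ n] conjI refl exI[of _ "\<lambda>i x. u i ((1/t) *\<^sub>R x)"])
qed

text \<open>Eigenvalues and multiplicities of \<open>S\<close> are carried over to the dilated set.  Applied
  to the dilated set with factor \<open>1/t\<close>, this yields the converse inequality as well.\<close>

lemma dirichlet_eigenvalue_scale_le:
  fixes S :: "'a::euclidean_space set"
  assumes S: "S \<in> sets lebesgue" and t: "t > 0"
  shows "ereal (t\<^sup>2) * dirichlet_eigenvalue k ((\<lambda>x. t *\<^sub>R x) ` S) \<le> dirichlet_eigenvalue k S"
  unfolding dirichlet_eigenvalue_def[of k S]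
proof (rule Inf_greatest, safe)
  fix s F
  let ?T = "(\<lambda>x. t *\<^sub>R x) ` S" and ?G = "(\<lambda>\<mu>. \<mu> / t\<^sup>2) ` F"
  assume F: "finite F" "F \<subseteq> dirichlet_spectrum S \<inter> {..s}"
    and k: "enat k \<le> (\<Sum>\<mu>\<in>F. dirichlet_multiplicity S \<mu>)"
  have inj: "inj_on (\<lambda>\<mu>. \<mu> / t\<^sup>2) F" using t by (auto simp: inj_on_def)
  have "?G \<subseteq> dirichlet_spectrum ?T \<inter> {..s / t\<^sup>2}"
    using F dirichlet_spectrum_scale[OF S t] t by (auto simp: divide_right_mono)
  moreover have "enat k \<le> (\<Sum>\<mu>\<in>?G. dirichlet_multiplicity ?T \<mu>)"
    using k sum_mono[of F, OF dirichlet_multiplicity_scale[OF S t]]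
    by (subst sum.reindex[OF inj]) (auto simp: o_def intro: order_trans)
  ultimately have "dirichlet_eigenvalue k ?T \<le> ereal (s / t\<^sup>2)"
    unfolding dirichlet_eigenvalue_def using F(1) by (intro Inf_lower) blast
  then have "ereal (t\<^sup>2) * dirichlet_eigenvalue k ?T \<le> ereal (t\<^sup>2) * ereal (s / t\<^sup>2)"
    by (rule ereal_mult_left_mono) simp
  then show "ereal (t\<^sup>2) * dirichlet_eigenvalue k ?T \<le> ereal s"
    using t by simp
qed

lemma dirichlet_eigenvalue_scale:
  fixes S :: "'a::euclidean_space set"
  assumes S: "S \<in> sets lebesgue" and t: "t > 0"
  shows "dirichlet_eigenvalue k ((\<lambda>x. t *\<^sub>R x) ` S) = ereal (t powr (- 2)) * dirichlet_eigenvalue k S"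
    (is "?L = ?c * ?R")
proof (rule antisym)
  have c: "?c = ereal ((1/t)\<^sup>2)"
    using t by (simp add: powr_minus powr_numeral power_divide divide_inverse power_inverse)
  have c': "?c * (ereal (t\<^sup>2) * x) = x" for x
    unfolding c using t by (simp flip: mult.assoc add: power_divide one_ereal_def[symmetric])
  have "?c * (ereal (t\<^sup>2) * ?L) \<le> ?c * ?R"
    by (rule ereal_mult_left_mono[OF dirichlet_eigenvalue_scale_le[OF S t]]) simp
  then show "?L \<le> ?c * ?R" by (simp only: c')
  have "(\<lambda>x. (1/t) *\<^sub>R x) ` (\<lambda>x. t *\<^sub>R x) ` S = S"
    using scaled_back[OF S t refl] by simp
  then show "?c * ?R \<le> ?L"
    using dirichlet_eigenvalue_scale_le[OF scaled_sets[OF S t refl], of "1/t" k] t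
    unfolding c by simp
qed

lemma lambda2_scale:
  fixes K :: "(real ^ 2) set"
  assumes t: "t > 0"
  shows "lambda2 ((\<lambda>x. t *\<^sub>R x) ` K) = ereal (t powr (- 2)) * lambda2 K"
proof -
  have "interior ((\<lambda>x. t *\<^sub>R x) ` K) = (\<lambda>x. t *\<^sub>R x) ` interior K"
    using t by (intro interior_injective_linear_image) (auto simp: linear_scaleR inj_on_def)
  then show ?thesis
    using t dirichlet_eigenvalue_scale[OF _ t, of "interior K" 2]
    by (simp add: lambda2_def)
qed


section \<open>Functions of class C1 that vanish on the boundary\<close>

text \<open>An odd function of class \<open>C\<^sup>1\<close> which vanishes for \<open>\<bar>s\<bar> \<le>
  \<epsilon>\<close> and equals \<open>(\<bar>s\<bar> - \<epsilon>)\<^sup>2 / s\<close> elsewhere;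
  the quotient is 0 at \<open>s = 0\<close> by the convention on division.  As
  \<open>\<epsilon>\<close> tends to 0 it tends to the identity, and its derivative stays in
  \<open>[0, 1]\<close> and tends to 1 away from 0.\<close>

definition soft_cutoff :: "real \<Rightarrow> real \<Rightarrow> real" where
  "soft_cutoff \<epsilon> s = ((max 0 (s - \<epsilon>))\<^sup>2 + (max 0 (- s - \<epsilon>))\<^sup>2) / s"

text \<open>The derivative \<open>1 - \<epsilon>\<^sup>2/s\<^sup>2\<close>, continued by 0 to
  \<open>\<bar>s\<bar> \<le> \<epsilon>\<close>; the maximum merges the two cases and makes
  continuity evident.\<close>

definition soft_cutoff' :: "real \<Rightarrow> real \<Rightarrow> real" where
  "soft_cutoff' \<epsilon> s = 1 - \<epsilon>\<^sup>2 / (max \<epsilon> \<bar>s\<bar>)\<^sup>2"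

lemma soft_cutoff_eq_0: "\<epsilon> > 0 \<Longrightarrow> \<bar>s\<bar> \<le> \<epsilon> \<Longrightarrow> soft_cutoff \<epsilon> s = 0"
  and soft_cutoff'_eq_0: "\<epsilon> > 0 \<Longrightarrow> \<bar>s\<bar> \<le> \<epsilon> \<Longrightarrow> soft_cutoff' \<epsilon> s = 0"
  by (auto simp: soft_cutoff_def soft_cutoff'_def max_def)

lemma DERIV_max_0_square: "((\<lambda>s::real. (max 0 s)\<^sup>2) has_field_derivative 2 * max 0 s) (at s)"
proof -
  consider "s < 0" | "s = 0" | "s > 0" by linarith
  then show ?thesis
  proof cases
    case 1
    have "((\<lambda>s::real. 0) has_field_derivative 0) (at s)" by simp
    then have "((\<lambda>s::real. (max 0 s)\<^sup>2) has_field_derivative 0) (at s)"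
      by (rule has_field_derivative_transform_within_open[where S = "{..<0}"]) (use 1 in auto)
    with 1 show ?thesis by simp
  next
    case 3
    have "((\<lambda>s::real. s\<^sup>2) has_field_derivative 2 * s) (at s)" by (auto intro!: derivative_eq_intros)
    then have "((\<lambda>s::real. (max 0 s)\<^sup>2) has_field_derivative 2 * s) (at s)"
      by (rule has_field_derivative_transform_within_open[where S = "{0<..}"]) (use 3 in auto)
    with 3 show ?thesis by simp
  next
    case 2
    have "((\<lambda>h::real. (max 0 h)\<^sup>2 / h) \<longlongrightarrow> 0) (at 0)"
    proof (rule Lim_null_comparison)
      show "\<forall>\<^sub>F h in at (0::real). norm ((max 0 h)\<^sup>2 / h) \<le> \<bar>h\<bar>"
        by (auto simp: max_def power2_eq_square)
      show "((\<lambda>h::real. \<bar>h\<bar>) \<longlongrightarrow> 0) (at 0)"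
        by (auto intro!: tendsto_eq_intros)
    qed
    with 2 show ?thesis by (simp add: DERIV_def)
  qed
qed

lemma DERIV_soft_cutoff:
  assumes "\<epsilon> > 0"
  shows "(soft_cutoff \<epsilon> has_field_derivative soft_cutoff' \<epsilon> s) (at s)"
proof (cases "\<bar>s\<bar> < \<epsilon>")
  case True
  have "((\<lambda>s::real. 0) has_field_derivative 0) (at s)" by simp
  then have "(soft_cutoff \<epsilon> has_field_derivative 0) (at s)"
    by (rule has_field_derivative_transform_within_open[where S = "{-\<epsilon><..<\<epsilon>}"])
      (use True in \<open>auto simp: soft_cutoff_def\<close>)
  with True assms show ?thesis by (simp add: soft_cutoff'_eq_0)
next
  case False
  have "((\<lambda>s. (max 0 (s - \<epsilon>))\<^sup>2) has_field_derivative 2 * max 0 (s - \<epsilon>) * 1) (at s)"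
    by (rule DERIV_chain'[OF _ DERIV_max_0_square]) (auto intro!: derivative_eq_intros)
  moreover have "((\<lambda>s. (max 0 (- s - \<epsilon>))\<^sup>2) has_field_derivative 2 * max 0 (- s - \<epsilon>) * (-1)) (at s)"
    by (rule DERIV_chain'[OF _ DERIV_max_0_square]) (auto intro!: derivative_eq_intros)
  ultimately have "((\<lambda>s. ((max 0 (s - \<epsilon>))\<^sup>2 + (max 0 (- s - \<epsilon>))\<^sup>2) / s) has_field_derivative
    ((2 * max 0 (s - \<epsilon>) * 1 + 2 * max 0 (- s - \<epsilon>) * (-1)) * s
      - ((max 0 (s - \<epsilon>))\<^sup>2 + (max 0 (- s - \<epsilon>))\<^sup>2) * 1) / (s * s)) (at s)"
    using False assms by (intro DERIV_divide DERIV_add DERIV_ident[THEN DERIV_cong]) auto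
  moreover have "((2 * max 0 (s - \<epsilon>) * 1 + 2 * max 0 (- s - \<epsilon>) * (-1)) * s
      - ((max 0 (s - \<epsilon>))\<^sup>2 + (max 0 (- s - \<epsilon>))\<^sup>2) * 1) / (s * s) = soft_cutoff' \<epsilon> s"
  proof (cases "s > 0")
    case True
    then have "max 0 (s - \<epsilon>) = s - \<epsilon>" "max 0 (- s - \<epsilon>) = 0" "max \<epsilon> \<bar>s\<bar> = s"
      using False assms by auto
    then show ?thesis using True
      by (simp add: soft_cutoff'_def field_simps power2_eq_square)
  next
    case s: False
    then have "max 0 (s - \<epsilon>) = 0" "max 0 (- s - \<epsilon>) = - s - \<epsilon>" "max \<epsilon> \<bar>s\<bar> = - s" "s \<noteq> 0"
      using False assms by auto
    then show ?thesis
      by (simp add: soft_cutoff'_def field_simps power2_eq_square)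
  qed
  ultimately show ?thesis by (simp add: soft_cutoff_def[abs_def])
qed

lemma continuous_on_soft_cutoff': "\<epsilon> > 0 \<Longrightarrow> continuous_on UNIV (soft_cutoff' \<epsilon>)"
  unfolding soft_cutoff'_def[abs_def] by (auto intro!: continuous_intros)

lemma soft_cutoff_close:
  assumes "\<epsilon> > 0"
  shows "\<bar>soft_cutoff \<epsilon> s - s\<bar> \<le> 2 * \<epsilon>"
proof (cases "\<bar>s\<bar> \<le> \<epsilon>")
  case True
  then show ?thesis using assms by (simp add: soft_cutoff_eq_0)
next
  case False
  have *: "\<bar>(a - \<epsilon>)\<^sup>2 / a - a\<bar> \<le> 2 * \<epsilon>" if "a > \<epsilon>" for a
  proof -
    have a: "a > 0" using that assms by simp
    have "(a - \<epsilon>)\<^sup>2 / a - a = - 2 * \<epsilon> + \<epsilon> * (\<epsilon> / a)"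
      using a by (simp add: field_simps power2_eq_square)
    moreover have "0 \<le> \<epsilon> * (\<epsilon> / a)" "\<epsilon> * (\<epsilon> / a) \<le> \<epsilon> * 1"
      using that a assms by (auto simp: divide_le_eq intro!: mult_left_mono)
    ultimately show ?thesis using assms by linarith
  qed
  show ?thesis
  proof (cases "s > 0")
    case True
    then have "soft_cutoff \<epsilon> s = (s - \<epsilon>)\<^sup>2 / s"
      using False assms by (simp add: soft_cutoff_def)
    then show ?thesis using *[of s] True False by simp
  next
    case s: False
    then have "soft_cutoff \<epsilon> s = (- s - \<epsilon>)\<^sup>2 / s"
      using False assms by (simp add: soft_cutoff_def)
    then show ?thesis using *[of "- s"] s False
      by (simp add: abs_minus_commute)
  qed
qed

lemma soft_cutoff'_bounds:
  assumes "\<epsilon> > 0"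
  shows "0 \<le> soft_cutoff' \<epsilon> s" "soft_cutoff' \<epsilon> s \<le> 1"
proof -
  have "\<epsilon>\<^sup>2 \<le> (max \<epsilon> \<bar>s\<bar>)\<^sup>2" using assms by (intro power_mono) auto
  moreover have "max \<epsilon> \<bar>s\<bar> > 0" using assms by auto
  ultimately show "0 \<le> soft_cutoff' \<epsilon> s"
    by (simp add: soft_cutoff'_def divide_le_eq)
  show "soft_cutoff' \<epsilon> s \<le> 1" by (simp add: soft_cutoff'_def)
qed

lemma soft_cutoff'_tendsto_1:
  assumes "s \<noteq> 0"
  shows "(\<lambda>n. soft_cutoff' (1 / real (Suc n)) s) \<longlonglongrightarrow> 1"
proof -
  have 0: "(\<lambda>n. 1 / real (Suc n)) \<longlonglongrightarrow> 0"
    using LIMSEQ_inverse_real_of_nat by (simp add: inverse_eq_divide)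
  have "(\<lambda>n. 1 - (1 / real (Suc n))\<^sup>2 / (max (1 / real (Suc n)) \<bar>s\<bar>)\<^sup>2) \<longlonglongrightarrow> 1 - 0\<^sup>2 / (max 0 \<bar>s\<bar>)\<^sup>2"
    using assms by (intro tendsto_intros 0) auto
  then show ?thesis by (simp add: soft_cutoff'_def)
qed

lemma borel_measurable_lebesgue_on_continuous:
  fixes f :: "'a::euclidean_space \<Rightarrow> 'b::euclidean_space"
  assumes "continuous_on UNIV f"
  shows "f \<in> borel_measurable (lebesgue_on S)"
  using borel_measurable_continuous_onI[OF assms]
  by (simp add: measurable_completion measurable_restrict_space1)

lemma integrable_on_bounded_if_bounded:
  fixes f :: "'a::euclidean_space \<Rightarrow> real"
  assumes S: "S \<in> sets lebesgue" "bounded S"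
    and f: "f \<in> borel_measurable (lebesgue_on S)" "\<And>x. x \<in> S \<Longrightarrow> \<bar>f x\<bar> \<le> B"
  shows "integrable (lebesgue_on S) f"
proof -
  have "finite_measure (lebesgue_on S)"
    using bounded_set_imp_lmeasurable[OF S(2,1)]
    by (auto intro!: finite_measure_lebesgue_on)
  then show ?thesis
    using f by (intro finite_measure.integrable_const_bound[where B = B]) (auto simp: space_restrict_space)
qed

lemma square_integrable_on_if_bounded:
  assumes S: "S \<in> sets lebesgue" "bounded S"
    and f: "f \<in> borel_measurable (lebesgue_on S)" "\<And>x. x \<in> S \<Longrightarrow> norm (f x) \<le> B"
  shows "square_integrable_on S f"
  unfolding square_integrable_on_def using f
  by (auto intro!: integrable_on_bounded_if_bounded[OF S, where B = "B\<^sup>2"] power_mono)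

lemma GDERIV_continuous_on:
  "(\<And>x. GDERIV f x :> D x) \<Longrightarrow> continuous_on S f"
  unfolding gderiv_def by (auto intro!: has_derivative_continuous continuous_at_imp_continuous_on)

text \<open>Composing \<open>v\<close> with the cutoff gives a function that vanishes wherever
  \<open>\<bar>v\<bar> \<le> \<epsilon>\<close>, in particular near the frontier, so that its
  continuation by 0 outside \<open>\<Omega>\<close> is a test function.  As
  \<open>\<epsilon>\<close> tends to 0 these test functions converge to \<open>v\<close> in the
  \<open>H\<^sup>1\<close> norm by dominated convergence.  Their gradients converge only where
  \<open>v \<noteq> 0\<close>, which is why the zero set is required to be negligible.\<close>

theorem H10_if_C1_zero_on_frontier:
  fixes v :: "'a::euclidean_space \<Rightarrow> real"
  assumes \<Omega>: "open \<Omega>" "bounded \<Omega>"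
    and v: "\<And>x. GDERIV v x :> D x" "continuous_on UNIV D"
    and fr: "\<And>x. x \<in> frontier \<Omega> \<Longrightarrow> v x = 0"
    and null: "negligible {x \<in> \<Omega>. v x = 0}"
  shows "H10 \<Omega> v D"
proof -
  note vcont = GDERIV_continuous_on[OF v(1)]
  have meas: "\<Omega> \<in> sets lebesgue" using \<Omega>(1) by simp
  have comp: "compact (closure \<Omega>)" using \<Omega>(2) by simp
  obtain Bv where Bv: "\<And>x. x \<in> \<Omega> \<Longrightarrow> norm (v x) \<le> Bv"
    using compact_imp_bounded[OF compact_continuous_image[OF vcont comp]] closure_subset
    by (force simp: bounded_iff)
  have "bounded (D ` closure \<Omega>)"
    using continuous_on_subset[OF v(2)] comp by (intro compact_imp_bounded compact_continuous_image) auto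
  then obtain B where B: "\<And>x. x \<in> \<Omega> \<Longrightarrow> norm (D x) \<le> B"
    using closure_subset by (force simp: bounded_iff)
  have vm[measurable]: "v \<in> borel_measurable (lebesgue_on \<Omega>)"
    and Dm[measurable]: "D \<in> borel_measurable (lebesgue_on \<Omega>)"
    using vcont v(2) by (auto intro!: borel_measurable_lebesgue_on_continuous)
  define \<epsilon> where "\<epsilon> n = 1 / real (Suc n)" for n
  have \<epsilon>: "\<epsilon> n > 0" "\<epsilon> n \<le> 1" for n by (auto simp: \<epsilon>_def)
  have \<epsilon>0: "\<epsilon> \<longlonglongrightarrow> 0"
    unfolding \<epsilon>_def using LIMSEQ_inverse_real_of_nat by (simp add: inverse_eq_divide)
  define \<phi> where "\<phi> n x = (if x \<in> \<Omega> then soft_cutoff (\<epsilon> n) (v x) else 0)" for n x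
  define D\<phi> where "D\<phi> n x = (if x \<in> \<Omega> then soft_cutoff' (\<epsilon> n) (v x) *\<^sub>R D x else 0)" for n x
  have tf: "test_function \<Omega> (\<phi> n) (D\<phi> n)" for n
  proof -
    \<comment> \<open>A compact subset of \<open>\<Omega>\<close> outside of which the truncated function and its gradient vanish.\<close>
    define C where "C = closure \<Omega> \<inter> {x. \<epsilon> n \<le> \<bar>v x\<bar>}"
    have Ccl: "closed C"
      unfolding C_def
      by (intro closed_Int closed_closure closed_Collect_le continuous_on_const continuous_on_rabs vcont)
    have C\<Omega>: "C \<subseteq> \<Omega>"
      using fr \<epsilon>(1)[of n] \<Omega>(1) by (fastforce simp: C_def frontier_def interior_open)
    have out: "\<bar>v x\<bar> \<le> \<epsilon> n" if "x \<in> \<Omega>" "x \<notin> C" for x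
      using that closure_subset by (force simp: C_def)
    have zero: "\<phi> n x = 0" "D\<phi> n x = 0" if "x \<notin> C" for x
      using out[of x] that \<epsilon>(1) by (auto simp: \<phi>_def D\<phi>_def soft_cutoff_eq_0 soft_cutoff'_eq_0)
    have supp: "closure {x. \<phi> n x \<noteq> 0} \<subseteq> C"
      using zero(1) Ccl by (intro closure_minimal) auto
    have "GDERIV (\<phi> n) x :> D\<phi> n x" for x
    proof (cases "x \<in> \<Omega>")
      case True
      have "GDERIV (\<lambda>x. soft_cutoff (\<epsilon> n) (v x)) x :> soft_cutoff' (\<epsilon> n) (v x) *\<^sub>R D x"
        by (rule GDERIV_DERIV_compose[OF v(1) DERIV_soft_cutoff[OF \<epsilon>(1)]])
      then have "GDERIV (\<phi> n) x :> soft_cutoff' (\<epsilon> n) (v x) *\<^sub>R D x"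
        unfolding gderiv_def
        by (rule has_derivative_transform_within_open[OF _ \<Omega>(1) True]) (simp add: \<phi>_def)
      with True show ?thesis by (simp add: D\<phi>_def)
    next
      case False
      have "GDERIV (\<lambda>x. 0) x :> 0" by (rule GDERIV_const)
      then have "GDERIV (\<phi> n) x :> 0"
        unfolding gderiv_def
        by (rule has_derivative_transform_within_open[where s = "- C"])
          (use False C\<Omega> Ccl zero in auto)
      with False show ?thesis by (simp add: D\<phi>_def)
    qed
    moreover have "continuous_on (\<Omega> \<union> - C) (D\<phi> n)"
    proof (rule continuous_on_open_Un)
      have "continuous_on \<Omega> (\<lambda>x. soft_cutoff' (\<epsilon> n) (v x) *\<^sub>R D x)"
        using continuous_on_subset[OF v(2)]
        by (auto intro!: continuous_intros vcont continuous_on_compose2[OF continuous_on_soft_cutoff'[OF \<epsilon>(1)]])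
      then show "continuous_on \<Omega> (D\<phi> n)"
        by (rule continuous_on_eq) (simp add: D\<phi>_def)
      show "continuous_on (- C) (D\<phi> n)"
        by (rule continuous_on_eq[OF continuous_on_const[of _ 0]]) (simp add: zero)
    qed (use \<Omega>(1) Ccl in auto)
    moreover have "\<Omega> \<union> - C = UNIV" using C\<Omega> by auto
    moreover have "compact (closure {x. \<phi> n x \<noteq> 0})"
      using supp C\<Omega> \<Omega>(2) by (meson bounded_subset closed_closure compact_eq_bounded_closed)
    ultimately show ?thesis
      using supp C\<Omega> by (auto simp: test_function_def)
  qed
  note [measurable] = test_function_measurable[OF tf, where X = \<Omega>]
  have l1: "(\<lambda>n. LINT x|lebesgue_on \<Omega>. (\<phi> n x - v x)\<^sup>2) \<longlonglongrightarrow> (LINT x|lebesgue_on \<Omega>. 0)"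
  proof (rule integral_dominated_convergence[where w = "\<lambda>_. 4"])
    show "integrable (lebesgue_on \<Omega>) (\<lambda>_. 4::real)"
      using integrable_on_bounded_if_bounded[OF meas \<Omega>(2), of "\<lambda>_. 4" 4] by simp
    have le: "(\<phi> n x - v x)\<^sup>2 \<le> (2 * \<epsilon> n)\<^sup>2" if "x \<in> \<Omega>" for n x
    proof -
      have "\<phi> n x = soft_cutoff (\<epsilon> n) (v x)" using that by (simp add: \<phi>_def)
      then have "\<bar>\<phi> n x - v x\<bar> \<le> 2 * \<epsilon> n"
        using soft_cutoff_close[OF \<epsilon>(1), of n "v x"] by simp
      then show ?thesis by (metis abs_ge_zero power2_abs power_mono)
    qed
    have "(2 * \<epsilon> n)\<^sup>2 \<le> 2\<^sup>2" for n
      using \<epsilon>[of n] by (intro power_mono) auto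
    then have "norm ((\<phi> n x - v x)\<^sup>2) \<le> 4" if "x \<in> \<Omega>" for n x
      using order_trans[OF le[OF that, of n]] by simp
    then show "AE x in lebesgue_on \<Omega>. norm ((\<phi> n x - v x)\<^sup>2) \<le> 4" for n
      by (intro AE_I2) (simp add: space_restrict_space)
    have lim: "(\<lambda>n. (2 * \<epsilon> n)\<^sup>2) \<longlonglongrightarrow> 0"
      using tendsto_power[OF tendsto_mult[OF tendsto_const \<epsilon>0, of 2], of 2] by simp
    show "AE x in lebesgue_on \<Omega>. (\<lambda>n. (\<phi> n x - v x)\<^sup>2) \<longlonglongrightarrow> 0"
    proof (intro AE_I2)
      fix x assume "x \<in> space (lebesgue_on \<Omega>)"
      then have "x \<in> \<Omega>" by (simp add: space_restrict_space)
      then show "(\<lambda>n. (\<phi> n x - v x)\<^sup>2) \<longlonglongrightarrow> 0"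
        by (intro Lim_null_comparison[OF _ lim] always_eventually allI)
          (simp only: real_norm_def abs_power2 le)
    qed
  qed measurable
  have l2: "(\<lambda>n. LINT x|lebesgue_on \<Omega>. (norm (D\<phi> n x - D x))\<^sup>2) \<longlonglongrightarrow> (LINT x|lebesgue_on \<Omega>. 0)"
  proof (rule integral_dominated_convergence[where w = "\<lambda>_. B\<^sup>2"])
    show "integrable (lebesgue_on \<Omega>) (\<lambda>_. B\<^sup>2)"
      using integrable_on_bounded_if_bounded[OF meas \<Omega>(2), of "\<lambda>_. B\<^sup>2" "B\<^sup>2"] by simp
    have eq: "norm (D\<phi> n x - D x) = (1 - soft_cutoff' (\<epsilon> n) (v x)) * norm (D x)" if "x \<in> \<Omega>" for n x
    proof -
      have "D\<phi> n x - D x = - ((1 - soft_cutoff' (\<epsilon> n) (v x)) *\<^sub>R D x)"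
        using that by (simp add: D\<phi>_def algebra_simps)
      then show ?thesis
        using soft_cutoff'_bounds[OF \<epsilon>(1), of n "v x"] by simp
    qed
    have "norm (D\<phi> n x - D x) \<le> 1 * B" if "x \<in> \<Omega>" for n x
      unfolding eq[OF that]
      using soft_cutoff'_bounds[OF \<epsilon>(1), of n "v x"] B[OF that] by (intro mult_mono) auto
    then show "AE x in lebesgue_on \<Omega>. norm ((norm (D\<phi> n x - D x))\<^sup>2) \<le> B\<^sup>2" for n
      by (intro AE_I2) (auto simp: space_restrict_space intro!: power_mono)
    have "AE x in lebesgue. x \<notin> {x \<in> \<Omega>. v x = 0}"
      using null by (intro AE_not_in) (simp add: negligible_iff_null_sets)
    then have "AE x in lebesgue_on \<Omega>. v x \<noteq> 0"
      using meas by (subst AE_restrict_space_iff) auto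
    then show "AE x in lebesgue_on \<Omega>. (\<lambda>n. (norm (D\<phi> n x - D x))\<^sup>2) \<longlonglongrightarrow> 0"
      using AE_space
    proof eventually_elim
      fix x assume x: "v x \<noteq> 0" "x \<in> space (lebesgue_on \<Omega>)"
      then have "x \<in> \<Omega>" by (simp add: space_restrict_space)
      moreover have "(\<lambda>n. ((1 - soft_cutoff' (\<epsilon> n) (v x)) * norm (D x))\<^sup>2) \<longlonglongrightarrow> ((1 - 1) * norm (D x))\<^sup>2"
        unfolding \<epsilon>_def by (intro tendsto_intros soft_cutoff'_tendsto_1 x)
      ultimately show "(\<lambda>n. (norm (D\<phi> n x - D x))\<^sup>2) \<longlonglongrightarrow> 0"
        by (simp add: eq)
    qed
  qed measurable
  show ?thesis
    unfolding H10_def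
    using l1 l2 tf square_integrable_on_if_bounded[OF meas \<Omega>(2) vm Bv]
      square_integrable_on_if_bounded[OF meas \<Omega>(2) Dm B]
    by auto
qed


section \<open>Integration by parts in Sobolev spaces\<close>

lemma compact_support_integrable:
  fixes f :: "'a::euclidean_space \<Rightarrow> real"
  assumes f: "continuous_on UNIV f" and K: "bounded K" "\<And>x. x \<notin> K \<Longrightarrow> f x = 0"
  shows "integrable lborel f"
proof -
  obtain R where R: "\<And>x. x \<in> K \<Longrightarrow> norm x \<le> R" using K(1) by (auto simp: bounded_iff)
  have "bounded (f ` cball 0 R)"
    using continuous_on_subset[OF f] by (intro compact_imp_bounded compact_continuous_image) auto
  then obtain B where B: "\<And>x. norm x \<le> R \<Longrightarrow> norm (f x) \<le> B" by (force simp: bounded_iff)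
  have "integrable lborel (\<lambda>x. indicator (cball 0 R :: 'a set) x *\<^sub>R B)"
    by (rule integrable_scaleR_left[OF integrable_real_indicator])
      (simp, rule emeasure_lborel_cball_finite)
  then show ?thesis
  proof (rule Bochner_Integration.integrable_bound)
    show "f \<in> borel_measurable lborel"
      using borel_measurable_continuous_onI[OF f] by simp
    show "AE x in lborel. norm (f x) \<le> norm (indicator (cball 0 R :: 'a set) x *\<^sub>R B)"
    proof (intro AE_I2)
      fix x :: 'a
      show "norm (f x) \<le> norm (indicator (cball 0 R :: 'a set) x *\<^sub>R B)"
        using B[of x] R[of x] K(2)[of x] by (cases "norm x \<le> R") (auto simp: indicator_def)
    qed
  qed
qed

text \<open>The difference quotients of \<open>f\<close> in direction \<open>b\<close> have integral 0 by
  translation invariance, and they converge to the directional derivative boundedly and within a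
  fixed ball.\<close>

lemma integral_directional_derivative_eq_0:
  fixes f :: "'a::euclidean_space \<Rightarrow> real"
  assumes f: "\<And>x. GDERIV f x :> D x" "continuous_on UNIV D"
    and K: "bounded K" "\<And>x. x \<notin> K \<Longrightarrow> f x = 0" "\<And>x. x \<notin> K \<Longrightarrow> D x = 0"
  shows "(LINT x|lborel. D x \<bullet> b) = 0"
proof -
  note fcont = GDERIV_continuous_on[OF f(1)]
  have int: "integrable lborel f"
    by (rule compact_support_integrable[OF fcont K(1,2)])
  have fm[measurable]: "f \<in> borel_measurable borel" and Dm[measurable]: "D \<in> borel_measurable borel"
    using borel_measurable_continuous_onI[OF fcont] borel_measurable_continuous_onI[OF f(2)] by auto
  obtain R where R: "\<And>x. x \<in> K \<Longrightarrow> norm x \<le> R" using K(1) by (auto simp: bounded_iff)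
  have "bounded (D ` cball 0 R)"
    using continuous_on_subset[OF f(2)] by (intro compact_imp_bounded compact_continuous_image) auto
  then obtain B0 where B0: "\<And>x. norm x \<le> R \<Longrightarrow> norm (D x) \<le> B0" by (force simp: bounded_iff)
  define B where "B = max 0 B0"
  have B: "norm (D x) \<le> B" for x
    using B0[of x] R[of x] K(3)[of x] by (cases "x \<in> K") (auto simp: B_def)
  define F where "F n x = real (Suc n) * (f (x + (1 / real (Suc n)) *\<^sub>R b) - f x)" for n x
  have F0: "(LINT x|lborel. F n x) = 0" for n
  proof -
    let ?c = "(1 / real (Suc n)) *\<^sub>R b"
    have "integrable (distr lborel borel ((+) ?c)) f"
      using int by (subst lborel_distr_plus) simp
    then have int': "integrable lborel (\<lambda>x. f (?c + x))"
      by (subst (asm) integrable_distr_eq) auto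
    have "(LINT x|lborel. f x) = (LINT x|distr lborel borel ((+) ?c). f x)"
      by (subst lborel_distr_plus) simp
    also have "\<dots> = (LINT x|lborel. f (?c + x))"
      by (subst integral_distr) auto
    finally show ?thesis
      using int int' by (simp add: F_def add.commute)
  qed
  have bound: "\<bar>F n x\<bar> \<le> B * norm b" for n x
  proof -
    let ?c = "(1 / real (Suc n)) *\<^sub>R b"
    have "norm (f (x + ?c) - f x) \<le> B * norm (x + ?c - x)"
    proof (rule differentiable_bound[where S = UNIV])
      show "(f has_derivative (\<lambda>h. h \<bullet> D x)) (at x within UNIV)" for x
        using f(1)[of x] by (simp add: gderiv_def)
      show "onorm (\<lambda>h. h \<bullet> D x) \<le> B" for x
        using B[of x] by (intro onorm_le) (metis Cauchy_Schwarz_ineq2 mult.commute mult_left_mono norm_ge_zero order_trans real_norm_def)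
    qed auto
    then have "real (Suc n) * \<bar>f (x + ?c) - f x\<bar> \<le> real (Suc n) * (B * norm ?c)"
      by (intro mult_left_mono) auto
    also have "\<dots> = B * norm b" by simp
    finally show ?thesis by (simp add: F_def abs_mult del: of_nat_Suc)
  qed
  have "(\<lambda>n. LINT x|lborel. F n x) \<longlonglongrightarrow> (LINT x|lborel. D x \<bullet> b)"
  proof (rule integral_dominated_convergence[where w = "\<lambda>x. indicator (cball 0 (R + norm b)) x *\<^sub>R (B * norm b)"])
    show "integrable lborel (\<lambda>x. indicator (cball (0::'a) (R + norm b)) x *\<^sub>R (B * norm b))"
      by (rule integrable_scaleR_left[OF integrable_real_indicator])
        (simp, rule emeasure_lborel_cball_finite)
    show "AE x in lborel. norm (F n x) \<le> indicator (cball 0 (R + norm b)) x *\<^sub>R (B * norm b)" for n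
    proof (intro AE_I2)
      fix x
      let ?c = "(1 / real (Suc n)) *\<^sub>R b"
      show "norm (F n x) \<le> indicator (cball 0 (R + norm b)) x *\<^sub>R (B * norm b)"
      proof (cases "norm x \<le> R + norm b")
        case True
        then show ?thesis using bound[of n x] by simp
      next
        case False
        have "norm x \<le> norm (x + ?c) + norm ?c"
          by (metis add_diff_cancel norm_triangle_ineq4)
        moreover have "norm ?c \<le> norm b"
          using mult_left_mono[of 1 "1 + real n" "norm b"] by (simp add: divide_le_eq)
        ultimately have "norm (x + ?c) > R" "norm x > R"
          using False norm_ge_zero[of b] by linarith+
        then have "x + ?c \<notin> K" "x \<notin> K" using R by force+
        then show ?thesis using False by (simp add: F_def K(2))
      qed
    qed
    show "AE x in lborel. (\<lambda>n. F n x) \<longlonglongrightarrow> D x \<bullet> b"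
    proof (intro AE_I2)
      fix x
      have "((\<lambda>t. x + t *\<^sub>R b) has_derivative (\<lambda>t. t *\<^sub>R b)) (at 0)"
        by (auto intro!: derivative_eq_intros)
      from has_derivative_compose[OF this, of f "\<lambda>h. h \<bullet> D x"] f(1)[of x]
      have "((\<lambda>t. f (x + t *\<^sub>R b)) has_derivative (\<lambda>t. (t *\<^sub>R b) \<bullet> D x)) (at 0)"
        by (simp add: gderiv_def)
      then have "((\<lambda>t. f (x + t *\<^sub>R b)) has_field_derivative (b \<bullet> D x)) (at 0)"
        by (simp add: has_field_derivative_def mult.commute[of _ "b \<bullet> D x"] mult_commute_abs)
      then have "((\<lambda>t. (f (x + t *\<^sub>R b) - f x) / t) \<longlongrightarrow> b \<bullet> D x) (at 0)"
        by (simp add: DERIV_def)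
      moreover have "filterlim (\<lambda>n. 1 / real (Suc n)) (at 0) sequentially"
        using LIMSEQ_inverse_real_of_nat
        by (auto simp: filterlim_at inverse_eq_divide)
      ultimately have "(\<lambda>n. (f (x + (1 / real (Suc n)) *\<^sub>R b) - f x) / (1 / real (Suc n))) \<longlonglongrightarrow> b \<bullet> D x"
        by (rule filterlim_compose)
      then show "(\<lambda>n. F n x) \<longlonglongrightarrow> D x \<bullet> b"
        by (simp add: F_def[abs_def] inner_commute mult.commute)
    qed
  qed (auto simp: F_def[abs_def])
  then show ?thesis
    using F0 by (simp add: LIMSEQ_const_iff)
qed

lemma integral_lebesgue_on_eq_lborel:
  fixes f :: "'a::euclidean_space \<Rightarrow> real"
  assumes "S \<in> sets lebesgue" "f \<in> borel_measurable borel" "\<And>x. x \<notin> S \<Longrightarrow> f x = 0"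
  shows "(LINT x|lebesgue_on S. f x) = (LINT x|lborel. f x)"
proof -
  have "(LINT x|lebesgue_on S. f x) = (LINT x|lebesgue. indicator S x *\<^sub>R f x)"
    using assms(1) by (subst integral_restrict_space) auto
  also have "(\<lambda>x. indicator S x *\<^sub>R f x) = f"
    using assms(3) by (auto simp: indicator_def fun_eq_iff)
  also have "(LINT x|lebesgue. f x) = (LINT x|lborel. f x)"
    using assms(2) by (intro integral_completion) simp
  finally show ?thesis .
qed

text \<open>The product \<open>\<phi> \<psi>\<close> is of class \<open>C\<^sup>1\<close> with compact
  support inside \<open>S\<close>, so its derivative in direction \<open>b\<close> integrates to 0
  over the whole space.\<close>

lemma integral_by_parts_test_function:
  fixes \<phi> \<psi> :: "'a::euclidean_space \<Rightarrow> real"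
  assumes S: "S \<in> sets lebesgue" and tf: "test_function S \<phi> D\<phi>"
    and \<psi>: "\<And>x. GDERIV \<psi> x :> D\<psi> x" "continuous_on UNIV D\<psi>"
  shows "(LINT x|lebesgue_on S. (D\<phi> x \<bullet> b) * \<psi> x) = - (LINT x|lebesgue_on S. \<phi> x * (D\<psi> x \<bullet> b))"
proof -
  define K where "K = closure {x. \<phi> x \<noteq> 0}"
  have \<phi>: "GDERIV \<phi> x :> D\<phi> x" "continuous_on UNIV D\<phi>" "compact K" "K \<subseteq> S" for x
    using tf unfolding test_function_def K_def by blast+
  have K\<phi>: "\<phi> x = 0" if "x \<notin> K" for x
    using that closure_subset[of "{x. \<phi> x \<noteq> 0}"] unfolding K_def by blast
  have KD: "D\<phi> x = 0" if "x \<notin> K" for x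
  proof -
    have "GDERIV (\<lambda>x. 0) x :> 0" by (rule GDERIV_const)
    then have "GDERIV \<phi> x :> 0"
      unfolding gderiv_def
      by (rule has_derivative_transform_within_open[where s = "- K"]) (use that K\<phi> \<phi>(3) in \<open>auto simp: compact_imp_closed\<close>)
    from has_derivative_unique[OF this[unfolded gderiv_def] \<phi>(1)[unfolded gderiv_def]]
    have "(\<lambda>h. h \<bullet> 0) = (\<lambda>h. h \<bullet> D\<phi> x)" .
    then have "D\<phi> x \<bullet> D\<phi> x = 0" by (simp add: fun_eq_iff)
    then show ?thesis by simp
  qed
  note \<phi>cont = GDERIV_continuous_on[OF \<phi>(1)] and \<psi>cont = GDERIV_continuous_on[OF \<psi>(1)]
  have [measurable]: "\<phi> \<in> borel_measurable borel" "\<psi> \<in> borel_measurable borel"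
    "D\<phi> \<in> borel_measurable borel" "D\<psi> \<in> borel_measurable borel"
    using \<phi>cont \<psi>cont \<phi>(2) \<psi>(2) by (auto intro!: borel_measurable_continuous_onI)
  have bd: "bounded K" using \<phi>(3) by (rule compact_imp_bounded)
  have "(LINT x|lborel. (\<phi> x *\<^sub>R D\<psi> x + \<psi> x *\<^sub>R D\<phi> x) \<bullet> b) = 0"
  proof (rule integral_directional_derivative_eq_0[where f = "\<lambda>x. \<phi> x * \<psi> x", OF _ _ bd])
    show "GDERIV (\<lambda>x. \<phi> x * \<psi> x) x :> \<phi> x *\<^sub>R D\<psi> x + \<psi> x *\<^sub>R D\<phi> x" for x
      by (rule GDERIV_mult[OF \<phi>(1) \<psi>(1)])
    show "continuous_on UNIV (\<lambda>x. \<phi> x *\<^sub>R D\<psi> x + \<psi> x *\<^sub>R D\<phi> x)"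
      by (intro continuous_intros \<phi>cont \<psi>cont \<phi>(2) \<psi>(2))
  qed (auto simp: KD K\<phi>)
  also have "(\<lambda>x. (\<phi> x *\<^sub>R D\<psi> x + \<psi> x *\<^sub>R D\<phi> x) \<bullet> b) = (\<lambda>x. \<phi> x * (D\<psi> x \<bullet> b) + (D\<phi> x \<bullet> b) * \<psi> x)"
    by (auto simp: fun_eq_iff inner_add_left)
  also have "(LINT x|lborel. \<phi> x * (D\<psi> x \<bullet> b) + (D\<phi> x \<bullet> b) * \<psi> x)
    = (LINT x|lborel. \<phi> x * (D\<psi> x \<bullet> b)) + (LINT x|lborel. (D\<phi> x \<bullet> b) * \<psi> x)"
  proof (rule Bochner_Integration.integral_add)
    show "integrable lborel (\<lambda>x. \<phi> x * (D\<psi> x \<bullet> b))"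
      by (rule compact_support_integrable[OF _ bd])
        (auto simp: K\<phi> intro!: continuous_intros \<phi>cont \<psi>(2))
    show "integrable lborel (\<lambda>x. (D\<phi> x \<bullet> b) * \<psi> x)"
      by (rule compact_support_integrable[OF _ bd])
        (auto simp: KD intro!: continuous_intros \<psi>cont \<phi>(2))
  qed
  finally have sum0: "(LINT x|lborel. \<phi> x * (D\<psi> x \<bullet> b)) + (LINT x|lborel. (D\<phi> x \<bullet> b) * \<psi> x) = 0" .
  have "\<phi> x = 0" "D\<phi> x = 0" if "x \<notin> S" for x
    using that \<phi>(4) KD K\<phi> by auto
  then have "(LINT x|lebesgue_on S. \<phi> x * (D\<psi> x \<bullet> b)) = (LINT x|lborel. \<phi> x * (D\<psi> x \<bullet> b))"
    "(LINT x|lebesgue_on S. (D\<phi> x \<bullet> b) * \<psi> x) = (LINT x|lborel. (D\<phi> x \<bullet> b) * \<psi> x)"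
    by (auto intro!: integral_lebesgue_on_eq_lborel[OF S])
  with sum0 show ?thesis by linarith
qed

text \<open>A substitute for the Cauchy-Schwarz inequality in \<open>L\<^sup>2\<close>: integrate \<open>2
  \<bar>a \<bullet> c\<bar> \<le> \<bar>a\<bar>\<^sup>2 / \<delta> + \<delta>
  \<bar>c\<bar>\<^sup>2\<close> with a small \<open>\<delta>\<close>.\<close>

lemma integral_inner_tendsto_0:
  fixes f :: "nat \<Rightarrow> 'a::euclidean_space \<Rightarrow> 'b::euclidean_space"
  assumes f: "\<And>n. f n \<in> borel_measurable M" "\<And>n. integrable M (\<lambda>x. (norm (f n x))\<^sup>2)"
    and lim: "(\<lambda>n. LINT x|M. (norm (f n x))\<^sup>2) \<longlonglongrightarrow> 0"
    and g: "g \<in> borel_measurable M" "integrable M (\<lambda>x. (norm (g x))\<^sup>2)"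
  shows "(\<lambda>n. LINT x|M. f n x \<bullet> g x) \<longlonglongrightarrow> 0"
proof (rule LIMSEQ_I)
  fix r :: real assume r: "r > 0"
  define G where "G = (LINT x|M. (norm (g x))\<^sup>2)"
  have G: "G \<ge> 0" by (simp add: G_def)
  \<comment> \<open>Chosen so that the term \<open>\<delta> * G / 2\<close> is at most \<open>r / 2\<close>; the 1 allows for \<open>G = 0\<close>.\<close>
  define \<delta> where "\<delta> = r / (2 * (G + 1))"
  have \<delta>: "\<delta> > 0" using r G by (simp add: \<delta>_def)
  have "\<forall>\<^sub>F n in sequentially. (LINT x|M. (norm (f n x))\<^sup>2) < r * \<delta>"
    using order_tendstoD(2)[OF lim, of "r * \<delta>"] r \<delta> by simp
  then obtain N where N: "\<And>n. n \<ge> N \<Longrightarrow> (LINT x|M. (norm (f n x))\<^sup>2) < r * \<delta>"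
    by (auto simp: eventually_sequentially)
  have "norm ((LINT x|M. f n x \<bullet> g x) - 0) < r" if "n \<ge> N" for n
  proof -
    have pt: "\<bar>a \<bullet> c\<bar> \<le> (1 / \<delta>) * (norm a)\<^sup>2 / 2 + \<delta> * (norm c)\<^sup>2 / 2" for a c :: 'b
    proof -
      have "0 \<le> (norm a - \<delta> * norm c)\<^sup>2 / (2 * \<delta>)" using \<delta> by simp
      also have "\<dots> = (1 / \<delta>) * (norm a)\<^sup>2 / 2 + \<delta> * (norm c)\<^sup>2 / 2 - norm a * norm c"
        using \<delta> by (simp add: field_simps power2_eq_square)
      finally show ?thesis using Cauchy_Schwarz_ineq2[of a c] by linarith
    qed
    have "norm (LINT x|M. f n x \<bullet> g x) \<le> (LINT x|M. (1 / \<delta>) * (norm (f n x))\<^sup>2 / 2 + \<delta> * (norm (g x))\<^sup>2 / 2)"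
    proof (rule Bochner_Integration.integral_norm_bound_integral)
      show int: "integrable M (\<lambda>x. (1 / \<delta>) * (norm (f n x))\<^sup>2 / 2 + \<delta> * (norm (g x))\<^sup>2 / 2)"
        using f(2) g(2) by simp
      show "integrable M (\<lambda>x. f n x \<bullet> g x)"
        by (rule Bochner_Integration.integrable_bound[OF int])
          (use f(1) g(1) pt in \<open>auto intro!: AE_I2 intro: order_trans[OF _ abs_ge_self]\<close>)
    qed (simp only: real_norm_def pt)
    also have "\<dots> = (1 / \<delta>) * (LINT x|M. (norm (f n x))\<^sup>2) / 2 + \<delta> * G / 2"
      using f(2) g(2) by (simp add: G_def)
    also have "(1 / \<delta>) * (LINT x|M. (norm (f n x))\<^sup>2) / 2 < (1 / \<delta>) * (r * \<delta>) / 2"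
      using N[OF that] \<delta> by (simp add: divide_less_eq)
    also have "(1 / \<delta>) * (r * \<delta>) / 2 + \<delta> * G / 2 \<le> r / 2 + r / 2"
    proof -
      have "\<delta> * (G + 1) = r / 2" using G by (simp add: \<delta>_def divide_simps)
      then have "\<delta> * G \<le> r" using \<delta> r by (simp add: distrib_left)
      then show ?thesis using \<delta> by simp
    qed
    finally show ?thesis by simp
  qed
  then show "\<exists>N. \<forall>n\<ge>N. norm ((LINT x|M. f n x \<bullet> g x) - 0) < r" by blast
qed

lemma square_integrable_on_inner_integrable:
  fixes f g :: "'a::euclidean_space \<Rightarrow> 'b::euclidean_space"
  assumes "square_integrable_on S f" "square_integrable_on S g"
  shows "integrable (lebesgue_on S) (\<lambda>x. f x \<bullet> g x)"
proof (rule Bochner_Integration.integrable_bound)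
  show "integrable (lebesgue_on S) (\<lambda>x. (norm (f x))\<^sup>2 + (norm (g x))\<^sup>2)"
    using assms by (auto simp: square_integrable_on_def)
  have "\<bar>f x \<bullet> g x\<bar> \<le> (norm (f x))\<^sup>2 + (norm (g x))\<^sup>2" for x
  proof -
    have "2 * (norm (f x) * norm (g x)) \<le> (norm (f x))\<^sup>2 + (norm (g x))\<^sup>2"
      using sum_squares_bound[of "norm (f x)" "norm (g x)"] by (simp add: mult.assoc)
    moreover have "0 \<le> norm (f x) * norm (g x)" by simp
    ultimately show ?thesis using Cauchy_Schwarz_ineq2[of "f x" "g x"] by linarith
  qed
  then show "AE x in lebesgue_on S. norm (f x \<bullet> g x) \<le> norm ((norm (f x))\<^sup>2 + (norm (g x))\<^sup>2)"
    by (intro AE_I2) auto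
qed (use assms in \<open>auto simp: square_integrable_on_def\<close>)

lemma square_integrable_on_diff:
  fixes f g :: "'a::euclidean_space \<Rightarrow> 'b::euclidean_space"
  assumes "square_integrable_on S f" "square_integrable_on S g"
  shows "square_integrable_on S (\<lambda>x. f x - g x)"
proof -
  have "(\<lambda>x. (norm (f x - g x))\<^sup>2) = (\<lambda>x. (norm (f x))\<^sup>2 + (norm (g x))\<^sup>2 - 2 * (f x \<bullet> g x))"
    by (auto simp: fun_eq_iff power2_norm_eq_inner inner_diff inner_commute)
  then show ?thesis
    using assms square_integrable_on_inner_integrable[OF assms]
    by (auto simp: square_integrable_on_def)
qed

lemma test_function_square_integrable:
  assumes S: "S \<in> sets lebesgue" "bounded S" and tf: "test_function S \<phi> D\<phi>"
  shows "square_integrable_on S \<phi>" "square_integrable_on S D\<phi>"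
proof -
  have \<phi>: "continuous_on UNIV \<phi>" "continuous_on UNIV D\<phi>"
    using tf GDERIV_continuous_on by (auto simp: test_function_def)
  have comp: "compact (closure S)" using S by simp
  have "bounded (\<phi> ` closure S)" "bounded (D\<phi> ` closure S)"
    using continuous_on_subset[OF \<phi>(1)] continuous_on_subset[OF \<phi>(2)] comp
    by (auto intro!: compact_imp_bounded compact_continuous_image)
  then obtain B B' where "\<And>x. x \<in> closure S \<Longrightarrow> norm (\<phi> x) \<le> B"
      "\<And>x. x \<in> closure S \<Longrightarrow> norm (D\<phi> x) \<le> B'"
    by (auto simp: bounded_iff)
  then have "\<And>x. x \<in> S \<Longrightarrow> norm (\<phi> x) \<le> B" "\<And>x. x \<in> S \<Longrightarrow> norm (D\<phi> x) \<le> B'"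
    using closure_subset by blast+
  then show "square_integrable_on S \<phi>" "square_integrable_on S D\<phi>"
    using test_function_measurable[OF tf]
    by (auto intro!: square_integrable_on_if_bounded[OF S])
qed

text \<open>The identity passes from test functions to their \<open>H\<^sup>1\<close> limits because both
  sides are continuous in the \<open>L\<^sup>2\<close> norm.\<close>

theorem H10_integral_by_parts:
  fixes \<psi> :: "'a::euclidean_space \<Rightarrow> real"
  assumes S: "S \<in> sets lebesgue" "bounded S" and H: "H10 S u g"
    and \<psi>: "\<And>x. GDERIV \<psi> x :> D\<psi> x" "continuous_on UNIV D\<psi>"
  shows "(LINT x|lebesgue_on S. (g x \<bullet> b) * \<psi> x) = - (LINT x|lebesgue_on S. u x * (D\<psi> x \<bullet> b))"
proof -
  obtain \<phi> D where tf: "\<And>n::nat. test_function S (\<phi> n) (D n)"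
    and l1: "(\<lambda>n. LINT x|lebesgue_on S. (\<phi> n x - u x)\<^sup>2) \<longlonglongrightarrow> 0"
    and l2: "(\<lambda>n. LINT x|lebesgue_on S. (norm (D n x - g x))\<^sup>2) \<longlonglongrightarrow> 0"
    and u: "square_integrable_on S u" and g: "square_integrable_on S g"
    using H by (auto simp: H10_def)
  note \<psi>cont = GDERIV_continuous_on[OF \<psi>(1)]
  have sq: "square_integrable_on S w" if "continuous_on UNIV w" for w :: "'a \<Rightarrow> 'b::euclidean_space"
  proof -
    have "bounded (w ` closure S)"
      using continuous_on_subset[OF that] S by (intro compact_imp_bounded compact_continuous_image) auto
    then obtain B where "\<And>x. x \<in> S \<Longrightarrow> norm (w x) \<le> B"
      using closure_subset by (force simp: bounded_iff)
    then show ?thesis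
      by (intro square_integrable_on_if_bounded[OF S] borel_measurable_lebesgue_on_continuous that)
  qed
  have s1: "square_integrable_on S (\<lambda>x. D\<psi> x \<bullet> b)" and s2: "square_integrable_on S (\<lambda>x. \<psi> x *\<^sub>R b)"
    by (intro sq continuous_intros \<psi>cont \<psi>(2))+
  have tfs: "square_integrable_on S (\<phi> n)" "square_integrable_on S (D n)" for n
    by (rule test_function_square_integrable[OF S tf])+
  have d1: "square_integrable_on S (\<lambda>x. \<phi> n x - u x)" and d2: "square_integrable_on S (\<lambda>x. D n x - g x)" for n
    by (intro square_integrable_on_diff tfs u g)+
  have "(\<lambda>n. LINT x|lebesgue_on S. (\<phi> n x - u x) \<bullet> (D\<psi> x \<bullet> b)) \<longlonglongrightarrow> 0"
    by (rule integral_inner_tendsto_0)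
      (use d1 s1 l1 in \<open>auto simp: square_integrable_on_def\<close>)
  moreover have "(LINT x|lebesgue_on S. (\<phi> n x - u x) \<bullet> (D\<psi> x \<bullet> b)) =
      (LINT x|lebesgue_on S. \<phi> n x \<bullet> (D\<psi> x \<bullet> b)) - (LINT x|lebesgue_on S. u x \<bullet> (D\<psi> x \<bullet> b))" for n
    unfolding inner_diff_left
    by (intro Bochner_Integration.integral_diff square_integrable_on_inner_integrable tfs u s1)
  ultimately have "(\<lambda>n. (LINT x|lebesgue_on S. \<phi> n x * (D\<psi> x \<bullet> b)) - (LINT x|lebesgue_on S. u x * (D\<psi> x \<bullet> b))) \<longlonglongrightarrow> 0"
    by simp
  then have L1: "(\<lambda>n. LINT x|lebesgue_on S. \<phi> n x * (D\<psi> x \<bullet> b)) \<longlonglongrightarrow> (LINT x|lebesgue_on S. u x * (D\<psi> x \<bullet> b))"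
    by (simp add: LIM_zero_iff)
  have "(\<lambda>n. LINT x|lebesgue_on S. (D n x - g x) \<bullet> (\<psi> x *\<^sub>R b)) \<longlonglongrightarrow> 0"
    by (rule integral_inner_tendsto_0)
      (use d2 s2 l2 in \<open>auto simp: square_integrable_on_def\<close>)
  moreover have "(LINT x|lebesgue_on S. (D n x - g x) \<bullet> (\<psi> x *\<^sub>R b)) =
      (LINT x|lebesgue_on S. D n x \<bullet> (\<psi> x *\<^sub>R b)) - (LINT x|lebesgue_on S. g x \<bullet> (\<psi> x *\<^sub>R b))" for n
    unfolding inner_diff_left
    by (intro Bochner_Integration.integral_diff square_integrable_on_inner_integrable tfs g s2)
  ultimately have "(\<lambda>n. (LINT x|lebesgue_on S. (D n x \<bullet> b) * \<psi> x) - (LINT x|lebesgue_on S. (g x \<bullet> b) * \<psi> x)) \<longlonglongrightarrow> 0"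
    by (simp add: mult.commute)
  then have L2: "(\<lambda>n. LINT x|lebesgue_on S. (D n x \<bullet> b) * \<psi> x) \<longlonglongrightarrow> (LINT x|lebesgue_on S. (g x \<bullet> b) * \<psi> x)"
    by (simp add: LIM_zero_iff)
  have "(\<lambda>n. LINT x|lebesgue_on S. (D n x \<bullet> b) * \<psi> x) \<longlonglongrightarrow> - (LINT x|lebesgue_on S. u x * (D\<psi> x \<bullet> b))"
    unfolding integral_by_parts_test_function[OF S(1) tf \<psi>]
    by (rule tendsto_minus[OF L1])
  with L2 show ?thesis by (rule LIMSEQ_unique)
qed


section \<open>Completeness of the sine modes of a rectangle\<close>

text \<open>By measurability, \<open>sgn w\<close> is almost everywhere a limit of continuous functions,
  which may be truncated to values in \<open>[-1, 1]\<close>.  Integrating \<open>w\<close>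
  against them gives 0 and tends to the integral of \<open>\<bar>w\<bar>\<close>.\<close>

lemma AE_eq_0_if_orthogonal_to_continuous:
  fixes w :: "'a::euclidean_space \<Rightarrow> real"
  assumes S: "S \<in> sets lebesgue" and w: "integrable (lebesgue_on S) w"
    and orth: "\<And>F. continuous_on UNIV F \<Longrightarrow> (LINT x|lebesgue_on S. w x * F x) = 0"
  shows "AE x in lebesgue_on S. w x = 0"
proof -
  have wm[measurable]: "w \<in> borel_measurable (lebesgue_on S)" using w by auto
  have "(\<lambda>x. sgn (w x)) \<in> borel_measurable (lebesgue_on S)" by measurable
  then have "(\<lambda>x. sgn (w x)) measurable_on S"
    by (simp add: measurable_on_iff_borel_measurable[OF S])
  then obtain N g where N: "negligible N" and g: "\<And>n. continuous_on UNIV (g n)"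
    and lim: "\<And>x. x \<notin> N \<Longrightarrow> (\<lambda>n. g n x) \<longlonglongrightarrow> (if x \<in> S then sgn (w x) else 0)"
    unfolding measurable_on_def by blast
  \<comment> \<open>Truncation provides the domination by \<open>\<bar>w\<bar>\<close> and does not affect the limit, a sign.\<close>
  define h where "h n x = max (- 1) (min 1 (g n x))" for n x
  have h: "continuous_on UNIV (h n)" for n
    unfolding h_def by (intro continuous_intros g)
  have hb: "\<bar>h n x\<bar> \<le> 1" for n x by (auto simp: h_def)
  have "AE x in lebesgue. x \<notin> N"
    using N by (intro AE_not_in) (simp add: negligible_iff_null_sets)
  then have AEN: "AE x in lebesgue_on S. x \<in> S \<and> x \<notin> N"
    using S by (subst AE_restrict_space_iff) auto
  have "(\<lambda>n. LINT x|lebesgue_on S. w x * h n x) \<longlonglongrightarrow> (LINT x|lebesgue_on S. \<bar>w x\<bar>)"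
  proof (rule integral_dominated_convergence[where w = "\<lambda>x. \<bar>w x\<bar>"])
    show "integrable (lebesgue_on S) (\<lambda>x. \<bar>w x\<bar>)" using w by auto
    show "(\<lambda>x. w x * h n x) \<in> borel_measurable (lebesgue_on S)" for n
      using borel_measurable_lebesgue_on_continuous[OF h] by measurable
    show "AE x in lebesgue_on S. norm (w x * h n x) \<le> \<bar>w x\<bar>" for n
      using hb by (intro AE_I2) (simp add: abs_mult mult_left_le)
    show "AE x in lebesgue_on S. (\<lambda>n. w x * h n x) \<longlonglongrightarrow> \<bar>w x\<bar>"
      using AEN
    proof eventually_elim
      fix x assume x: "x \<in> S \<and> x \<notin> N"
      have "(\<lambda>n. w x * h n x) \<longlonglongrightarrow> w x * max (- 1) (min 1 (sgn (w x)))"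
        unfolding h_def using lim[of x] x by (intro tendsto_intros) auto
      moreover have "w x * max (- 1) (min 1 (sgn (w x))) = \<bar>w x\<bar>"
        by (auto simp: sgn_if)
      ultimately show "(\<lambda>n. w x * h n x) \<longlonglongrightarrow> \<bar>w x\<bar>" by simp
    qed
  qed measurable
  then have "(LINT x|lebesgue_on S. \<bar>w x\<bar>) = 0"
    using orth[OF h] by (simp add: LIMSEQ_const_iff)
  then show ?thesis
    using w by (subst (asm) integral_nonneg_eq_0_iff_AE) auto
qed

definition rectangle :: "real \<Rightarrow> real \<Rightarrow> (real ^ 2) set" where
  "rectangle a b = cbox 0 (vector [a, b])"

abbreviation open_rectangle :: "real \<Rightarrow> real \<Rightarrow> (real ^ 2) set" where
  "open_rectangle a b \<equiv> interior (rectangle a b)"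

lemma mem_rectangle: "x \<in> rectangle a b \<longleftrightarrow> 0 \<le> x $ 1 \<and> x $ 1 \<le> a \<and> 0 \<le> x $ 2 \<and> x $ 2 \<le> b"
  by (auto simp: rectangle_def mem_box_cart forall_2)

lemma mem_interior_rectangle:
  "x \<in> interior (rectangle a b) \<longleftrightarrow> 0 < x $ 1 \<and> x $ 1 < a \<and> 0 < x $ 2 \<and> x $ 2 < b"
  by (auto simp: rectangle_def mem_box_cart forall_2)

definition sine_mode :: "real \<Rightarrow> real \<Rightarrow> nat \<Rightarrow> nat \<Rightarrow> real ^ 2 \<Rightarrow> real" where
  "sine_mode a b m n x = sin (real m * pi / a * x $ 1) * sin (real n * pi / b * x $ 2)"

text \<open>The linear span of all modes.  The index 0 is included although it gives the zero function,
  because multiplication by a cosine shifts the indices by one in both directions.\<close>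

inductive_set sine_span :: "real \<Rightarrow> real \<Rightarrow> (real ^ 2 \<Rightarrow> real) set" for a b where
  mode: "sine_mode a b m n \<in> sine_span a b"
| add: "f \<in> sine_span a b \<Longrightarrow> g \<in> sine_span a b \<Longrightarrow> (\<lambda>x. f x + g x) \<in> sine_span a b"
| scale: "f \<in> sine_span a b \<Longrightarrow> (\<lambda>x. c * f x) \<in> sine_span a b"

lemma cos_times_sin: "cos y * sin (real m * y) = (sin (real (Suc m) * y) + sin (real (m - 1) * y)) / 2"
  if "m > 0" for y :: real
proof -
  have "real (Suc m) * y = real m * y + y" "real (m - 1) * y = real m * y - y"
    using that by (auto simp: algebra_simps of_nat_diff)
  then show ?thesis by (simp only: sin_add sin_diff) (simp add: mult.commute)
qed

lemma sine_span_cos1: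
  assumes "f \<in> sine_span a b"
  shows "(\<lambda>x. cos (pi / a * x $ 1) * f x) \<in> sine_span a b"
  using assms
proof induction
  case (mode m n)
  show ?case
  proof (cases "m = 0")
    case True
    then have "(\<lambda>x. cos (pi / a * x $ 1) * sine_mode a b m n x) = sine_mode a b m n"
      by (simp add: sine_mode_def fun_eq_iff)
    then show ?thesis by (simp add: sine_span.mode)
  next
    case False
    have "(\<lambda>x. cos (pi / a * x $ 1) * sine_mode a b m n x) =
      (\<lambda>x. (1/2) * (sine_mode a b (Suc m) n x + sine_mode a b (m - 1) n x))"
    proof
      fix x :: "real ^ 2"
      let ?y = "pi / a * x $ 1" and ?S = "sin (real n * pi / b * x $ 2)"
      have mode: "sine_mode a b k n x = sin (real k * ?y) * ?S" for k
        by (simp add: sine_mode_def mult.assoc)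
      have "cos ?y * sin (real m * ?y) = (sin (real (Suc m) * ?y) + sin (real (m - 1) * ?y)) / 2"
        by (rule cos_times_sin) (use False in simp)
      then have "(cos ?y * sin (real m * ?y)) * ?S = (sin (real (Suc m) * ?y) + sin (real (m - 1) * ?y)) / 2 * ?S"
        by (rule arg_cong)
      also have "\<dots> = (1/2) * (sin (real (Suc m) * ?y) * ?S + sin (real (m - 1) * ?y) * ?S)"
        by (simp only: distrib_right times_divide_eq_left mult_1_left)
      finally show "cos ?y * sine_mode a b m n x =
        (1/2) * (sine_mode a b (Suc m) n x + sine_mode a b (m - 1) n x)"
        unfolding mode by (simp only: mult.assoc)
    qed
    then show ?thesis by (simp only:) (intro sine_span.intros)
  qed
next
  case (add f g)
  from sine_span.add[OF add.IH] show ?case by (simp add: distrib_left)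
next
  case (scale f c)
  from sine_span.scale[OF scale.IH, of c] show ?case by (simp add: mult.left_commute)
qed

text \<open>Exchanging the two coordinates reduces multiplication by a cosine of the second coordinate to
  the first.\<close>

lemma sine_span_swap:
  assumes "f \<in> sine_span a b"
  shows "(\<lambda>x. f (\<chi> i. x $ (if i = 1 then 2 else 1))) \<in> sine_span b a"
  using assms
proof induction
  case (mode m n)
  have "(\<lambda>x. sine_mode a b m n (\<chi> i. x $ (if i = 1 then 2 else 1))) = sine_mode b a n m"
    by (auto simp: sine_mode_def fun_eq_iff)
  then show ?case by (simp add: sine_span.mode)
qed (auto intro: sine_span.intros)

lemma sine_span_cos2:
  assumes "f \<in> sine_span a b"
  shows "(\<lambda>x. cos (pi / b * x $ 2) * f x) \<in> sine_span a b"
proof -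
  have "(\<chi> i. (\<chi> j::2. x $ (if j = 1 then 2 else 1)) $ (if i = 1 then 2 else 1)) = x" for x :: "real ^ 2"
    by (auto simp: vec_eq_iff forall_2)
  then show ?thesis
    using sine_span_swap[OF sine_span_cos1[OF sine_span_swap[OF assms]]] by simp
qed

lemma sine_span_continuous: "f \<in> sine_span a b \<Longrightarrow> continuous_on UNIV f"
proof (induction rule: sine_span.induct)
  case (mode m n)
  show ?case unfolding sine_mode_def[abs_def] by (intro continuous_intros)
qed (auto intro!: continuous_intros)

lemma interior_rectangle_props:
  "interior (rectangle a b) \<in> sets lebesgue" "bounded (interior (rectangle a b))"
  "open (interior (rectangle a b))"
  by (auto simp: rectangle_def bounded_box)

lemma integrable_mult_continuous:
  fixes w F :: "'a::euclidean_space \<Rightarrow> real"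
  assumes "bounded S" "integrable (lebesgue_on S) w" "continuous_on UNIV F"
  shows "integrable (lebesgue_on S) (\<lambda>x. w x * F x)"
proof -
  have "bounded (F ` closure S)"
    using assms continuous_on_subset[OF assms(3)]
    by (intro compact_imp_bounded compact_continuous_image) auto
  then obtain B where B: "\<And>x. x \<in> S \<Longrightarrow> norm (F x) \<le> B"
    using closure_subset by (force simp: bounded_iff)
  have "integrable (lebesgue_on S) (\<lambda>x. B * w x)" using assms(2) by simp
  then show ?thesis
  proof (rule Bochner_Integration.integrable_bound)
    show "(\<lambda>x. w x * F x) \<in> borel_measurable (lebesgue_on S)"
      using assms(2) borel_measurable_lebesgue_on_continuous[OF assms(3), of S] by simp
    have "norm (w x * F x) \<le> norm (B * w x)" if "x \<in> S" for x
      using mult_right_mono[OF B[OF that], of "\<bar>w x\<bar>"] B[OF that]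
      by (auto simp: abs_mult mult.commute intro: order_trans mult_right_mono)
    then show "AE x in lebesgue_on S. norm (w x * F x) \<le> norm (B * w x)"
      by (intro AE_I2) (simp add: space_restrict_space)
  qed
qed

text \<open>Let \<open>s\<close> be the mode with \<open>m = n = 1\<close>, which is positive inside the
  rectangle.  The continuous functions \<open>f\<close> such that multiplication by
  \<open>f\<close> maps the span of the modes into itself form an algebra.  It contains the
  cosines of both coordinates, hence separates the points of the closed rectangle and is dense by
  the Stone-Weierstrass theorem.  Since \<open>f s\<close> is in the span, \<open>w s\<close> is
  orthogonal to every such \<open>f\<close> and therefore to every continuous function, which
  forces \<open>w s = 0\<close> and \<open>w = 0\<close> almost everywhere.\<close>

theorem sine_modes_complete:
  assumes ab: "a > 0" "b > 0"
    and w: "integrable (lebesgue_on (open_rectangle a b)) w"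
    and orth: "\<And>m n. m \<ge> 1 \<Longrightarrow> n \<ge> 1 \<Longrightarrow>
      (LINT x|lebesgue_on (open_rectangle a b). w x * sine_mode a b m n x) = 0"
  shows "AE x in lebesgue_on (open_rectangle a b). w x = 0"
proof -
  let ?M = "lebesgue_on (open_rectangle a b)"
  let ?s = "sine_mode a b 1 1"
  note \<Omega> = interior_rectangle_props[of a b]
  have orth': "(LINT x|?M. w x * f x) = 0" if "f \<in> sine_span a b" for f
    using that
  proof induction
    case (mode m n)
    show ?case
    proof (cases "m = 0 \<or> n = 0")
      case True
      then have "sine_mode a b m n = (\<lambda>_. 0)" by (auto simp: sine_mode_def fun_eq_iff)
      then show ?thesis by simp
    next
      case False
      then show ?thesis using orth[of m n] by simp
    qed
  next
    case (add f g)
    then show ?case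
      using integrable_mult_continuous[OF \<Omega>(2) w] sine_span_continuous
      by (simp add: distrib_left)
  next
    case (scale f c)
    then show ?case by (simp add: mult.left_commute)
  qed
  have s: "?s \<in> sine_span a b" by (rule sine_span.mode)
  note scont = sine_span_continuous[OF s]
  note wsint = integrable_mult_continuous[OF \<Omega>(2) w scont]
  define R where "R = {f. continuous_on (rectangle a b) f \<and> (\<forall>h\<in>sine_span a b. (\<lambda>x. f x * h x) \<in> sine_span a b)}"
  interpret function_ring_on R "rectangle a b"
  proof
    show "compact (rectangle a b)" by (simp add: rectangle_def)
    fix f assume f: "f \<in> R"
    then show "continuous_on (rectangle a b) f" by (simp add: R_def)
    fix g assume g: "g \<in> R"
    show "(\<lambda>x. f x + g x) \<in> R" 
      using f g by (auto simp: R_def distrib_right intro: sine_span.add intro!: continuous_intros)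
    show "(\<lambda>x. f x * g x) \<in> R"
      using f g by (auto simp: R_def mult.assoc intro!: continuous_intros)
  next
    fix c :: real
    show "(\<lambda>_. c) \<in> R" by (auto simp: R_def intro: sine_span.scale)
  next
    fix x y assume xy: "x \<in> rectangle a b" "y \<in> rectangle a b" "x \<noteq> y"
    have c1: "(\<lambda>x. cos (pi / a * x $ 1)) \<in> R" and c2: "(\<lambda>x. cos (pi / b * x $ 2)) \<in> R"
      unfolding R_def using ab
      by (auto intro!: sine_span_cos1 sine_span_cos2 continuous_on_cos continuous_on_mult_left
          continuous_on_component continuous_on_id simp del: times_divide_eq_left)
    have inj: "s = t" if "cos (pi / c * s) = cos (pi / c * t)" "c > 0" "0 \<le> s" "s \<le> c" "0 \<le> t" "t \<le> c" for c s t :: real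
    proof -
      have "pi / c * s = pi / c * t"
        by (rule cos_inj_pi) (use that in \<open>auto simp: field_simps\<close>)
      then show ?thesis using that by simp
    qed
    have "x $ 1 \<noteq> y $ 1 \<or> x $ 2 \<noteq> y $ 2" using xy(3) by (auto simp: vec_eq_iff forall_2)
    then show "\<exists>f\<in>R. f x \<noteq> f y"
    proof
      assume "x $ 1 \<noteq> y $ 1"
      then show ?thesis
        using inj[of a "x $ 1" "y $ 1"] ab xy(1,2) unfolding mem_rectangle by (intro bexI[OF _ c1]) blast
    next
      assume "x $ 2 \<noteq> y $ 2"
      then show ?thesis
        using inj[of b "x $ 2" "y $ 2"] ab xy(1,2) unfolding mem_rectangle by (intro bexI[OF _ c2]) blast
    qed
  qed
  have "(LINT x|?M. (w x * ?s x) * F x) = 0" if F: "continuous_on UNIV F" for F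
  proof -
    define A where "A = (LINT x|?M. \<bar>w x * ?s x\<bar>)"
    have A: "A \<ge> 0" by (simp add: A_def)
    have bound: "norm (LINT x|?M. (w x * ?s x) * F x) \<le> e * A" if e: "e > 0" for e
    proof -
      obtain f where f: "f \<in> R" "\<And>x. x \<in> rectangle a b \<Longrightarrow> \<bar>F x - f x\<bar> < e"
        using Stone_Weierstrass_basic[OF continuous_on_subset[OF F subset_UNIV] e] by blast
      have fs: "(\<lambda>x. f x * ?s x) \<in> sine_span a b" using f(1) s by (simp add: R_def)
      have int1: "integrable ?M (\<lambda>x. (w x * ?s x) * F x)"
        by (rule integrable_mult_continuous[OF \<Omega>(2) wsint F])
      have int2: "integrable ?M (\<lambda>x. w x * (f x * ?s x))"
        by (rule integrable_mult_continuous[OF \<Omega>(2) w sine_span_continuous[OF fs]])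
      have "(LINT x|?M. (w x * ?s x) * F x) = (LINT x|?M. (w x * ?s x) * F x) - (LINT x|?M. w x * (f x * ?s x))"
        using orth'[OF fs] by simp
      also have "\<dots> = (LINT x|?M. (w x * ?s x) * F x - w x * (f x * ?s x))"
        using int1 int2 by simp
      also have "norm \<dots> \<le> (LINT x|?M. e * \<bar>w x * ?s x\<bar>)"
      proof (rule Bochner_Integration.integral_norm_bound_integral)
        show "integrable ?M (\<lambda>x. e * \<bar>w x * ?s x\<bar>)" using wsint by auto
        show "integrable ?M (\<lambda>x. (w x * ?s x) * F x - w x * (f x * ?s x))" using int1 int2 by auto
        fix x assume "x \<in> space ?M"
        then have "x \<in> rectangle a b" using interior_subset by (auto simp: space_restrict_space)
        then have "\<bar>F x - f x\<bar> * \<bar>w x * ?s x\<bar> \<le> e * \<bar>w x * ?s x\<bar>"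
          by (rule mult_right_mono[OF less_imp_le[OF f(2)]]) simp
        moreover have "(w x * ?s x) * F x - w x * (f x * ?s x) = (F x - f x) * (w x * ?s x)"
          by (simp add: algebra_simps)
        ultimately show "norm ((w x * ?s x) * F x - w x * (f x * ?s x)) \<le> e * \<bar>w x * ?s x\<bar>"
          by (simp add: abs_mult)
      qed
      finally show ?thesis by (simp add: A_def)
    qed
    show ?thesis
    proof (rule ccontr)
      assume "\<not> ?thesis"
      then have pos: "norm (LINT x|?M. (w x * ?s x) * F x) > 0" (is "?I > 0") by simp
      \<comment> \<open>A precision \<open>e\<close> for which the bound \<open>e * A\<close> is smaller than the integral itself.\<close>
      have aux: "c / (2 * (A + 1)) * A < c" if "c > 0" for c
        using that A by (auto simp: field_simps intro!: add_nonneg_pos mult_nonneg_nonneg)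
      have "?I \<le> (?I / (2 * (A + 1))) * A" using pos A by (intro bound) auto
      also have "\<dots> < ?I" by (rule aux[OF pos])
      finally show False by simp
    qed
  qed
  then have "AE x in ?M. w x * ?s x = 0"
    by (intro AE_eq_0_if_orthogonal_to_continuous \<Omega>(1) wsint)
  then show ?thesis
    using AE_space
  proof eventually_elim
    case (elim x)
    have "x \<in> interior (rectangle a b)" using elim by (simp add: space_restrict_space)
    then have "0 < x $ 1" "x $ 1 < a" "0 < x $ 2" "x $ 2 < b" by (auto simp: mem_interior_rectangle)
    then have "?s x > 0"
      using ab unfolding sine_mode_def by (intro mult_pos_pos sin_gt_zero) (auto simp: field_simps)
    with elim show "w x = 0" by simp
  qed
qed


section \<open>The Dirichlet spectrum of a rectangle\<close>

definition rect_eigenvalue :: "real \<Rightarrow> real \<Rightarrow> nat \<Rightarrow> nat \<Rightarrow> real" where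
  "rect_eigenvalue a b m n = (real m * pi / a)\<^sup>2 + (real n * pi / b)\<^sup>2"

definition sine_gradient :: "real \<Rightarrow> real \<Rightarrow> nat \<Rightarrow> nat \<Rightarrow> real ^ 2 \<Rightarrow> real ^ 2" where
  "sine_gradient a b m n x =
     (real m * pi / a * cos (real m * pi / a * x $ 1) * sin (real n * pi / b * x $ 2)) *\<^sub>R axis 1 1 +
     (real n * pi / b * sin (real m * pi / a * x $ 1) * cos (real n * pi / b * x $ 2)) *\<^sub>R axis 2 1"

lemma GDERIV_product:
  fixes x :: "real ^ 2"
  assumes "(p has_field_derivative p') (at (x $ 1))" "(q has_field_derivative q') (at (x $ 2))"
  shows "GDERIV (\<lambda>x. p (x $ 1) * q (x $ 2)) x :> (p' * q (x $ 2)) *\<^sub>R axis 1 1 + (p (x $ 1) * q') *\<^sub>R axis 2 1"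
proof -
  have coord: "GDERIV (\<lambda>x. x $ i) x :> axis i 1" for i :: 2
    unfolding gderiv_def inner_axis
    using bounded_linear_imp_has_derivative[OF bounded_linear_vec_nth] by simp
  have "GDERIV (\<lambda>x. p (x $ 1) * q (x $ 2)) x :>
      p (x $ 1) *\<^sub>R (q' *\<^sub>R axis 2 1) + q (x $ 2) *\<^sub>R (p' *\<^sub>R axis 1 1)"
    by (rule GDERIV_mult[OF GDERIV_DERIV_compose[OF coord assms(1)] GDERIV_DERIV_compose[OF coord assms(2)]])
  then show ?thesis by (simp add: add.commute mult.commute)
qed

lemma DERIV_sin_scaled: "((\<lambda>s. sin (c * s)) has_field_derivative c * cos (c * s)) (at s)"
  and DERIV_cos_scaled: "((\<lambda>s. c * cos (c * s)) has_field_derivative - (c\<^sup>2 * sin (c * s))) (at s)"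
  for c s :: real
  by (auto intro!: derivative_eq_intros simp: power2_eq_square)

lemma GDERIV_sine_mode: "GDERIV (sine_mode a b m n) x :> sine_gradient a b m n x"
  unfolding sine_mode_def[abs_def]
  by (rule GDERIV_subst[OF GDERIV_product[OF DERIV_sin_scaled DERIV_sin_scaled]])
    (simp add: sine_gradient_def mult_ac)

lemma continuous_on_sine_gradient: "continuous_on UNIV (sine_gradient a b m n)"
  unfolding sine_gradient_def[abs_def] divide_inverse by (intro continuous_intros)

lemma sine_gradient_inner:
  "sine_gradient a b m n x \<bullet> axis 1 1 = real m * pi / a * cos (real m * pi / a * x $ 1) * sin (real n * pi / b * x $ 2)"
  "sine_gradient a b m n x \<bullet> axis 2 1 = sin (real m * pi / a * x $ 1) * (real n * pi / b * cos (real n * pi / b * x $ 2))"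
  by (auto simp: sine_gradient_def inner_add_left inner_axis_axis)

lemma negligible_sin_zeros:
  assumes "c \<noteq> 0"
  shows "negligible {x :: real ^ 2. sin (c * x $ k) = 0}"
proof -
  have "{x :: real ^ 2. sin (c * x $ k) = 0} = (\<Union>i::int. {x. x $ k = of_int i * pi / c})"
    using assms by (auto simp: sin_zero_iff_int2 field_simps)
  moreover have "(\<Union>i::int. {x :: real ^ 2. x $ k = of_int i * pi / c}) \<in> null_sets lebesgue"
    by (intro null_sets_UN' countableI_type)
      (use negligible_standard_hyperplane[of "axis k 1 :: real ^ 2"] in
        \<open>auto simp: inner_axis axis_in_Basis_iff negligible_iff_null_sets\<close>)
  ultimately show ?thesis by (simp add: negligible_iff_null_sets)
qed

lemma multiplicity_ge_1:
  assumes "\<mu> \<in> dirichlet_spectrum S"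
  shows "1 \<le> dirichlet_multiplicity S \<mu>"
proof -
  obtain u where u: "u \<in> dirichlet_eigenspace S \<mu>" "\<not> (AE x in lebesgue_on S. u x = 0)"
    using assms by (auto simp: dirichlet_spectrum_def)
  have "c 0 = 0" if "AE x in lebesgue_on S. c (0::nat) * u x = 0" for c :: "nat \<Rightarrow> real"
  proof (rule ccontr)
    assume "c 0 \<noteq> 0"
    with that have "AE x in lebesgue_on S. u x = 0" by simp
    with u(2) show False by simp
  qed
  then have "\<exists>v. (\<forall>i<1. v i \<in> dirichlet_eigenspace S \<mu>) \<and>
        (\<forall>c :: nat \<Rightarrow> real. (AE x in lebesgue_on S. (\<Sum>i<1. c i * v i x) = 0) \<longrightarrow> (\<forall>i<1. c i = 0))"
    using u(1) by (intro exI[of _ "\<lambda>_. u"]) auto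
  then show ?thesis
    unfolding dirichlet_multiplicity_def one_enat_def by (intro Sup_upper) blast
qed

context
  fixes a b :: real
  assumes a: "a > 0" and b: "b > 0"
begin

lemma negligible_sine_mode_zeros:
  assumes "m \<ge> 1" "n \<ge> 1"
  shows "negligible {x. sine_mode a b m n x = 0}"
proof -
  have "{x. sine_mode a b m n x = 0} =
    {x. sin (real m * pi / a * x $ 1) = 0} \<union> {x. sin (real n * pi / b * x $ 2) = 0}"
    by (auto simp: sine_mode_def)
  then show ?thesis
    using negligible_sin_zeros[of "real m * pi / a" 1] negligible_sin_zeros[of "real n * pi / b" 2]
      assms a b by (simp add: negligible_Un_eq)
qed

lemma H10_sine_mode:
  assumes "m \<ge> 1" "n \<ge> 1"
  shows "H10 (open_rectangle a b) (sine_mode a b m n) (sine_gradient a b m n)"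
proof (rule H10_if_C1_zero_on_frontier)
  show "open (open_rectangle a b)" "bounded (open_rectangle a b)" by (rule interior_rectangle_props)+
  show "GDERIV (sine_mode a b m n) x :> sine_gradient a b m n x" for x
    by (rule GDERIV_sine_mode)
  show "continuous_on UNIV (sine_gradient a b m n)"
    by (rule continuous_on_sine_gradient)
  show "negligible {x \<in> open_rectangle a b. sine_mode a b m n x = 0}"
    by (rule negligible_subset[OF negligible_sine_mode_zeros[OF assms]]) auto
  fix x assume "x \<in> frontier (open_rectangle a b)"
  then have "x \<in> rectangle a b" "x \<notin> (open_rectangle a b)"
    by (auto simp: rectangle_def frontier_box split: if_splits)
  then have "x $ 1 = 0 \<or> x $ 1 = a \<or> x $ 2 = 0 \<or> x $ 2 = b"
    by (auto simp: mem_rectangle mem_interior_rectangle)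
  then show "sine_mode a b m n x = 0"
    using a b sin_npi by (auto simp: sine_mode_def)
qed

text \<open>Integration by parts in each coordinate against the corresponding component of the gradient of
  the mode; the second derivatives of the mode reproduce it up to the factor \<open>-(m
  \<pi>/a)\<^sup>2\<close> or \<open>-(n \<pi>/b)\<^sup>2\<close>.\<close>

lemma H10_green_sine_mode:
  assumes H: "H10 (open_rectangle a b) u g"
  shows "(LINT x|lebesgue_on (open_rectangle a b). g x \<bullet> sine_gradient a b m n x) =
    rect_eigenvalue a b m n * (LINT x|lebesgue_on (open_rectangle a b). u x * sine_mode a b m n x)"
proof -
  let ?\<alpha> = "real m * pi / a" and ?\<beta> = "real n * pi / b"
  let ?D1 = "\<lambda>x::real^2. (- (?\<alpha>\<^sup>2 * sin (?\<alpha> * x $ 1)) * sin (?\<beta> * x $ 2)) *\<^sub>R axis 1 1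
      + (?\<alpha> * cos (?\<alpha> * x $ 1) * (?\<beta> * cos (?\<beta> * x $ 2))) *\<^sub>R (axis 2 1 :: real^2)"
  let ?D2 = "\<lambda>x::real^2. (?\<alpha> * cos (?\<alpha> * x $ 1) * (?\<beta> * cos (?\<beta> * x $ 2))) *\<^sub>R axis 1 1
      + (sin (?\<alpha> * x $ 1) * - (?\<beta>\<^sup>2 * sin (?\<beta> * x $ 2))) *\<^sub>R (axis 2 1 :: real^2)"
  note \<Omega>p = interior_rectangle_props(1,2)[of a b]
  have 1: "(LINT x|lebesgue_on (open_rectangle a b). (g x \<bullet> axis 1 1) * (sine_gradient a b m n x \<bullet> axis 1 1))
      = - (LINT x|lebesgue_on (open_rectangle a b). u x * (?D1 x \<bullet> axis 1 1))"
  proof (rule H10_integral_by_parts[OF \<Omega>p H])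
    show "GDERIV (\<lambda>x. sine_gradient a b m n x \<bullet> axis 1 1) x :> ?D1 x" for x
      unfolding sine_gradient_inner
      by (rule GDERIV_product[OF DERIV_cos_scaled DERIV_sin_scaled])
    show "continuous_on UNIV ?D1" unfolding divide_inverse by (intro continuous_intros)
  qed
  have 2: "(LINT x|lebesgue_on (open_rectangle a b). (g x \<bullet> axis 2 1) * (sine_gradient a b m n x \<bullet> axis 2 1))
      = - (LINT x|lebesgue_on (open_rectangle a b). u x * (?D2 x \<bullet> axis 2 1))"
  proof (rule H10_integral_by_parts[OF \<Omega>p H])
    show "GDERIV (\<lambda>x. sine_gradient a b m n x \<bullet> axis 2 1) x :> ?D2 x" for x
      unfolding sine_gradient_inner
      by (rule GDERIV_product[OF DERIV_sin_scaled DERIV_cos_scaled])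
    show "continuous_on UNIV ?D2" unfolding divide_inverse by (intro continuous_intros)
  qed
  have D: "?D1 x \<bullet> axis 1 1 = - (?\<alpha>\<^sup>2 * sine_mode a b m n x)"
    "?D2 x \<bullet> axis 2 1 = - (?\<beta>\<^sup>2 * sine_mode a b m n x)" for x
  proof -
    have "(p *\<^sub>R axis 1 1 + q *\<^sub>R axis 2 1) \<bullet> (axis 1 1 :: real^2) = p"
      "(p *\<^sub>R axis 1 1 + q *\<^sub>R axis 2 1) \<bullet> (axis 2 1 :: real^2) = q" for p q
      by (auto simp: inner_add_left inner_axis_axis)
    then show "?D1 x \<bullet> axis 1 1 = - (?\<alpha>\<^sup>2 * sine_mode a b m n x)"
      "?D2 x \<bullet> axis 2 1 = - (?\<beta>\<^sup>2 * sine_mode a b m n x)"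
      by (auto simp only: sine_mode_def mult_ac mult_minus_left mult_minus_right)
  qed
  have g: "square_integrable_on (open_rectangle a b) g" using H by (simp add: H10_def)
  have comp: "continuous_on UNIV (\<lambda>x. sine_gradient a b m n x \<bullet> axis k 1)" for k
    by (intro continuous_intros continuous_on_sine_gradient)
  have int: "integrable (lebesgue_on (open_rectangle a b)) (\<lambda>x. (g x \<bullet> axis k 1) * (sine_gradient a b m n x \<bullet> axis k 1))" for k
  proof (rule integrable_mult_continuous[OF \<Omega>p(2) _ comp])
    have "square_integrable_on (open_rectangle a b) (\<lambda>_. axis k 1 :: real^2)"
      by (rule square_integrable_on_if_bounded[OF \<Omega>p]) auto
    then show "integrable (lebesgue_on (open_rectangle a b)) (\<lambda>x. g x \<bullet> axis k 1)"
      by (rule square_integrable_on_inner_integrable[OF g])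
  qed
  have "(LINT x|lebesgue_on (open_rectangle a b). g x \<bullet> sine_gradient a b m n x) =
      (LINT x|lebesgue_on (open_rectangle a b). (g x \<bullet> axis 1 1) * (sine_gradient a b m n x \<bullet> axis 1 1)
        + (g x \<bullet> axis 2 1) * (sine_gradient a b m n x \<bullet> axis 2 1))"
  proof -
    have "y \<bullet> z = (y \<bullet> axis 1 1) * (z \<bullet> axis 1 1) + (y \<bullet> axis 2 1) * (z \<bullet> axis 2 1)"
      for y z :: "real ^ 2"
      by (simp only: inner_axis) (simp add: inner_vec_def sum_2)
    then show ?thesis by (rule Bochner_Integration.integral_cong[OF refl])
  qed
  also have "\<dots> = ?\<alpha>\<^sup>2 * (LINT x|lebesgue_on (open_rectangle a b). u x * sine_mode a b m n x)
      + ?\<beta>\<^sup>2 * (LINT x|lebesgue_on (open_rectangle a b). u x * sine_mode a b m n x)"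
  proof -
    have "(LINT x|lebesgue_on (open_rectangle a b). u x * (c * sine_mode a b m n x))
      = c * (LINT x|lebesgue_on (open_rectangle a b). u x * sine_mode a b m n x)" for c
      by (simp add: mult.left_commute)
    with 1 2 show ?thesis
      unfolding D Bochner_Integration.integral_add[OF int int]
      by (simp only: mult_minus_right Bochner_Integration.integral_minus minus_minus)
  qed
  finally show ?thesis by (simp add: rect_eigenvalue_def distrib_right)
qed

lemma sine_mode_in_eigenspace:
  assumes "m \<ge> 1" "n \<ge> 1"
  shows "sine_mode a b m n \<in> dirichlet_eigenspace (open_rectangle a b) (rect_eigenvalue a b m n)"
  unfolding dirichlet_eigenspace_def
  using H10_sine_mode[OF assms] H10_green_sine_mode[of _ _ m n]
  by (auto simp: inner_commute mult.commute intro!: exI[of _ "sine_gradient a b m n"])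

lemma rect_eigenvalue_in_spectrum:
  assumes "m \<ge> 1" "n \<ge> 1"
  shows "rect_eigenvalue a b m n \<in> dirichlet_spectrum (open_rectangle a b)"
proof -
  have "\<not> (AE x in lebesgue_on (open_rectangle a b). sine_mode a b m n x = 0)"
  proof
    assume "AE x in lebesgue_on (open_rectangle a b). sine_mode a b m n x = 0"
    then have "AE x in lebesgue. x \<in> open_rectangle a b \<longrightarrow> sine_mode a b m n x = 0"
      using interior_rectangle_props(1) by (subst (asm) AE_restrict_space_iff) auto
    moreover have "AE x in lebesgue. x \<notin> {x. sine_mode a b m n x = 0}"
      using negligible_sine_mode_zeros[OF assms]
      by (intro AE_not_in) (simp add: negligible_iff_null_sets)
    ultimately have "AE x in lebesgue. x \<notin> (open_rectangle a b)" by eventually_elim auto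
    then have "negligible (open_rectangle a b)"
      using interior_rectangle_props(1)[of a b] by (simp add: AE_iff_null_sets negligible_iff_null_sets)
    moreover have "vector [a/2, b/2] \<in> open_rectangle a b" using a b by (simp add: mem_interior_rectangle)
    ultimately show False using open_not_negligible[of "open_rectangle a b"] by blast
  qed
  then show ?thesis
    using sine_mode_in_eigenspace[OF assms] by (auto simp: dirichlet_spectrum_def)
qed

lemma eigenspace_integrable:
  assumes "u \<in> dirichlet_eigenspace (open_rectangle a b) \<mu>"
  shows "integrable (lebesgue_on (open_rectangle a b)) u"
proof -
  obtain g where "H10 (open_rectangle a b) u g"
    using assms unfolding dirichlet_eigenspace_def by blast
  then have "square_integrable_on (open_rectangle a b) u" by (simp add: H10_def)
  moreover have "square_integrable_on (open_rectangle a b) (\<lambda>_. 1::real)"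
    by (rule square_integrable_on_if_bounded[OF interior_rectangle_props(1,2)]) auto
  ultimately have "integrable (lebesgue_on (open_rectangle a b)) (\<lambda>x. u x \<bullet> 1)"
    by (rule square_integrable_on_inner_integrable)
  then show ?thesis by simp
qed

text \<open>The weak equation tested with the mode and the Green identity evaluate the same integral with
  the factors \<open>\<mu>\<close> and \<open>rect_eigenvalue a b m n\<close>.\<close>

lemma eigenspace_orthogonal_sine_mode:
  assumes "u \<in> dirichlet_eigenspace (open_rectangle a b) \<mu>" "m \<ge> 1" "n \<ge> 1" "\<mu> \<noteq> rect_eigenvalue a b m n"
  shows "(LINT x|lebesgue_on (open_rectangle a b). u x * sine_mode a b m n x) = 0"
proof -
  obtain g where "H10 (open_rectangle a b) u g" and
    "(LINT x|lebesgue_on (open_rectangle a b). g x \<bullet> sine_gradient a b m n x) = \<mu> * (LINT x|lebesgue_on (open_rectangle a b). u x * sine_mode a b m n x)"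
    using assms(1) H10_sine_mode[OF assms(2,3)] unfolding dirichlet_eigenspace_def by blast
  then show ?thesis using H10_green_sine_mode[of u g m n] assms(4) by auto
qed

text \<open>Otherwise an eigenfunction would be orthogonal to all modes, contradicting completeness.\<close>

lemma spectrum_rectangle:
  assumes "\<mu> \<in> dirichlet_spectrum (open_rectangle a b)"
  shows "\<exists>m n. m \<ge> 1 \<and> n \<ge> 1 \<and> \<mu> = rect_eigenvalue a b m n"
proof (rule ccontr)
  assume neg: "\<not> ?thesis"
  obtain u where u: "u \<in> dirichlet_eigenspace (open_rectangle a b) \<mu>" "\<not> (AE x in lebesgue_on (open_rectangle a b). u x = 0)"
    using assms by (auto simp: dirichlet_spectrum_def)
  have "AE x in lebesgue_on (open_rectangle a b). u x = 0"
    by (rule sine_modes_complete[OF a b eigenspace_integrable[OF u(1)]])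
      (use eigenspace_orthogonal_sine_mode[OF u(1)] neg in blast)
  with u(2) show False by simp
qed

text \<open>All eigenfunctions for \<open>\<mu>\<close> are orthogonal to every mode but one.  Given two of
  them, some linear combination with coefficients not both 0 is orthogonal to the remaining mode
  as well, and vanishes by completeness.\<close>

lemma multiplicity_rectangle_le_1:
  assumes uniq: "\<And>m n. m \<ge> 1 \<Longrightarrow> n \<ge> 1 \<Longrightarrow> rect_eigenvalue a b m n = \<mu> \<Longrightarrow> m = m0 \<and> n = n0"
  shows "dirichlet_multiplicity (open_rectangle a b) \<mu> \<le> 1"
  unfolding dirichlet_multiplicity_def
proof (rule Sup_least, clarify)
  fix n and u :: "nat \<Rightarrow> real ^ 2 \<Rightarrow> real"
  assume u: "\<forall>i<n. u i \<in> dirichlet_eigenspace (open_rectangle a b) \<mu>"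
    and ind: "\<forall>c::nat \<Rightarrow> real. (AE x in lebesgue_on (open_rectangle a b). (\<Sum>i<n. c i * u i x) = 0) \<longrightarrow> (\<forall>i<n. c i = 0)"
  define I where "I v = (LINT x|lebesgue_on (open_rectangle a b). v x * sine_mode a b m0 n0 x)" for v
  have smooth: "continuous_on UNIV (sine_mode a b k l)" for k l
    by (rule GDERIV_continuous_on[OF GDERIV_sine_mode])
  have key: "AE x in lebesgue_on (open_rectangle a b). c0 * u 0 x + c1 * u 1 x = 0"
    if n: "n \<ge> 2" and c: "c0 * I (u 0) + c1 * I (u 1) = 0" for c0 c1
  proof (rule sine_modes_complete[OF a b])
    have e: "u 0 \<in> dirichlet_eigenspace (open_rectangle a b) \<mu>" "u 1 \<in> dirichlet_eigenspace (open_rectangle a b) \<mu>"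
      using u n by auto
    note int = eigenspace_integrable[OF e(1)] eigenspace_integrable[OF e(2)]
    show "integrable (lebesgue_on (open_rectangle a b)) (\<lambda>x. c0 * u 0 x + c1 * u 1 x)"
      using int by simp
    fix k l :: nat assume kl: "k \<ge> 1" "l \<ge> 1"
    have "(LINT x|lebesgue_on (open_rectangle a b). (c0 * u 0 x + c1 * u 1 x) * sine_mode a b k l x)
      = c0 * (LINT x|lebesgue_on (open_rectangle a b). u 0 x * sine_mode a b k l x)
        + c1 * (LINT x|lebesgue_on (open_rectangle a b). u 1 x * sine_mode a b k l x)"
      using integrable_mult_continuous[OF interior_rectangle_props(2) int(1) smooth]
        integrable_mult_continuous[OF interior_rectangle_props(2) int(2) smooth]
      by (simp add: distrib_right mult.assoc)
    also have "\<dots> = 0"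
    proof (cases "rect_eigenvalue a b k l = \<mu>")
      case True
      then show ?thesis using uniq[OF kl] c by (simp add: I_def)
    next
      case False
      then show ?thesis
        using eigenspace_orthogonal_sine_mode[OF e(1) kl] eigenspace_orthogonal_sine_mode[OF e(2) kl] by auto
    qed
    finally show "(LINT x|lebesgue_on (open_rectangle a b). (c0 * u 0 x + c1 * u 1 x) * sine_mode a b k l x) = 0" .
  qed
  have indep: "c0 = 0 \<and> c1 = 0" if n: "n \<ge> 2" and c: "c0 * I (u 0) + c1 * I (u 1) = 0" for c0 c1
  proof -
    define c where "c i = (if i = 0 then c0 else if i = 1 then c1 else 0)" for i :: nat
    have "(\<Sum>i<n. c i * u i x) = c0 * u 0 x + c1 * u 1 x" for x
    proof -
      have "(\<Sum>i<n. c i * u i x) = (\<Sum>i\<in>{0,1}. c i * u i x)"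
        using n by (intro sum.mono_neutral_right) (auto simp: c_def)
      then show ?thesis by (simp add: c_def)
    qed
    then have "AE x in lebesgue_on (open_rectangle a b). (\<Sum>i<n. c i * u i x) = 0"
      using key[OF that] by simp
    then have "\<forall>i<n. c i = 0" using ind by blast
    then have "c 0 = 0" "c 1 = 0" using n by auto
    then show ?thesis by (simp add: c_def)
  qed
  have "n < 2"
  proof (rule ccontr)
    assume "\<not> n < 2"
    then have n: "n \<ge> 2" by simp
    \<comment> \<open>The combination \<open>I (u 1) * u 0 - I (u 0) * u 1\<close> is orthogonal to the remaining mode; once both
      integrals are 0, so is \<open>u 0\<close> itself.\<close>
    have "I (u 1) = 0 \<and> - I (u 0) = 0" by (rule indep[OF n]) simp
    then have "(1::real) = 0 \<and> (0::real) = 0" by (intro indep[OF n]) simp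
    then show False by simp
  qed
  then have "n \<le> 1" by simp
  then show "enat n \<le> 1" by (simp add: one_enat_def)
qed

lemma rect_eigenvalue_mono:
  "m \<le> m' \<Longrightarrow> n \<le> n' \<Longrightarrow> rect_eigenvalue a b m n \<le> rect_eigenvalue a b m' n'"
  unfolding rect_eigenvalue_def using a b
  by (intro add_mono power_mono divide_right_mono mult_right_mono) auto

lemma rect_eigenvalue_first_less:
  "rect_eigenvalue a b 1 1 < rect_eigenvalue a b 2 1" "rect_eigenvalue a b 1 1 < rect_eigenvalue a b 1 2"
  unfolding rect_eigenvalue_def using a b by (auto intro!: power_strict_mono divide_strict_right_mono)

text \<open>Raising either index to 2 already reaches the smaller of the two candidates for the second
  eigenvalue.\<close>

lemma rect_eigenvalue_ground:
  assumes "m \<ge> 1" "n \<ge> 1" "rect_eigenvalue a b m n < min (rect_eigenvalue a b 2 1) (rect_eigenvalue a b 1 2)"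
  shows "m = 1 \<and> n = 1"
  using rect_eigenvalue_mono[of 2 m 1 n] rect_eigenvalue_mono[of 1 m 2 n] assms by force

end

text \<open>The two smallest eigenvalues give the upper bound.  Conversely, below the claimed value the
  spectrum consists of the first eigenvalue only, whose multiplicity is too small to count up to
  2.\<close>

theorem lambda2_rectangle:
  assumes a: "a > 0" and b: "b > 0"
  shows "lambda2 (rectangle a b) = ereal (min (rect_eigenvalue a b 2 1) (rect_eigenvalue a b 1 2))"
    (is "_ = ereal ?l")
proof -
  let ?\<Omega> = "interior (rectangle a b)" and ?l1 = "rect_eigenvalue a b 1 1"
  note spec = rect_eigenvalue_in_spectrum[OF a b]
  note less = rect_eigenvalue_first_less[OF a b]
  have "vector [a/2, b/2] \<in> ?\<Omega>" using a b by (simp add: mem_interior_rectangle)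
  then have "lambda2 (rectangle a b) = dirichlet_eigenvalue 2 ?\<Omega>"
    by (auto simp: lambda2_def)
  also have "\<dots> = ereal ?l"
    unfolding dirichlet_eigenvalue_def
  proof (rule antisym[OF Inf_lower Inf_greatest])
    obtain \<mu> where \<mu>: "\<mu> \<in> dirichlet_spectrum ?\<Omega>" "\<mu> = ?l" "?l1 < \<mu>"
      using spec[of 2 1] spec[of 1 2] less by (auto simp: min_def)
    have "enat 2 = 1 + 1" by (simp add: one_enat_def)
    also have "\<dots> \<le> (\<Sum>\<mu>\<in>{?l1, \<mu>}. dirichlet_multiplicity ?\<Omega> \<mu>)"
      using \<mu>(3) add_mono[OF multiplicity_ge_1[OF spec[of 1 1]] multiplicity_ge_1[OF \<mu>(1)]]
      by simp
    finally show "ereal ?l \<in> {ereal t |t. \<exists>F. finite F \<and> F \<subseteq> dirichlet_spectrum ?\<Omega> \<inter> {..t} \<and>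
        enat 2 \<le> (\<Sum>\<mu>\<in>F. dirichlet_multiplicity ?\<Omega> \<mu>)}"
      using \<mu> spec[of 1 1] by (intro CollectI exI[of _ ?l] conjI refl exI[of _ "{?l1, \<mu>}"]) auto
  next
    fix z assume "z \<in> {ereal t |t. \<exists>F. finite F \<and> F \<subseteq> dirichlet_spectrum ?\<Omega> \<inter> {..t} \<and>
        enat 2 \<le> (\<Sum>\<mu>\<in>F. dirichlet_multiplicity ?\<Omega> \<mu>)}"
    then obtain t F where z: "z = ereal t" and F: "finite F" "F \<subseteq> dirichlet_spectrum ?\<Omega> \<inter> {..t}"
      "enat 2 \<le> (\<Sum>\<mu>\<in>F. dirichlet_multiplicity ?\<Omega> \<mu>)" by blast
    have "?l \<le> t"
    proof (rule ccontr)
      assume "\<not> ?l \<le> t"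
      have "\<mu> = ?l1" if "\<mu> \<in> F" for \<mu>
      proof -
        have "\<mu> \<in> dirichlet_spectrum ?\<Omega>" "\<mu> < ?l"
          using that F(2) \<open>\<not> ?l \<le> t\<close> by auto
        then show ?thesis
          using spectrum_rectangle[OF a b] rect_eigenvalue_ground[OF a b] by metis
      qed
      then have "F \<subseteq> {?l1}" by blast
      then have "(\<Sum>\<mu>\<in>F. dirichlet_multiplicity ?\<Omega> \<mu>) \<le> (\<Sum>\<mu>\<in>{?l1}. dirichlet_multiplicity ?\<Omega> \<mu>)"
        by (intro sum_mono2) auto
      also have "\<dots> \<le> 1"
      proof -
        have "dirichlet_multiplicity ?\<Omega> ?l1 \<le> 1"
          by (rule multiplicity_rectangle_le_1[OF a b, of _ 1 1])
            (use rect_eigenvalue_ground[OF a b] less in auto)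
        then show ?thesis by simp
      qed
      finally have "enat 2 \<le> 1" by (rule order_trans[OF F(3)])
      then show False by (simp add: one_enat_def)
    qed
    then show "ereal ?l \<le> z" by (simp only: z ereal_less_eq)
  qed
  finally show ?thesis .
qed


section \<open>Hausdorff measure of finite unions of segments\<close>

text \<open>The infimum inside the definition of \<open>hausdorff1\<close>: the Hausdorff premeasure at
  scale \<open>\<delta>\<close>.\<close>

definition hausdorff1_scale :: "real \<Rightarrow> 'a::metric_space set \<Rightarrow> ennreal" where
  "hausdorff1_scale \<delta> A =
     (INF C\<in>{C :: nat \<Rightarrow> 'a set. A \<subseteq> (\<Union>i. C i) \<and> (\<forall>i. bounded (C i) \<and> diameter (C i) \<le> \<delta>)}.
       (\<Sum>i. ennreal (diameter (C i))))"

lemma hausdorff1_eq: "hausdorff1 A = (SUP \<delta>\<in>{0<..}. hausdorff1_scale \<delta> A)"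
  by (simp add: hausdorff1_def hausdorff1_scale_def)

lemma hausdorff1_mono: "A \<subseteq> B \<Longrightarrow> hausdorff1 A \<le> hausdorff1 B"
  unfolding hausdorff1_def by (intro SUP_mono' INF_superset_mono) auto

lemma hausdorff1_scale_le_finite_cover:
  assumes J: "finite J" and cov: "A \<subseteq> (\<Union>j\<in>J. D j)" and \<delta>: "\<delta> > 0"
    and D: "\<And>j. j \<in> J \<Longrightarrow> bounded (D j) \<and> diameter (D j) \<le> \<delta>"
  shows "hausdorff1_scale \<delta> A \<le> (\<Sum>j\<in>J. ennreal (diameter (D j)))"
proof -
  obtain h where h: "bij_betw h {0..<card J} J" using ex_bij_betw_nat_finite[OF J] by blast
  define C where "C i = (if i < card J then D (h i) else {})" for i
  have hJ: "h i \<in> J" if "i < card J" for i using that h by (auto simp: bij_betw_def)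
  have "A \<subseteq> (\<Union>i. C i)"
  proof
    fix x assume "x \<in> A"
    then obtain j where j: "j \<in> J" "x \<in> D j" using cov by blast
    then have "j \<in> h ` {0..<card J}" using h by (simp add: bij_betw_def)
    then obtain i where "i < card J" "j = h i" by auto
    with j have "x \<in> C i" by (simp add: C_def)
    then show "x \<in> (\<Union>i. C i)" by blast
  qed
  moreover have "bounded (C i) \<and> diameter (C i) \<le> \<delta>" for i
    using D[OF hJ, of i] \<delta> by (auto simp: C_def)
  ultimately have "hausdorff1_scale \<delta> A \<le> (\<Sum>i. ennreal (diameter (C i)))"
    unfolding hausdorff1_scale_def by (intro INF_lower) auto
  also have "\<dots> = (\<Sum>i\<in>{0..<card J}. ennreal (diameter (C i)))"
    by (rule suminf_finite) (auto simp: C_def)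
  also have "\<dots> = (\<Sum>i\<in>{0..<card J}. ennreal (diameter (D (h i))))"
    by (rule sum.cong) (auto simp: C_def)
  also have "\<dots> = (\<Sum>j\<in>J. ennreal (diameter (D j)))"
    by (rule sum.reindex_bij_betw[OF h])
  finally show ?thesis .
qed

text \<open>Each segment is cut into \<open>N\<close> pieces of equal length, with \<open>N\<close> so large
  that the total length divided by \<open>N\<close> is at most \<open>\<delta>\<close>.\<close>

lemma hausdorff1_Union_open_segments_le:
  fixes p q :: "'i \<Rightarrow> 'a::euclidean_space"
  assumes I: "finite I"
  shows "hausdorff1 (\<Union>i\<in>I. open_segment (p i) (q i)) \<le> (\<Sum>i\<in>I. ennreal (dist (p i) (q i)))"
  unfolding hausdorff1_eq
proof (rule SUP_least)
  fix \<delta> :: real assume "\<delta> \<in> {0<..}"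
  then have \<delta>: "\<delta> > 0" by simp
  define L where "L = (\<Sum>i\<in>I. dist (p i) (q i))"
  have L: "dist (p i) (q i) \<le> L" if "i \<in> I" for i
    unfolding L_def using that I by (intro member_le_sum) auto
  have L0: "L \<ge> 0" by (auto simp: L_def intro: sum_nonneg)
  obtain N :: nat where N: "N > 0" "L / \<delta> < real N"
    using reals_Archimedean2[of "L / \<delta>"] L0 \<delta> by (metis divide_nonneg_pos gr0I not_less of_nat_0)
  have N\<delta>: "L / real N \<le> \<delta>" using N \<delta> by (simp add: field_simps)
  define D where "D j = (\<lambda>t. p (fst j) + t *\<^sub>R (q (fst j) - p (fst j))) ` {real (snd j) / real N .. (real (snd j) + 1) / real N}"
    for j :: "'i \<times> nat"
  let ?J = "I \<times> {..<N}"
  have diam: "diameter (D j) \<le> dist (p (fst j)) (q (fst j)) / real N" for j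
  proof (rule diameter_le)
    show "D j \<noteq> {} \<or> 0 \<le> dist (p (fst j)) (q (fst j)) / real N" by simp
    fix x y assume "x \<in> D j" "y \<in> D j"
    then obtain s t where st: "x = p (fst j) + s *\<^sub>R (q (fst j) - p (fst j))" "y = p (fst j) + t *\<^sub>R (q (fst j) - p (fst j))"
      "s \<in> {real (snd j) / real N .. (real (snd j) + 1) / real N}"
      "t \<in> {real (snd j) / real N .. (real (snd j) + 1) / real N}"
      unfolding D_def by blast
    have "(real (snd j) + 1) / real N = real (snd j) / real N + 1 / real N" by (simp add: add_divide_distrib)
    then have st1: "\<bar>s - t\<bar> \<le> 1 / real N" using st(3,4) by auto
    have "x - y = (s - t) *\<^sub>R (q (fst j) - p (fst j))"
      unfolding st(1,2) scaleR_left_diff_distrib by simp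
    then have "norm (x - y) = \<bar>s - t\<bar> * dist (p (fst j)) (q (fst j))"
      by (simp add: dist_norm norm_minus_commute)
    also have "\<dots> \<le> (1 / real N) * dist (p (fst j)) (q (fst j))"
      by (rule mult_right_mono[OF st1]) simp
    finally show "norm (x - y) \<le> dist (p (fst j)) (q (fst j)) / real N" by simp
  qed
  have "hausdorff1_scale \<delta> (\<Union>i\<in>I. open_segment (p i) (q i)) \<le> (\<Sum>j\<in>?J. ennreal (diameter (D j)))"
  proof (rule hausdorff1_scale_le_finite_cover[OF _ _ \<delta>])
    show "finite ?J" using I by simp
    show "(\<Union>i\<in>I. open_segment (p i) (q i)) \<subseteq> (\<Union>j\<in>?J. D j)"
    proof
      fix x assume "x \<in> (\<Union>i\<in>I. open_segment (p i) (q i))"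
      then obtain i t where i: "i \<in> I" and t: "0 < t" "t < 1" "x = (1 - t) *\<^sub>R p i + t *\<^sub>R q i"
        by (auto simp: in_segment)
      define k where "k = nat \<lfloor>t * real N\<rfloor>"
      have k1: "real k \<le> t * real N" and k2: "t * real N < real k + 1"
        using t N unfolding k_def by (auto simp: of_nat_nat)
      have "t * real N < real N" using t N by simp
      then have "real k < real N" using k1 by linarith
      then have kN: "k < N" by simp
      have "t \<in> {real k / real N .. (real k + 1) / real N}"
        using k1 k2 N by (auto simp: field_simps)
      moreover have "x = p i + t *\<^sub>R (q i - p i)" using t by (simp add: algebra_simps)
      ultimately have "x \<in> D (i, k)" by (auto simp: D_def)
      then show "x \<in> (\<Union>j\<in>?J. D j)" using i kN by blast
    qed
    fix j assume j: "j \<in> ?J"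
    have "bounded (D j)"
      unfolding D_def by (intro compact_imp_bounded compact_continuous_image continuous_intros) auto
    moreover have "diameter (D j) \<le> \<delta>"
    proof -
      have "dist (p (fst j)) (q (fst j)) / real N \<le> L / real N"
        using L[of "fst j"] j by (intro divide_right_mono) auto
      then show ?thesis using diam[of j] N\<delta> by linarith
    qed
    ultimately show "bounded (D j) \<and> diameter (D j) \<le> \<delta>" ..
  qed
  also have "\<dots> \<le> (\<Sum>j\<in>?J. ennreal (dist (p (fst j)) (q (fst j)) / real N))"
    using diam by (intro sum_mono ennreal_leI)
  also have "\<dots> = (\<Sum>i\<in>I. \<Sum>k<N. ennreal (dist (p i) (q i) / real N))"
    unfolding sum.cartesian_product by (simp only: case_prod_unfold)
  also have "\<dots> = (\<Sum>i\<in>I. ennreal (dist (p i) (q i)))"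
  proof (rule sum.cong[OF refl])
    fix i
    have "(\<Sum>k<N. ennreal (dist (p i) (q i) / real N)) = ennreal (\<Sum>k<N. dist (p i) (q i) / real N)"
      by (rule sum_ennreal) simp
    also have "(\<Sum>k<N. dist (p i) (q i) / real N) = dist (p i) (q i)" using N by simp
    finally show "(\<Sum>k<N. ennreal (dist (p i) (q i) / real N)) = ennreal (dist (p i) (q i))" .
  qed
  finally show "hausdorff1_scale \<delta> (\<Union>i\<in>I. open_segment (p i) (q i)) \<le> (\<Sum>i\<in>I. ennreal (dist (p i) (q i)))" .
qed

text \<open>The orthogonal projection to the line through \<open>p\<close> and \<open>q\<close> does not
  increase distances, so it sends each \<open>C i\<close> into an interval of length at most its
  diameter; these intervals cover one of length \<open>dist p q\<close>, and Lebesgue measure is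
  countably subadditive.\<close>

lemma dist_le_cover_closed_segment:
  fixes p q :: "'a::euclidean_space"
  assumes cov: "closed_segment p q \<subseteq> (\<Union>i. C i)" and C: "\<And>i::nat. bounded (C i)"
  shows "ennreal (dist p q) \<le> (\<Sum>i. ennreal (diameter (C i)))"
proof (cases "p = q")
  case True
  then show ?thesis by simp
next
  case False
  define L where "L = dist p q"
  have L: "L > 0" using False by (simp add: L_def)
  define v where "v = (1 / L) *\<^sub>R (q - p)"
  define f where "f x = (x - p) \<bullet> v" for x
  have nrm: "norm v = 1" using L by (simp add: v_def L_def dist_norm norm_minus_commute)
  have flip: "\<bar>f x - f y\<bar> \<le> dist x y" for x y
  proof -
    have "f x - f y = (x - y) \<bullet> v"
      unfolding f_def by (simp only: inner_diff_left[symmetric]) simp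
    then show ?thesis
      using Cauchy_Schwarz_ineq2[of "x - y" v] nrm by (simp add: dist_norm)
  qed
  define J where "J i = (if C i = {} then {} else {Inf (f ` C i) .. Sup (f ` C i)})" for i
  have fb: "bounded (f ` C i)" for i
  proof -
    obtain x0 e where "\<And>y. y \<in> C i \<Longrightarrow> dist x0 y \<le> e" using C[of i] by (auto simp: bounded_def)
    then have "dist (f x0) (f y) \<le> e" if "y \<in> C i" for y
      using flip[of x0 y] that by (force simp: dist_real_def)
    then show ?thesis by (auto simp: bounded_def)
  qed
  have fJ: "f ` C i \<subseteq> J i" for i
    using bounded_imp_bdd_above[OF fb[of i]] bounded_imp_bdd_below[OF fb[of i]]
    by (auto simp: J_def intro!: cINF_lower cSUP_upper)
  have lenJ: "emeasure lborel (J i) \<le> ennreal (diameter (C i))" for i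
  proof (cases "C i = {}")
    case True
    then show ?thesis by (simp add: J_def)
  next
    case False
    have "Sup (f ` C i) - diameter (C i) \<le> Inf (f ` C i)"
    proof (rule cINF_greatest[OF False])
      fix y assume y: "y \<in> C i"
      have "Sup (f ` C i) \<le> f y + diameter (C i)"
      proof (rule cSUP_least[OF False])
        fix x assume x: "x \<in> C i"
        show "f x \<le> f y + diameter (C i)"
          using flip[of x y] diameter_bounded_bound[OF C x y] by linarith
      qed
      then show "Sup (f ` C i) - diameter (C i) \<le> f y" by linarith
    qed
    moreover have "Inf (f ` C i) \<le> Sup (f ` C i)"
      using False bounded_imp_bdd_above[OF fb] bounded_imp_bdd_below[OF fb] by (intro cInf_le_cSup) auto
    ultimately show ?thesis using False by (auto simp: J_def intro!: ennreal_leI)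
  qed
  have "{0..L} \<subseteq> (\<Union>i. J i)"
  proof
    fix s assume s: "s \<in> {0..L}"
    let ?x = "p + (s / L) *\<^sub>R (q - p)"
    have "?x \<in> closed_segment p q"
      using s L by (auto simp: in_segment algebra_simps intro!: exI[of _ "s / L"])
    then obtain i where "?x \<in> C i" using cov by blast
    moreover have "f ?x = s"
    proof -
      have "L = norm (q - p)" by (simp add: L_def dist_norm norm_minus_commute)
      then have "(q - p) \<bullet> (q - p) = L\<^sup>2" by (simp add: power2_norm_eq_inner)
      then show ?thesis using L by (simp add: f_def v_def power2_eq_square)
    qed
    ultimately show "s \<in> (\<Union>i. J i)" using fJ by force
  qed
  then have "emeasure lborel {0..L} \<le> emeasure lborel (\<Union>i. J i)"
    by (intro emeasure_mono) (auto simp: J_def)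
  also have "\<dots> \<le> (\<Sum>i. emeasure lborel (J i))"
    by (intro emeasure_subadditive_countably) (auto simp: J_def)
  also have "\<dots> \<le> (\<Sum>i. ennreal (diameter (C i)))"
    by (intro suminf_le lenJ) auto
  finally show ?thesis using L by (simp add: L_def)
qed

lemma compact_family_separated:
  fixes K :: "'i \<Rightarrow> 'a::euclidean_space set"
  assumes I: "finite I" and K: "\<And>i. i \<in> I \<Longrightarrow> compact (K i)"
    and disj: "\<And>i j. i \<in> I \<Longrightarrow> j \<in> I \<Longrightarrow> i \<noteq> j \<Longrightarrow> K i \<inter> K j = {}"
  shows "\<exists>d>0. \<forall>i\<in>I. \<forall>j\<in>I. i \<noteq> j \<longrightarrow> (\<forall>x\<in>K i. \<forall>y\<in>K j. d \<le> dist x y)"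
proof -
  let ?P = "{(i, j) \<in> I \<times> I. i \<noteq> j}"
  have "\<forall>z\<in>?P. \<exists>d>0. \<forall>x\<in>K (fst z). \<forall>y\<in>K (snd z). d \<le> dist x y"
  proof
    fix z assume "z \<in> ?P"
    then have "compact (K (fst z))" "closed (K (snd z))" "K (fst z) \<inter> K (snd z) = {}"
      using K disj[of "fst z" "snd z"] by (auto intro: compact_imp_closed)
    then show "\<exists>d>0. \<forall>x\<in>K (fst z). \<forall>y\<in>K (snd z). d \<le> dist x y"
      by (rule separate_compact_closed)
  qed
  from bchoice[OF this] obtain e
    where e: "\<forall>z\<in>?P. e z > 0 \<and> (\<forall>x\<in>K (fst z). \<forall>y\<in>K (snd z). e z \<le> dist x y)" ..
  \<comment> \<open>The 1 keeps the minimum meaningful if there are no pairs.\<close>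
  define d where "d = Min (insert 1 (e ` ?P))"
  have fin: "finite ?P" using I by (auto intro: finite_subset[of _ "I \<times> I"])
  have epos: "e z > 0" if "z \<in> ?P" for z
    using bspec[OF e that] by (rule conjunct1)
  have "d > 0" unfolding d_def using fin epos by (subst Min_gr_iff) (auto simp del: mem_Collect_eq)
  moreover have "d \<le> dist x y" if ij: "i \<in> I" "j \<in> I" "i \<noteq> j" and xy: "x \<in> K i" "y \<in> K j" for i j x y
  proof -
    have z: "(i, j) \<in> ?P" using ij by simp
    have "d \<le> e (i, j)" unfolding d_def using fin z by (intro Min_le) auto
    also have "\<dots> \<le> dist x y" using bspec[OF e z] xy by simp
    finally show ?thesis .
  qed
  ultimately show ?thesis by blast
qed

text \<open>Disjoint compact segments have a positive distance \<open>d\<close> from each other.  A set of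
  diameter at most \<open>d/2\<close> meets at most one of them, so a cover at this scale splits
  into separate covers of the individual segments.\<close>

lemma sum_dist_le_hausdorff1_closed_segments:
  fixes p q :: "'i \<Rightarrow> 'a::euclidean_space"
  assumes I: "finite I"
    and disj: "\<And>i j. i \<in> I \<Longrightarrow> j \<in> I \<Longrightarrow> i \<noteq> j \<Longrightarrow> closed_segment (p i) (q i) \<inter> closed_segment (p j) (q j) = {}"
  shows "(\<Sum>i\<in>I. ennreal (dist (p i) (q i))) \<le> hausdorff1 (\<Union>i\<in>I. closed_segment (p i) (q i))"
proof -
  let ?K = "\<lambda>i. closed_segment (p i) (q i)"
  obtain d where d: "d > 0" and sep: "\<And>i j x y. i \<in> I \<Longrightarrow> j \<in> I \<Longrightarrow> i \<noteq> j \<Longrightarrow> x \<in> ?K i \<Longrightarrow> y \<in> ?K j \<Longrightarrow> d \<le> dist x y"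
    using compact_family_separated[OF I, of ?K] disj by force
  have "(\<Sum>i\<in>I. ennreal (dist (p i) (q i))) \<le> hausdorff1_scale (d / 2) (\<Union>i\<in>I. ?K i)"
    unfolding hausdorff1_scale_def
  proof (rule INF_greatest, clarify)
    fix C :: "nat \<Rightarrow> 'a set"
    assume cov: "(\<Union>i\<in>I. ?K i) \<subseteq> (\<Union>n. C n)" and C: "\<forall>n. bounded (C n) \<and> diameter (C n) \<le> d / 2"
    define E where "E i n = (if C n \<inter> ?K i = {} then {} else C n)" for i n
    have "(\<Sum>i\<in>I. ennreal (dist (p i) (q i))) \<le> (\<Sum>i\<in>I. \<Sum>n. ennreal (diameter (E i n)))"
    proof (rule sum_mono, rule dist_le_cover_closed_segment)
      fix i assume i: "i \<in> I"
      show "?K i \<subseteq> (\<Union>n. E i n)"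
      proof
        fix x assume x: "x \<in> ?K i"
        then obtain n where "x \<in> C n" using i cov by blast
        then have "x \<in> E i n" using x by (auto simp: E_def)
        then show "x \<in> (\<Union>n. E i n)" by blast
      qed
      show "bounded (E i n)" for n using C by (simp add: E_def)
    qed
    also have "\<dots> = (\<Sum>n. \<Sum>i\<in>I. ennreal (diameter (E i n)))"
      by (rule suminf_sum[symmetric]) simp
    also have "\<dots> \<le> (\<Sum>n. ennreal (diameter (C n)))"
    proof (rule suminf_le)
      fix n
      show "(\<Sum>i\<in>I. ennreal (diameter (E i n))) \<le> ennreal (diameter (C n))"
      proof (cases "\<exists>i\<in>I. C n \<inter> ?K i \<noteq> {}")
        case False
        then have "(\<Sum>i\<in>I. ennreal (diameter (E i n))) = 0" by (intro sum.neutral) (auto simp: E_def)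
        then show ?thesis by simp
      next
        case True
        then obtain i x where i: "i \<in> I" "x \<in> C n" "x \<in> ?K i" by blast
        have "E j n = {}" if j: "j \<in> I" "j \<noteq> i" for j
        proof (rule ccontr)
          assume "E j n \<noteq> {}"
          then obtain y where y: "y \<in> C n" "y \<in> ?K j" by (auto simp: E_def split: if_splits)
          have "d \<le> dist x y" using sep[OF i(1) j(1) _ i(3) y(2)] j(2) by auto
          moreover have "dist x y \<le> diameter (C n)"
            using C by (intro diameter_bounded_bound i y) auto
          moreover have "diameter (C n) \<le> d / 2" using C by blast
          ultimately show False using d by linarith
        qed
        then have "(\<Sum>j\<in>I. ennreal (diameter (E j n))) = (\<Sum>j\<in>{i}. ennreal (diameter (E j n)))"
          using I i(1) by (intro sum.mono_neutral_right) auto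
        also have "\<dots> \<le> ennreal (diameter (C n))" by (simp add: E_def)
        finally show ?thesis .
      qed
    qed auto
    finally show "(\<Sum>i\<in>I. ennreal (dist (p i) (q i))) \<le> (\<Sum>n. ennreal (diameter (C n)))" .
  qed
  also have "\<dots> \<le> hausdorff1 (\<Union>i\<in>I. ?K i)"
    unfolding hausdorff1_eq using d by (intro SUP_upper) auto
  finally show ?thesis .
qed

text \<open>Disjoint open segments may touch at their ends, as the sides of a polygon do.  The lower bound
  is therefore obtained on the compact subsegments that omit a fraction \<open>s\<close> at both
  ends, whose total length exhausts the whole as \<open>s\<close> tends to 0.\<close>

theorem hausdorff1_Union_open_segments:
  fixes p q :: "'i \<Rightarrow> 'a::euclidean_space"
  assumes I: "finite I" and pq: "\<And>i. i \<in> I \<Longrightarrow> p i \<noteq> q i"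
    and disj: "\<And>i j. i \<in> I \<Longrightarrow> j \<in> I \<Longrightarrow> i \<noteq> j \<Longrightarrow> open_segment (p i) (q i) \<inter> open_segment (p j) (q j) = {}"
  shows "hausdorff1 (\<Union>i\<in>I. open_segment (p i) (q i)) = (\<Sum>i\<in>I. ennreal (dist (p i) (q i)))"
proof (rule antisym[OF hausdorff1_Union_open_segments_le[OF I]])
  let ?H = "hausdorff1 (\<Union>i\<in>I. open_segment (p i) (q i))"
  define S where "S = (\<Sum>i\<in>I. dist (p i) (q i))"
  have S: "S \<ge> 0" by (auto simp: S_def intro: sum_nonneg)
  have shrink: "ennreal ((1 - 2 * s) * S) \<le> ?H" if s: "0 < s" "s < 1/2" for s
  proof -
    define p' where "p' i = p i + s *\<^sub>R (q i - p i)" for i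
    define q' where "q' i = p i + (1 - s) *\<^sub>R (q i - p i)" for i
    have sub: "closed_segment (p' i) (q' i) \<subseteq> open_segment (p i) (q i)" if "i \<in> I" for i
    proof (rule closed_segment_subset)
      show "convex (open_segment (p i) (q i))" by (rule convex_open_segment)
      have "p' i = (1 - s) *\<^sub>R p i + s *\<^sub>R q i" by (simp add: p'_def algebra_simps)
      then show "p' i \<in> open_segment (p i) (q i)"
        unfolding in_segment using pq[OF that] s by (intro conjI exI[of _ s]) auto
      have "q' i = (1 - (1 - s)) *\<^sub>R p i + (1 - s) *\<^sub>R q i" by (simp add: q'_def algebra_simps)
      then show "q' i \<in> open_segment (p i) (q i)"
        unfolding in_segment using pq[OF that] s by (intro conjI exI[of _ "1 - s"]) auto
    qed
    have "dist (p' i) (q' i) = (1 - 2 * s) * dist (p i) (q i)" for i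
    proof -
      have "p' i - q' i = (s - (1 - s)) *\<^sub>R (q i - p i)"
        unfolding p'_def q'_def scaleR_left_diff_distrib by simp
      then have "dist (p' i) (q' i) = \<bar>s - (1 - s)\<bar> * dist (p i) (q i)"
        by (simp only: dist_norm norm_scaleR norm_minus_commute)
      also have "\<bar>s - (1 - s)\<bar> = 1 - 2 * s" using s by simp
      finally show ?thesis .
    qed
    then have "(\<Sum>i\<in>I. ennreal (dist (p' i) (q' i))) = ennreal ((1 - 2 * s) * S)"
      using s by (simp add: S_def sum_distrib_left sum_ennreal)
    moreover have "(\<Sum>i\<in>I. ennreal (dist (p' i) (q' i))) \<le> hausdorff1 (\<Union>i\<in>I. closed_segment (p' i) (q' i))"
    proof (rule sum_dist_le_hausdorff1_closed_segments[OF I])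
      fix i j assume ij: "i \<in> I" "j \<in> I" "i \<noteq> j"
      show "closed_segment (p' i) (q' i) \<inter> closed_segment (p' j) (q' j) = {}"
        using sub[OF ij(1)] sub[OF ij(2)] disj[OF ij] by blast
    qed
    moreover have "\<dots> \<le> ?H" using sub by (intro hausdorff1_mono) blast
    ultimately show ?thesis by order
  qed
  have "ennreal S \<le> ?H"
  proof (rule ennreal_le_epsilon)
    fix e :: real assume e: "0 < e"
    \<comment> \<open>Small enough that the omitted length \<open>2 * s * S\<close> is at most \<open>e\<close>.\<close>
    define s where "s = min (1/4) (e / (2 * (S + 1)))"
    have s: "0 < s" "s < 1/2" using e S by (auto simp: s_def)
    have "2 * s * S \<le> e"
    proof -
      have "s \<le> e / (2 * (S + 1))" by (simp add: s_def)
      then have "2 * s * (S + 1) \<le> e" using S by (simp add: field_simps)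
      then show ?thesis using s by (simp add: distrib_left)
    qed
    have "(1 - 2 * s) * S \<ge> 0" "2 * s * S \<ge> 0"
      using s S by (intro mult_nonneg_nonneg; simp)+
    moreover have "S = (1 - 2 * s) * S + 2 * s * S" by (simp add: algebra_simps)
    ultimately have "ennreal S = ennreal ((1 - 2 * s) * S) + ennreal (2 * s * S)"
      using ennreal_plus by metis
    also have "\<dots> \<le> ?H + ennreal e"
      using shrink[OF s] \<open>2 * s * S \<le> e\<close> by (intro add_mono ennreal_leI)
    finally show "ennreal S \<le> ?H + ennreal e" .
  qed
  then show "(\<Sum>i\<in>I. ennreal (dist (p i) (q i))) \<le> ?H"
    by (simp add: S_def sum_ennreal)
qed


section \<open>Blaschke and Minkowski sums of rectangles\<close>

lemma mem_open_segment_coords: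
  "x \<in> open_segment (vector [c, 0]) (vector [c, b]) \<longleftrightarrow> x $ 1 = c \<and> 0 < x $ 2 \<and> x $ 2 < b"
  "x \<in> open_segment (vector [0, c]) (vector [a, c]) \<longleftrightarrow> 0 < x $ 1 \<and> x $ 1 < a \<and> x $ 2 = c"
  if "a > 0" "b > 0" for x :: "real ^ 2"
proof -
  have sv: "(vector [s, t] :: real ^ 2) = vector [s', t'] \<longleftrightarrow> s = s' \<and> t = t'" for s t s' t' :: real
    by (auto simp: vec_eq_iff forall_2)
  show "x \<in> open_segment (vector [c, 0]) (vector [c, b]) \<longleftrightarrow> x $ 1 = c \<and> 0 < x $ 2 \<and> x $ 2 < b"
  proof
    assume "x \<in> open_segment (vector [c, 0]) (vector [c, b])"
    then obtain u where "0 < u" "u < 1" "x = (1 - u) *\<^sub>R vector [c, 0] + u *\<^sub>R vector [c, b]"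
      by (auto simp: in_segment)
    then have "x $ 1 = (1 - u) * c + u * c" "x $ 2 = u * b" by simp_all
    then show "x $ 1 = c \<and> 0 < x $ 2 \<and> x $ 2 < b"
      using that \<open>0 < u\<close> \<open>u < 1\<close> by (simp add: algebra_simps)
  next
    assume x: "x $ 1 = c \<and> 0 < x $ 2 \<and> x $ 2 < b"
    then show "x \<in> open_segment (vector [c, 0]) (vector [c, b])"
      unfolding in_segment sv using that
      by (intro conjI exI[of _ "x $ 2 / b"]) (auto simp: vec_eq_iff forall_2 algebra_simps)
  qed
  show "x \<in> open_segment (vector [0, c]) (vector [a, c]) \<longleftrightarrow> 0 < x $ 1 \<and> x $ 1 < a \<and> x $ 2 = c"
  proof
    assume "x \<in> open_segment (vector [0, c]) (vector [a, c])"
    then obtain u where "0 < u" "u < 1" "x = (1 - u) *\<^sub>R vector [0, c] + u *\<^sub>R vector [a, c]"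
      by (auto simp: in_segment)
    then have "x $ 1 = u * a" "x $ 2 = (1 - u) * c + u * c" by simp_all
    then show "0 < x $ 1 \<and> x $ 1 < a \<and> x $ 2 = c"
      using that \<open>0 < u\<close> \<open>u < 1\<close> by (simp add: algebra_simps)
  next
    assume x: "0 < x $ 1 \<and> x $ 1 < a \<and> x $ 2 = c"
    then show "x \<in> open_segment (vector [0, c]) (vector [a, c])"
      unfolding in_segment sv using that
      by (intro conjI exI[of _ "x $ 1 / a"]) (auto simp: vec_eq_iff forall_2 algebra_simps)
  qed
qed

definition axis_normals :: "(real ^ 2) set" where
  "axis_normals = {axis 1 1, - axis 1 1, axis 2 1, - axis 2 1}"

text \<open>The side of the rectangle with outer normal \<open>\<nu>\<close> runs from
  \<open>edge_start\<close> to \<open>edge_end\<close>.  In each definition the last branch serves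
  the two normals not listed before it: the sides with outer normals \<open>- axis 1 1\<close> and
  \<open>- axis 2 1\<close> start at the origin, those with the opposite normals end at the
  opposite corner.\<close>

definition edge_start :: "real \<Rightarrow> real \<Rightarrow> real ^ 2 \<Rightarrow> real ^ 2" where
  "edge_start a b \<nu> = (if \<nu> = axis 1 1 then vector [a, 0] else if \<nu> = axis 2 1 then vector [0, b] else vector [0, 0])"

definition edge_end :: "real \<Rightarrow> real \<Rightarrow> real ^ 2 \<Rightarrow> real ^ 2" where
  "edge_end a b \<nu> = (if \<nu> = - axis 1 1 then vector [0, b] else if \<nu> = - axis 2 1 then vector [a, 0] else vector [a, b])"

lemma axis_normals_distinct:
  "axis 1 1 \<noteq> (axis 2 1 :: real ^ 2)" "axis 1 1 \<noteq> (- axis 2 1 :: real ^ 2)"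
  "axis 2 1 \<noteq> (axis 1 1 :: real ^ 2)" "axis 2 1 \<noteq> (- axis 1 1 :: real ^ 2)"
  "- axis 1 1 \<noteq> (axis 2 1 :: real ^ 2)" "- axis 2 1 \<noteq> (axis 1 1 :: real ^ 2)"
  "- axis 1 1 \<noteq> (- axis 2 1 :: real ^ 2)" "- axis 2 1 \<noteq> (- axis 1 1 :: real ^ 2)"
  "axis 1 1 \<noteq> (- axis 1 1 :: real ^ 2)" "- axis 1 1 \<noteq> (axis 1 1 :: real ^ 2)"
  "axis 2 1 \<noteq> (- axis 2 1 :: real ^ 2)" "- axis 2 1 \<noteq> (axis 2 1 :: real ^ 2)"
  by (auto simp: vec_eq_iff forall_2 axis_def)

lemma mem_edge:
  assumes "a > 0" "b > 0"
  shows "x \<in> open_segment (edge_start a b (axis 1 1)) (edge_end a b (axis 1 1)) \<longleftrightarrow> x $ 1 = a \<and> 0 < x $ 2 \<and> x $ 2 < b"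
    "x \<in> open_segment (edge_start a b (- axis 1 1)) (edge_end a b (- axis 1 1)) \<longleftrightarrow> x $ 1 = 0 \<and> 0 < x $ 2 \<and> x $ 2 < b"
    "x \<in> open_segment (edge_start a b (axis 2 1)) (edge_end a b (axis 2 1)) \<longleftrightarrow> 0 < x $ 1 \<and> x $ 1 < a \<and> x $ 2 = b"
    "x \<in> open_segment (edge_start a b (- axis 2 1)) (edge_end a b (- axis 2 1)) \<longleftrightarrow> 0 < x $ 1 \<and> x $ 1 < a \<and> x $ 2 = 0"
  by (simp_all only: edge_start_def edge_end_def axis_normals_distinct if_True if_False refl
      mem_open_segment_coords[OF assms])

lemma axis_coords:
  "axis 1 1 $ 1 = (1::real)" "axis 1 1 $ (2::2) = (0::real)" "axis 2 1 $ 2 = (1::real)" "axis 2 1 $ (1::2) = (0::real)"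
  by (auto simp: axis_def)

lemma norm_eq_1_coords: "norm (\<nu> :: real ^ 2) = 1 \<longleftrightarrow> (\<nu> $ 1)\<^sup>2 + (\<nu> $ 2)\<^sup>2 = 1"
  by (simp add: norm_eq_1 inner_vec_def sum_2 power2_eq_square)

text \<open>Comparing \<open>x\<close> with points of the rectangle that differ from it in one coordinate
  only decouples the two coordinates.\<close>

lemma outer_unit_normals_rectangle:
  assumes x: "x \<in> rectangle a b"
  shows "\<nu> \<in> outer_unit_normals (rectangle a b) x \<longleftrightarrow> norm \<nu> = 1 \<and>
    (\<nu> $ 1 > 0 \<longrightarrow> x $ 1 = a) \<and> (\<nu> $ 1 < 0 \<longrightarrow> x $ 1 = 0) \<and>
    (\<nu> $ 2 > 0 \<longrightarrow> x $ 2 = b) \<and> (\<nu> $ 2 < 0 \<longrightarrow> x $ 2 = 0)" (is "?L \<longleftrightarrow> ?R")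
proof
  assume ?L
  then have nrm: "norm \<nu> = 1" and le: "\<And>y. y \<in> rectangle a b \<Longrightarrow> \<nu> $ 1 * (y $ 1 - x $ 1) + \<nu> $ 2 * (y $ 2 - x $ 2) \<le> 0"
    by (auto simp: outer_unit_normals_def inner_vec_def sum_2)
  have "\<nu> $ 1 * (s - x $ 1) \<le> 0" if "0 \<le> s" "s \<le> a" for s
    using le[of "vector [s, x $ 2]"] that x by (simp add: mem_rectangle)
  from this[of 0] this[of a] have 1: "\<nu> $ 1 * (0 - x $ 1) \<le> 0" "\<nu> $ 1 * (a - x $ 1) \<le> 0"
    using x by (auto simp: mem_rectangle)
  have "\<nu> $ 2 * (s - x $ 2) \<le> 0" if "0 \<le> s" "s \<le> b" for s
    using le[of "vector [x $ 1, s]"] that x by (simp add: mem_rectangle)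
  from this[of 0] this[of b] have 2: "\<nu> $ 2 * (0 - x $ 2) \<le> 0" "\<nu> $ 2 * (b - x $ 2) \<le> 0"
    using x by (auto simp: mem_rectangle)
  show ?R using nrm 1 2 x by (auto simp: mem_rectangle mult_le_0_iff zero_le_mult_iff)
next
  assume R: ?R
  have "\<nu> \<bullet> (y - x) \<le> 0" if "y \<in> rectangle a b" for y
  proof -
    have "\<nu> $ 1 * (y $ 1 - x $ 1) \<le> 0"
      using R that x by (cases "\<nu> $ 1" "0::real" rule: linorder_cases) (auto simp: mem_rectangle mult_le_0_iff)
    moreover have "\<nu> $ 2 * (y $ 2 - x $ 2) \<le> 0"
      using R that x by (cases "\<nu> $ 2" "0::real" rule: linorder_cases) (auto simp: mem_rectangle mult_le_0_iff)
    ultimately show ?thesis by (simp add: inner_vec_def sum_2)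
  qed
  with R show ?L by (auto simp: outer_unit_normals_def)
qed

lemma frontier_rectangle:
  "x \<in> frontier (rectangle a b) \<longleftrightarrow> x \<in> rectangle a b \<and> x \<notin> interior (rectangle a b)"
  by (simp add: frontier_def rectangle_def)

lemma outer_unit_normals_edge:
  assumes ab: "a > 0" "b > 0"
    and \<nu>: "\<nu> \<in> axis_normals" "x \<in> open_segment (edge_start a b \<nu>) (edge_end a b \<nu>)"
  shows "x \<in> frontier (rectangle a b) \<and> outer_unit_normals (rectangle a b) x = {\<nu>}"
  using \<nu>(1) unfolding axis_normals_def
proof (elim insertE emptyE)
  assume e: "\<nu> = axis 1 1"
  then have x: "x $ 1 = a" "0 < x $ 2" "x $ 2 < b" using \<nu>(2) mem_edge(1)[OF ab] by auto
  then have x': "x \<in> rectangle a b" using ab by (simp add: mem_rectangle)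
  have "\<nu>' = axis 1 1" if "\<nu>' \<in> outer_unit_normals (rectangle a b) x" for \<nu>'
  proof -
    have "\<nu>' $ 2 = 0" "0 \<le> \<nu>' $ 1" "(\<nu>' $ 1)\<^sup>2 + (\<nu>' $ 2)\<^sup>2 = 1"
      using that x ab unfolding outer_unit_normals_rectangle[OF x'] norm_eq_1_coords by (auto simp: not_less[symmetric] linorder_neq_iff)
    then have "\<nu>' $ 1 = 1" by (auto simp: power2_eq_1_iff)
    with \<open>\<nu>' $ 2 = 0\<close> show ?thesis by (simp add: vec_eq_iff forall_2 axis_coords)
  qed
  moreover have "axis 1 1 \<in> outer_unit_normals (rectangle a b) x"
    using x unfolding outer_unit_normals_rectangle[OF x'] by (simp add: axis_coords)
  ultimately have "outer_unit_normals (rectangle a b) x = {axis 1 1}"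
    by blast
  moreover have "x \<notin> interior (rectangle a b)" using x by (simp add: mem_interior_rectangle)
  ultimately show ?thesis using x' unfolding e frontier_rectangle by simp
next
  assume e: "\<nu> = - axis 1 1"
  then have x: "x $ 1 = 0" "0 < x $ 2" "x $ 2 < b" using \<nu>(2) mem_edge(2)[OF ab] by auto
  then have x': "x \<in> rectangle a b" using ab by (simp add: mem_rectangle)
  have "\<nu>' = - axis 1 1" if "\<nu>' \<in> outer_unit_normals (rectangle a b) x" for \<nu>'
  proof -
    have "\<nu>' $ 2 = 0" "\<nu>' $ 1 \<le> 0" "(\<nu>' $ 1)\<^sup>2 + (\<nu>' $ 2)\<^sup>2 = 1"
      using that x ab unfolding outer_unit_normals_rectangle[OF x'] norm_eq_1_coords by (auto simp: not_less[symmetric] linorder_neq_iff)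
    then have "\<nu>' $ 1 = - 1" by (auto simp: power2_eq_1_iff)
    with \<open>\<nu>' $ 2 = 0\<close> show ?thesis by (simp add: vec_eq_iff forall_2 axis_coords)
  qed
  moreover have "- axis 1 1 \<in> outer_unit_normals (rectangle a b) x"
    using x unfolding outer_unit_normals_rectangle[OF x'] by (simp add: axis_coords)
  ultimately have "outer_unit_normals (rectangle a b) x = {- axis 1 1}"
    by blast
  moreover have "x \<notin> interior (rectangle a b)" using x by (simp add: mem_interior_rectangle)
  ultimately show ?thesis using x' unfolding e frontier_rectangle by simp
next
  assume e: "\<nu> = axis 2 1"
  then have x: "0 < x $ 1" "x $ 1 < a" "x $ 2 = b" using \<nu>(2) mem_edge(3)[OF ab] by auto
  then have x': "x \<in> rectangle a b" using ab by (simp add: mem_rectangle)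
  have "\<nu>' = axis 2 1" if "\<nu>' \<in> outer_unit_normals (rectangle a b) x" for \<nu>'
  proof -
    have "\<nu>' $ 1 = 0" "0 \<le> \<nu>' $ 2" "(\<nu>' $ 1)\<^sup>2 + (\<nu>' $ 2)\<^sup>2 = 1"
      using that x ab unfolding outer_unit_normals_rectangle[OF x'] norm_eq_1_coords by (auto simp: not_less[symmetric] linorder_neq_iff)
    then have "\<nu>' $ 2 = 1" by (auto simp: power2_eq_1_iff)
    with \<open>\<nu>' $ 1 = 0\<close> show ?thesis by (simp add: vec_eq_iff forall_2 axis_coords)
  qed
  moreover have "axis 2 1 \<in> outer_unit_normals (rectangle a b) x"
    using x unfolding outer_unit_normals_rectangle[OF x'] by (simp add: axis_coords)
  ultimately have "outer_unit_normals (rectangle a b) x = {axis 2 1}"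
    by blast
  moreover have "x \<notin> interior (rectangle a b)" using x by (simp add: mem_interior_rectangle)
  ultimately show ?thesis using x' unfolding e frontier_rectangle by simp
next
  assume e: "\<nu> = - axis 2 1"
  then have x: "0 < x $ 1" "x $ 1 < a" "x $ 2 = 0" using \<nu>(2) mem_edge(4)[OF ab] by auto
  then have x': "x \<in> rectangle a b" using ab by (simp add: mem_rectangle)
  have "\<nu>' = - axis 2 1" if "\<nu>' \<in> outer_unit_normals (rectangle a b) x" for \<nu>'
  proof -
    have "\<nu>' $ 1 = 0" "\<nu>' $ 2 \<le> 0" "(\<nu>' $ 1)\<^sup>2 + (\<nu>' $ 2)\<^sup>2 = 1"
      using that x ab unfolding outer_unit_normals_rectangle[OF x'] norm_eq_1_coords by (auto simp: not_less[symmetric] linorder_neq_iff)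
    then have "\<nu>' $ 2 = - 1" by (auto simp: power2_eq_1_iff)
    with \<open>\<nu>' $ 1 = 0\<close> show ?thesis by (simp add: vec_eq_iff forall_2 axis_coords)
  qed
  moreover have "- axis 2 1 \<in> outer_unit_normals (rectangle a b) x"
    using x unfolding outer_unit_normals_rectangle[OF x'] by (simp add: axis_coords)
  ultimately have "outer_unit_normals (rectangle a b) x = {- axis 2 1}"
    by blast
  moreover have "x \<notin> interior (rectangle a b)" using x by (simp add: mem_interior_rectangle)
  ultimately show ?thesis using x' unfolding e frontier_rectangle by simp
qed

text \<open>The boundary points with a single outer normal are those in the relative interiors of the sides;
  at a corner two coordinate directions are normal.\<close>

lemma gauss_preimage_rectangle:
  assumes ab: "a > 0" "b > 0"
  shows "gauss_preimage (rectangle a b) \<omega> =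
    (\<Union>\<nu>\<in>\<omega> \<inter> axis_normals. open_segment (edge_start a b \<nu>) (edge_end a b \<nu>))" (is "_ = ?U")
proof (intro equalityI subsetI)
  note normals = outer_unit_normals_rectangle[of _ a b]
  fix x
  {
    assume "x \<in> gauss_preimage (rectangle a b) \<omega>"
    then obtain \<nu> where x: "x \<in> rectangle a b" "x \<notin> interior (rectangle a b)"
      and \<nu>: "\<nu> \<in> \<omega>" "outer_unit_normals (rectangle a b) x = {\<nu>}"
      unfolding gauss_preimage_def frontier_rectangle by blast
    have N: "(x $ 1 = a \<longrightarrow> \<nu> = axis 1 1) \<and> (x $ 1 = 0 \<longrightarrow> \<nu> = - axis 1 1) \<and>
        (x $ 2 = b \<longrightarrow> \<nu> = axis 2 1) \<and> (x $ 2 = 0 \<longrightarrow> \<nu> = - axis 2 1)"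
    proof -
      have "axis 1 1 \<in> outer_unit_normals (rectangle a b) x" if "x $ 1 = a"
        using that unfolding normals[OF x(1)] by (simp add: axis_coords)
      moreover have "- axis 1 1 \<in> outer_unit_normals (rectangle a b) x" if "x $ 1 = 0"
        using that unfolding normals[OF x(1)] by (simp add: axis_coords)
      moreover have "axis 2 1 \<in> outer_unit_normals (rectangle a b) x" if "x $ 2 = b"
        using that unfolding normals[OF x(1)] by (simp add: axis_coords)
      moreover have "- axis 2 1 \<in> outer_unit_normals (rectangle a b) x" if "x $ 2 = 0"
        using that unfolding normals[OF x(1)] by (simp add: axis_coords)
      ultimately show ?thesis unfolding \<nu>(2) singleton_iff by metis
    qed
    have bounds: "0 \<le> x $ 1" "x $ 1 \<le> a" "0 \<le> x $ 2" "x $ 2 \<le> b"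
      using x(1) by (auto simp: mem_rectangle)
    consider "x $ 1 = a" | "x $ 1 = 0" | "x $ 2 = b" | "x $ 2 = 0"
      using x bounds unfolding mem_interior_rectangle by linarith
    then have "\<nu> \<in> axis_normals \<and> x \<in> open_segment (edge_start a b \<nu>) (edge_end a b \<nu>)"
    proof cases
      case 1
      then have \<nu>: "\<nu> = axis 1 1" using N by blast
      then have "x $ 2 \<noteq> b" "x $ 2 \<noteq> 0" using N axis_normals_distinct by auto
      then show ?thesis using 1 bounds unfolding \<nu> mem_edge[OF ab] by (simp add: axis_normals_def)
    next
      case 2
      then have \<nu>: "\<nu> = - axis 1 1" using N by blast
      then have "x $ 2 \<noteq> b" "x $ 2 \<noteq> 0" using N axis_normals_distinct by auto
      then show ?thesis using 2 bounds unfolding \<nu> mem_edge[OF ab] by (simp add: axis_normals_def)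
    next
      case 3
      then have \<nu>: "\<nu> = axis 2 1" using N by blast
      then have "x $ 1 \<noteq> a" "x $ 1 \<noteq> 0" using N axis_normals_distinct by auto
      then show ?thesis using 3 bounds unfolding \<nu> mem_edge[OF ab] by (simp add: axis_normals_def)
    next
      case 4
      then have \<nu>: "\<nu> = - axis 2 1" using N by blast
      then have "x $ 1 \<noteq> a" "x $ 1 \<noteq> 0" using N axis_normals_distinct by auto
      then show ?thesis using 4 bounds unfolding \<nu> mem_edge[OF ab] by (simp add: axis_normals_def)
    qed
    with \<nu>(1) show "x \<in> ?U" by blast
  }
  {
    assume "x \<in> ?U"
    then obtain \<nu> where \<nu>: "\<nu> \<in> \<omega>" "\<nu> \<in> axis_normals" "x \<in> open_segment (edge_start a b \<nu>) (edge_end a b \<nu>)"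
      by blast
    then show "x \<in> gauss_preimage (rectangle a b) \<omega>"
      using outer_unit_normals_edge[OF ab] unfolding gauss_preimage_def by blast
  }
qed

definition edge_length :: "real \<Rightarrow> real \<Rightarrow> real ^ 2 \<Rightarrow> real" where
  "edge_length a b \<nu> = (if \<nu> = axis 1 1 \<or> \<nu> = - axis 1 1 then b else a)"

lemma surface_area_measure_rectangle:
  assumes ab: "a > 0" "b > 0"
  shows "surface_area_measure (rectangle a b) \<omega> = (\<Sum>\<nu>\<in>\<omega> \<inter> axis_normals. ennreal (edge_length a b \<nu>))"
proof -
  have len: "dist (edge_start a b \<nu>) (edge_end a b \<nu>) = edge_length a b \<nu>" if "\<nu> \<in> axis_normals" for \<nu>
    using that unfolding axis_normals_def
  proof (elim insertE emptyE)
  qed (simp_all only: edge_start_def edge_end_def edge_length_def axis_normals_distinct if_True if_False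
      refl simp_thms, use ab in \<open>simp_all add: dist_norm norm_vec_def L2_set_def sum_2\<close>)
  have "hausdorff1 (\<Union>\<nu>\<in>\<omega> \<inter> axis_normals. open_segment (edge_start a b \<nu>) (edge_end a b \<nu>))
    = (\<Sum>\<nu>\<in>\<omega> \<inter> axis_normals. ennreal (dist (edge_start a b \<nu>) (edge_end a b \<nu>)))"
  proof (rule hausdorff1_Union_open_segments)
    show "finite (\<omega> \<inter> axis_normals)" by (simp add: axis_normals_def)
    show "edge_start a b \<nu> \<noteq> edge_end a b \<nu>" if "\<nu> \<in> \<omega> \<inter> axis_normals" for \<nu>
    proof -
      have "edge_length a b \<nu> > 0" using ab by (simp add: edge_length_def)
      then show ?thesis using len[of \<nu>] that by auto
    qed
    fix \<nu> \<nu>' assume \<nu>: "\<nu> \<in> \<omega> \<inter> axis_normals" "\<nu>' \<in> \<omega> \<inter> axis_normals" "\<nu> \<noteq> \<nu>'"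
    show "open_segment (edge_start a b \<nu>) (edge_end a b \<nu>) \<inter>
        open_segment (edge_start a b \<nu>') (edge_end a b \<nu>') = {}"
    proof (rule ccontr)
      assume "\<not> ?thesis"
      then obtain x where "x \<in> open_segment (edge_start a b \<nu>) (edge_end a b \<nu>)"
        "x \<in> open_segment (edge_start a b \<nu>') (edge_end a b \<nu>')" by blast
      then have "outer_unit_normals (rectangle a b) x = {\<nu>}" "outer_unit_normals (rectangle a b) x = {\<nu>'}"
        using outer_unit_normals_edge[OF ab] \<nu>(1,2) by simp_all
      then show False using \<nu>(3) by simp
    qed
  qed
  also have "\<dots> = (\<Sum>\<nu>\<in>\<omega> \<inter> axis_normals. ennreal (edge_length a b \<nu>))"
    using len by (intro sum.cong) auto
  finally show ?thesis
    by (simp add: surface_area_measure_def gauss_preimage_rectangle[OF ab])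
qed

lemma rectangle_solid:
  assumes "a > 0" "b > 0"
  shows "rectangle a b \<in> solid_convex_bodies"
proof -
  have "vector [a/2, b/2] \<in> interior (rectangle a b)" using assms by (simp add: mem_interior_rectangle)
  moreover from this have "vector [a/2, b/2] \<in> rectangle a b" using interior_subset by blast
  ultimately show ?thesis
    by (auto simp: solid_convex_bodies_def convex_bodies_def rectangle_def simp del: interior_cbox)
qed

text \<open>Both sides are sums of point masses at the same four normals, whose weights are the side
  lengths.\<close>

lemma is_blaschke_sum_rectangle:
  assumes "a > 0" "b > 0" "c > 0" "d > 0"
  shows "is_blaschke_sum (rectangle a b) (rectangle c d) (rectangle (a + c) (b + d))"
  unfolding is_blaschke_sum_def
proof (intro conjI allI impI)
  show "rectangle (a + c) (b + d) \<in> solid_convex_bodies" using assms by (intro rectangle_solid) auto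
  fix \<omega> :: "(real ^ 2) set"
  have "edge_length (a + c) (b + d) \<nu> = edge_length a b \<nu> + edge_length c d \<nu>" for \<nu>
    by (simp add: edge_length_def)
  moreover have "edge_length a b \<nu> \<ge> 0" "edge_length c d \<nu> \<ge> 0" for \<nu>
    using assms by (auto simp: edge_length_def)
  ultimately show "surface_area_measure (rectangle (a + c) (b + d)) \<omega> =
      surface_area_measure (rectangle a b) \<omega> + surface_area_measure (rectangle c d) \<omega>"
    using assms by (simp add: surface_area_measure_rectangle sum.distrib)
qed

text \<open>A point of the large rectangle is split, in each coordinate, in proportion to the side lengths.\<close>

lemma rectangle_plus_rectangle:
  assumes "a > 0" "b > 0" "c > 0" "d > 0"
  shows "rectangle a b + rectangle c d = rectangle (a + c) (b + d)"
proof (intro equalityI subsetI)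
  fix x assume "x \<in> rectangle a b + rectangle c d"
  then show "x \<in> rectangle (a + c) (b + d)"
    by (auto simp: set_plus_def mem_rectangle)
next
  fix x assume x: "x \<in> rectangle (a + c) (b + d)"
  let ?y = "vector [a / (a + c) * x $ 1, b / (b + d) * x $ 2] :: real ^ 2"
  let ?z = "vector [c / (a + c) * x $ 1, d / (b + d) * x $ 2] :: real ^ 2"
  have part: "0 \<le> s / (s + t) * y" "s / (s + t) * y \<le> s" "s / (s + t) * y + t / (s + t) * y = y"
    if "s > 0" "t > 0" "0 \<le> y" "y \<le> s + t" for s t y :: real
  proof -
    show "0 \<le> s / (s + t) * y" using that by simp
    have "s / (s + t) * y \<le> s / (s + t) * (s + t)" using that by (intro mult_left_mono) auto
    then show "s / (s + t) * y \<le> s" using that by simp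
    have "s / (s + t) + t / (s + t) = 1" using that by (simp flip: add_divide_distrib)
    then show "s / (s + t) * y + t / (s + t) * y = y" by (simp only: distrib_right[symmetric] mult_1_left)
  qed
  have "?y \<in> rectangle a b" "?z \<in> rectangle c d"
    using part[of a c "x $ 1"] part[of b d "x $ 2"] part[of c a "x $ 1"] part[of d b "x $ 2"] x assms
    by (auto simp: mem_rectangle add.commute)
  moreover have "x = ?y + ?z"
    using part(3)[of a c "x $ 1"] part(3)[of b d "x $ 2"] x assms
    by (auto simp: mem_rectangle vec_eq_iff forall_2)
  ultimately show "x \<in> rectangle a b + rectangle c d"
    by (metis set_plus_intro)
qed


section \<open>The counterexample\<close>

lemma lambda2_inv_sqrt_rectangle:
  assumes "a > 0" "b > 0"
  shows "lambda2_inv_sqrt (rectangle a b) =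
    min (rect_eigenvalue a b 2 1) (rect_eigenvalue a b 1 2) powr (- 1 / 2)"
proof -
  have "interior (rectangle a b) \<noteq> {}" using rectangle_solid[OF assms] by (simp add: solid_convex_bodies_def)
  then show ?thesis
    using lambda2_rectangle[OF assms] unfolding lambda2_inv_sqrt_def by (simp only: if_False real_of_ereal.simps)
qed

lemma square_powr_minus_half: "(c\<^sup>2) powr (- 1 / 2) = 1 / c" if "c > 0" for c :: real
  using that by (simp add: powr_minus_divide powr_half_sqrt)

text \<open>The side lengths 3 and 2 are chosen so that the eigenvalue \<open>\<pi>\<^sup>2 (4/9 + 1/4) = (5
  \<pi>/6)\<^sup>2\<close> has a rational multiple of \<open>\<pi>\<close> as its square root.\<close>

lemma lambda2_inv_sqrt_rectangle_3_2:
  "lambda2_inv_sqrt (rectangle 3 2) = 6 / (5 * pi)" "lambda2_inv_sqrt (rectangle 2 3) = 6 / (5 * pi)"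
proof -
  have 1: "rect_eigenvalue 3 2 2 1 = (5 * pi / 6)\<^sup>2" "rect_eigenvalue 2 3 1 2 = (5 * pi / 6)\<^sup>2"
    by (simp_all add: rect_eigenvalue_def field_simps power2_eq_square)
  have 2: "(5 * pi / 6)\<^sup>2 \<le> rect_eigenvalue 3 2 1 2" "(5 * pi / 6)\<^sup>2 \<le> rect_eigenvalue 2 3 2 1"
    by (simp_all add: rect_eigenvalue_def field_simps power2_eq_square)
  have "min (rect_eigenvalue 3 2 2 1) (rect_eigenvalue 3 2 1 2) = (5 * pi / 6)\<^sup>2"
    "min (rect_eigenvalue 2 3 2 1) (rect_eigenvalue 2 3 1 2) = (5 * pi / 6)\<^sup>2"
    using 1 2 by auto
  moreover have "((5 * pi / 6)\<^sup>2) powr (- 1 / 2) = 6 / (5 * pi)"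
    by (subst square_powr_minus_half) auto
  ultimately show "lambda2_inv_sqrt (rectangle 3 2) = 6 / (5 * pi)" "lambda2_inv_sqrt (rectangle 2 3) = 6 / (5 * pi)"
    by (simp_all only: lambda2_inv_sqrt_rectangle zero_less_numeral)
qed

text \<open>The eigenvalue is \<open>\<pi>\<^sup>2/5\<close>, and \<open>1/5 > (5/12)\<^sup>2\<close>.\<close>

lemma lambda2_inv_sqrt_square_5: "lambda2_inv_sqrt (rectangle 5 5) < 12 / (5 * pi)"
proof -
  have "(5 * pi / 12)\<^sup>2 < min (rect_eigenvalue 5 5 2 1) (rect_eigenvalue 5 5 1 2)"
    by (simp add: rect_eigenvalue_def field_simps power2_eq_square)
  then have "min (rect_eigenvalue 5 5 2 1) (rect_eigenvalue 5 5 1 2) powr (- 1 / 2) < ((5 * pi / 12)\<^sup>2) powr (- 1 / 2)"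
    by (intro powr_less_mono2_neg) auto
  also have "\<dots> = 12 / (5 * pi)"
    by (subst square_powr_minus_half) auto
  finally show ?thesis by (simp only: lambda2_inv_sqrt_rectangle zero_less_numeral)
qed

theorem proposition2p6:
  shows "(\<forall>(K :: (real ^ 2) set) (t :: real). K \<in> convex_bodies \<and> t > 0 \<longrightarrow>
            lambda2 ((\<lambda>x. t *\<^sub>R x) ` K) = ereal (t powr (- 2)) * lambda2 K) \<and>
         \<not> (\<forall>(K :: (real ^ 2) set) (L :: (real ^ 2) set).
              K \<in> convex_bodies \<and> L \<in> convex_bodies \<longrightarrow>
              lambda2_inv_sqrt (K + L) \<ge> lambda2_inv_sqrt K + lambda2_inv_sqrt L) \<and>
         \<not> (\<forall>(K :: (real ^ 2) set) (L :: (real ^ 2) set) (M :: (real ^ 2) set).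
              K \<in> solid_convex_bodies \<and> L \<in> solid_convex_bodies \<and> is_blaschke_sum K L M \<longrightarrow>
              lambda2_inv_sqrt M \<ge> lambda2_inv_sqrt K + lambda2_inv_sqrt L)"
proof (intro conjI)
  show "\<forall>(K :: (real ^ 2) set) (t :: real). K \<in> convex_bodies \<and> t > 0 \<longrightarrow>
            lambda2 ((\<lambda>x. t *\<^sub>R x) ` K) = ereal (t powr (- 2)) * lambda2 K"
    using lambda2_scale by blast
  have solid: "rectangle 3 2 \<in> solid_convex_bodies" "rectangle 2 3 \<in> solid_convex_bodies"
    by (simp_all add: rectangle_solid)
  then have conv: "rectangle 3 2 \<in> convex_bodies" "rectangle 2 3 \<in> convex_bodies"
    by (simp_all add: solid_convex_bodies_def)
  have less: "lambda2_inv_sqrt (rectangle 5 5) < lambda2_inv_sqrt (rectangle 3 2) + lambda2_inv_sqrt (rectangle 2 3)"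
    using lambda2_inv_sqrt_square_5 by (simp add: lambda2_inv_sqrt_rectangle_3_2)
  show "\<not> (\<forall>(K :: (real ^ 2) set) (L :: (real ^ 2) set).
              K \<in> convex_bodies \<and> L \<in> convex_bodies \<longrightarrow>
              lambda2_inv_sqrt (K + L) \<ge> lambda2_inv_sqrt K + lambda2_inv_sqrt L)"
  proof
    assume "\<forall>(K :: (real ^ 2) set) (L :: (real ^ 2) set).
              K \<in> convex_bodies \<and> L \<in> convex_bodies \<longrightarrow>
              lambda2_inv_sqrt (K + L) \<ge> lambda2_inv_sqrt K + lambda2_inv_sqrt L"
    then have "lambda2_inv_sqrt (rectangle 3 2 + rectangle 2 3) \<ge> lambda2_inv_sqrt (rectangle 3 2) + lambda2_inv_sqrt (rectangle 2 3)"
      using conv by blast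
    then show False using less rectangle_plus_rectangle[of 3 2 2 3] by simp
  qed
  have "is_blaschke_sum (rectangle 3 2) (rectangle 2 3) (rectangle 5 5)"
    using is_blaschke_sum_rectangle[of 3 2 2 3] by simp
  then show "\<not> (\<forall>(K :: (real ^ 2) set) (L :: (real ^ 2) set) (M :: (real ^ 2) set).
              K \<in> solid_convex_bodies \<and> L \<in> solid_convex_bodies \<and> is_blaschke_sum K L M \<longrightarrow>
              lambda2_inv_sqrt M \<ge> lambda2_inv_sqrt K + lambda2_inv_sqrt L)"
    using solid less by (meson not_le)
qed

end
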